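(* Let $n\geq 3$. There are uncountably many polar, non-hyperpolar actions on the complex hyperbolic space $\mathbb{C}H^n$ up to orbit equivalence.
   Context: A proper isometric action of a connected Lie group $H$ on a Riemannian manifold $M$ is called polar if there is an immersed connected submanifold $\Sigma$ of $M$ (a section) that intersects all orbits and satisfies $T_p\Sigma\perp T_p(H\cdot p)$ for every $p\in\Sigma$. It is called hyperpolar if moreover the section is flat in its induced Riemannian metric. Two isometric Lie group actions on $M$ and $N$ are orbit equivalent if there is an isometry $M\to N$ mapping connected components of orbits onto connected components of orbits. $\mathbb{C}H^n$ carries its standard metric of constant holomorphic sectional curvature $-1$. *)

theory Defs
  imports "HOL-Analysis.Analysis" "HOL-Algebra.Group_Action"
begin

section \<open>Smooth maps between open subsets of Euclidean spaces\<close>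

text \<open>
  Since dimensions of Lie groups and of submanifolds are existentially quantified, they cannot be
  types. The space of real \<open>d\<close>-tuples is therefore the topological space
  \<^term>\<open>Euclidean_space d\<close>: functions \<open>nat \<Rightarrow> real\<close> vanishing at all indices \<open>\<ge> d\<close>.
\<close>

abbreviation Rn :: "nat \<Rightarrow> (nat \<Rightarrow> real) set" where
  "Rn d \<equiv> topspace (Euclidean_space d)"

definition partial :: "nat \<Rightarrow> ((nat \<Rightarrow> real) \<Rightarrow> real) \<Rightarrow> (nat \<Rightarrow> real) \<Rightarrow> real" where
  "partial i f x = deriv (\<lambda>t. f (x(i := t))) (x i)"

text \<open>Meaningful for \<open>U\<close> open in \<^term>\<open>Euclidean_space d\<close>; values of \<open>f\<close> off \<open>U\<close> are irrelevant.\<close>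

primrec Ck_on :: "nat \<Rightarrow> nat \<Rightarrow> (nat \<Rightarrow> real) set \<Rightarrow> ((nat \<Rightarrow> real) \<Rightarrow> real) \<Rightarrow> bool" where
  "Ck_on 0 d U f \<longleftrightarrow> continuous_map (subtopology (Euclidean_space d) U) euclideanreal f"
| "Ck_on (Suc k) d U f \<longleftrightarrow>
     continuous_map (subtopology (Euclidean_space d) U) euclideanreal f \<and>
     (\<forall>i<d. (\<forall>x\<in>U. (\<lambda>t. f (x(i := t))) differentiable (at (x i))) \<and>
            Ck_on k d U (partial i f))"

definition smooth_coord ::
    "nat \<Rightarrow> (nat \<Rightarrow> real) set \<Rightarrow> nat \<Rightarrow> ((nat \<Rightarrow> real) \<Rightarrow> (nat \<Rightarrow> real)) \<Rightarrow> bool" where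
  "smooth_coord d U m F \<longleftrightarrow> (\<forall>j<m. \<forall>k. Ck_on k d U (\<lambda>x. F x j))"

definition jacobian ::
    "nat \<Rightarrow> nat \<Rightarrow> ((nat \<Rightarrow> real) \<Rightarrow> (nat \<Rightarrow> real)) \<Rightarrow> (nat \<Rightarrow> real) \<Rightarrow> (nat \<Rightarrow> real) \<Rightarrow> (nat \<Rightarrow> real)" where
  "jacobian d m F x v = (\<lambda>j. if j < m then \<Sum>i<d. v i * partial i (\<lambda>y. F y j) x else 0)"

section \<open>Smooth manifolds and Lie groups\<close>

record 'a manifold =
  mtop :: "'a topology"
  mdim :: nat
  atlas :: "('a set \<times> ('a \<Rightarrow> nat \<Rightarrow> real)) set"

abbreviation points :: "('a, 'z) manifold_scheme \<Rightarrow> 'a set" where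
  "points M \<equiv> topspace (mtop M)"

definition chart :: "'a topology \<Rightarrow> nat \<Rightarrow> 'a set \<times> ('a \<Rightarrow> nat \<Rightarrow> real) \<Rightarrow> bool" where
  "chart T d = (\<lambda>(U, \<phi>). openin T U \<and> openin (Euclidean_space d) (\<phi> ` U) \<and>
     homeomorphic_map (subtopology T U) (subtopology (Euclidean_space d) (\<phi> ` U)) \<phi>)"

definition transition_smooth ::
    "nat \<Rightarrow> 'a set \<times> ('a \<Rightarrow> nat \<Rightarrow> real) \<Rightarrow> 'a set \<times> ('a \<Rightarrow> nat \<Rightarrow> real) \<Rightarrow> bool" where
  "transition_smooth d = (\<lambda>(U, \<phi>) (V, \<psi>).
     smooth_coord d (\<phi> ` (U \<inter> V)) d (\<psi> \<circ> inv_into U \<phi>))"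

definition smooth_manifold :: "'a manifold \<Rightarrow> bool" where
  "smooth_manifold M \<longleftrightarrow>
     Hausdorff_space (mtop M) \<and> second_countable (mtop M) \<and>
     (\<forall>c\<in>atlas M. chart (mtop M) (mdim M) c) \<and>
     (\<Union>(U, \<phi>)\<in>atlas M. U) = points M \<and>
     (\<forall>c\<in>atlas M. \<forall>c'\<in>atlas M. transition_smooth (mdim M) c c')"

text \<open>Membership in the maximal atlas:\<close>

definition compatible_chart :: "'a manifold \<Rightarrow> 'a set \<times> ('a \<Rightarrow> nat \<Rightarrow> real) \<Rightarrow> bool" where
  "compatible_chart M c \<longleftrightarrow> chart (mtop M) (mdim M) c \<and>
     (\<forall>c'\<in>atlas M. transition_smooth (mdim M) c c' \<and> transition_smooth (mdim M) c' c)"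

definition smooth_map :: "'a manifold \<Rightarrow> 'b manifold \<Rightarrow> ('a \<Rightarrow> 'b) \<Rightarrow> bool" where
  "smooth_map M N f \<longleftrightarrow> continuous_map (mtop M) (mtop N) f \<and>
     (\<forall>(U, \<phi>)\<in>atlas M. \<forall>(V, \<psi>)\<in>atlas N.
        smooth_coord (mdim M) (\<phi> ` (U \<inter> f -` V)) (mdim N) (\<psi> \<circ> f \<circ> inv_into U \<phi>))"

definition prod_manifold :: "'a manifold \<Rightarrow> 'b manifold \<Rightarrow> ('a \<times> 'b) manifold" where
  "prod_manifold M N =
     \<lparr> mtop = prod_topology (mtop M) (mtop N),
       mdim = mdim M + mdim N,
       atlas = {(U \<times> V, \<lambda>(x, y) i. if i < mdim M then \<phi> x i else \<psi> y (i - mdim M)) |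
                U \<phi> V \<psi>. (U, \<phi>) \<in> atlas M \<and> (V, \<psi>) \<in> atlas N} \<rparr>"

definition lie_group :: "'g monoid \<Rightarrow> 'g manifold \<Rightarrow> bool" where
  "lie_group G L \<longleftrightarrow> group G \<and> smooth_manifold L \<and> points L = carrier G \<and>
     smooth_map (prod_manifold L L) L (\<lambda>(g, h). g \<otimes>\<^bsub>G\<^esub> h) \<and>
     smooth_map L L (\<lambda>g. inv\<^bsub>G\<^esub> g)"

section \<open>Riemannian manifolds with one global chart\<close>

text \<open>
  An open subset of a Euclidean space with a metric tensor; its tangent spaces are all identified
  with \<open>Rn\<close> of the dimension. This suffices for complex hyperbolic space.
\<close>

record riem_domain =
  rdim :: nat
  rset :: "(nat \<Rightarrow> real) set"
  rmetric :: "(nat \<Rightarrow> real) \<Rightarrow> (nat \<Rightarrow> real) \<Rightarrow> (nat \<Rightarrow> real) \<Rightarrow> real"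

definition riem_manifold :: "riem_domain \<Rightarrow> (nat \<Rightarrow> real) manifold" where
  "riem_manifold R =
     \<lparr> mtop = subtopology (Euclidean_space (rdim R)) (rset R),
       mdim = rdim R,
       atlas = {(rset R, \<lambda>x. x)} \<rparr>"

definition isometry :: "riem_domain \<Rightarrow> riem_domain \<Rightarrow> ((nat \<Rightarrow> real) \<Rightarrow> (nat \<Rightarrow> real)) \<Rightarrow> bool" where
  "isometry R R' f \<longleftrightarrow>
     bij_betw f (rset R) (rset R') \<and>
     smooth_map (riem_manifold R) (riem_manifold R') f \<and>
     smooth_map (riem_manifold R') (riem_manifold R) (inv_into (rset R) f) \<and>
     (\<forall>p\<in>rset R. \<forall>v\<in>Rn (rdim R). \<forall>w\<in>Rn (rdim R).
        rmetric R' (f p) (jacobian (rdim R) (rdim R') f p v) (jacobian (rdim R) (rdim R') f p w)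
          = rmetric R p v w)"

text \<open>
  The image of the tangent space at \<open>s\<close> of a manifold \<open>S\<close> under the differential of a map
  \<open>\<iota>\<close> from \<open>S\<close> to a domain in \<open>Rn m\<close>. For smooth \<open>\<iota>\<close> it is independent of the chart around \<open>s\<close>.
\<close>

definition tangent_image ::
    "'a manifold \<Rightarrow> nat \<Rightarrow> ('a \<Rightarrow> nat \<Rightarrow> real) \<Rightarrow> 'a \<Rightarrow> (nat \<Rightarrow> real) set" where
  "tangent_image S m \<iota> s =
     {jacobian (mdim S) m (\<iota> \<circ> inv_into U \<phi>) (\<phi> s) v | U \<phi> v.
        (U, \<phi>) \<in> atlas S \<and> s \<in> U \<and> v \<in> Rn (mdim S)}"

text \<open>
  An immersed submanifold is a subset with its own manifold structure (whose topology may be finer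
  than the subspace topology) for which the inclusion is an immersion.
\<close>

definition immersed_submanifold :: "riem_domain \<Rightarrow> (nat \<Rightarrow> real) manifold \<Rightarrow> bool" where
  "immersed_submanifold R S \<longleftrightarrow>
     smooth_manifold S \<and> points S \<subseteq> rset R \<and>
     smooth_map S (riem_manifold R) (\<lambda>x. x) \<and>
     (\<forall>(U, \<phi>)\<in>atlas S. \<forall>s\<in>U.
        inj_on (jacobian (mdim S) (rdim R) (inv_into U \<phi>) (\<phi> s)) (Rn (mdim S)))"

definition tangent_space ::
    "riem_domain \<Rightarrow> (nat \<Rightarrow> real) manifold \<Rightarrow> (nat \<Rightarrow> real) \<Rightarrow> (nat \<Rightarrow> real) set" where
  "tangent_space R S p = tangent_image S (rdim R) (\<lambda>x. x) p"

text \<open>Flatness of the induced metric: every point has a neighbourhood isometric to an open subset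
  of a Euclidean space.\<close>

definition flat_submanifold :: "riem_domain \<Rightarrow> (nat \<Rightarrow> real) manifold \<Rightarrow> bool" where
  "flat_submanifold R S \<longleftrightarrow>
     (\<forall>s\<in>points S. \<exists>U \<psi>. s \<in> U \<and> compatible_chart S (U, \<psi>) \<and>
        (\<forall>p\<in>U. \<forall>v\<in>Rn (mdim S). \<forall>w\<in>Rn (mdim S).
           rmetric R p (jacobian (mdim S) (rdim R) (inv_into U \<psi>) (\<psi> p) v)
                       (jacobian (mdim S) (rdim R) (inv_into U \<psi>) (\<psi> p) w)
             = (\<Sum>i<mdim S. v i * w i)))"

section \<open>Polar and hyperpolar actions\<close>

record 'g lie_action =
  grp :: "'g monoid"
  lie :: "'g manifold"
  act :: "'g \<Rightarrow> (nat \<Rightarrow> real) \<Rightarrow> (nat \<Rightarrow> real)"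

abbreviation orbit_of :: "'g lie_action \<Rightarrow> (nat \<Rightarrow> real) \<Rightarrow> (nat \<Rightarrow> real) set" where
  "orbit_of A p \<equiv> orbit (grp A) (act A) p"

definition proper_isometric_action :: "riem_domain \<Rightarrow> 'g lie_action \<Rightarrow> bool" where
  "proper_isometric_action R A \<longleftrightarrow>
     lie_group (grp A) (lie A) \<and> connected_space (mtop (lie A)) \<and>
     group_action (grp A) (rset R) (act A) \<and>
     smooth_map (prod_manifold (lie A) (riem_manifold R)) (riem_manifold R) (\<lambda>(g, p). act A g p) \<and>
     (\<forall>g\<in>carrier (grp A). isometry R R (act A g)) \<and>
     proper_map (prod_topology (mtop (lie A)) (mtop (riem_manifold R)))
                (prod_topology (mtop (riem_manifold R)) (mtop (riem_manifold R)))
                (\<lambda>(g, p). (act A g p, p))"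

text \<open>The orbit map at \<open>p\<close> has constant rank, so the tangent space at \<open>p\<close> of the orbit is the image
  of its differential at the identity.\<close>

definition orbit_tangent_space ::
    "riem_domain \<Rightarrow> 'g lie_action \<Rightarrow> (nat \<Rightarrow> real) \<Rightarrow> (nat \<Rightarrow> real) set" where
  "orbit_tangent_space R A p = tangent_image (lie A) (rdim R) (\<lambda>g. act A g p) \<one>\<^bsub>grp A\<^esub>"

definition is_section :: "riem_domain \<Rightarrow> 'g lie_action \<Rightarrow> (nat \<Rightarrow> real) manifold \<Rightarrow> bool" where
  "is_section R A S \<longleftrightarrow>
     immersed_submanifold R S \<and> connected_space (mtop S) \<and>
     (\<forall>p\<in>rset R. points S \<inter> orbit_of A p \<noteq> {}) \<and>
     (\<forall>p\<in>points S. \<forall>v\<in>tangent_space R S p. \<forall>w\<in>orbit_tangent_space R A p. rmetric R p v w = 0)"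

definition polar :: "riem_domain \<Rightarrow> 'g lie_action \<Rightarrow> bool" where
  "polar R A \<longleftrightarrow> proper_isometric_action R A \<and> (\<exists>S. is_section R A S)"

definition hyperpolar :: "riem_domain \<Rightarrow> 'g lie_action \<Rightarrow> bool" where
  "hyperpolar R A \<longleftrightarrow>
     proper_isometric_action R A \<and> (\<exists>S. is_section R A S \<and> flat_submanifold R S)"

definition orbit_components :: "riem_domain \<Rightarrow> 'g lie_action \<Rightarrow> (nat \<Rightarrow> real) set set" where
  "orbit_components R A =
     (\<Union>p\<in>rset R. connected_components_of (subtopology (mtop (riem_manifold R)) (orbit_of A p)))"

definition orbit_equivalent ::
    "riem_domain \<Rightarrow> 'g lie_action \<Rightarrow> riem_domain \<Rightarrow> 'h lie_action \<Rightarrow> bool" where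
  "orbit_equivalent R A R' B \<longleftrightarrow>
     (\<exists>f. isometry R R' f \<and> (\<lambda>C. f ` C) ` orbit_components R A = orbit_components R' B)"

section \<open>Complex hyperbolic space\<close>

definition cplx :: "(nat \<Rightarrow> real) \<Rightarrow> nat \<Rightarrow> complex" where
  "cplx x j = Complex (x (2 * j)) (x (2 * j + 1))"

definition herm :: "nat \<Rightarrow> (nat \<Rightarrow> real) \<Rightarrow> (nat \<Rightarrow> real) \<Rightarrow> complex" where
  "herm n v w = (\<Sum>j<n. cplx v j * cnj (cplx w j))"

text \<open>
  The unit ball model with its Bergman metric. The factor \<open>4\<close> normalises the holomorphic sectional
  curvature to \<open>-1\<close>: on a complex line through the origin the metric is
  \<open>4 \<bar>dz\<bar>\<^sup>2 / (1 - \<bar>z\<bar>\<^sup>2)\<^sup>2\<close>, the Poincare disc of curvature \<open>-1\<close>.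
\<close>

definition CH :: "nat \<Rightarrow> riem_domain" where
  "CH n =
     \<lparr> rdim = 2 * n,
       rset = {z \<in> Rn (2 * n). (\<Sum>i<2 * n. (z i)\<^sup>2) < 1},
       rmetric = (\<lambda>z v w. 4 * Re (herm n v w / (1 - herm n z z) +
                                  herm n v z * herm n z w / (1 - herm n z z)\<^sup>2)) \<rparr>"

section \<open>Actions up to orbit equivalence\<close>

text \<open>
  Second countable Lie groups have at most continuum many elements, so every one of them is
  isomorphic to one whose elements are drawn from the type \<open>nat \<Rightarrow> real\<close>; this type serves as
  the universe of group elements, so that the actions form a set.
\<close>

definition polar_nonhyperpolar_actions :: "riem_domain \<Rightarrow> (nat \<Rightarrow> real) lie_action set" where
  "polar_nonhyperpolar_actions R = {A. polar R A \<and> \<not> hyperpolar R A}"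

definition orbit_equivalence ::
    "riem_domain \<Rightarrow> ((nat \<Rightarrow> real) lie_action \<times> (nat \<Rightarrow> real) lie_action) set" where
  "orbit_equivalence R = {(A, B). A \<in> polar_nonhyperpolar_actions R \<and>
     B \<in> polar_nonhyperpolar_actions R \<and> orbit_equivalent R A R B}"

end

theory Submission imports Defs begin

text \<open>
  In Siegel coordinates \<open>(\<omega>, \<zeta>)\<close> let \<open>P\<close> be a real plane in the \<open>\<zeta>\<close>-space whose Kaehler angle has
  cosine \<open>k\<close>, where \<open>0 < k < 1\<close>. The horospherical translations orthogonal to \<open>P\<close>, the centre of the
  Heisenberg group and a circle of unitary maps rotating \<open>P\<close> generate a group whose orbits are the
  joint level sets of the height and of the norm of the \<open>P\<close>-component of \<open>\<zeta>\<close>. The action is polar, with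
  a totally real hyperbolic plane as a section. For any section, these two invariants written in
  flat coordinates would satisfy an overdetermined system without solutions, so the action is not
  hyperpolar. An orbit equivalence preserves the Riemannian distance; the nearest points of an
  orbit to a point of a singular orbit form a circle in \<open>P\<close>, and the distances between its points
  recover \<open>k\<close>.
\<close>

section \<open>Calculus on open subsets of \<open>Rn d\<close>\<close>

text \<open>Failing to be hyperpolar concerns every section, so neither the shape nor the dimension
  of a section may be assumed. What any section supplies is its values under the two orbit
  invariants: they fill a quarter plane, which bounds its dimension from below, while the few
  vectors normal to the orbits bound it from above. With \<open>p\<close> the squared norm of the
  plane component and \<open>y\<close> the height, the induced metric can then only be
  \<open>dp\<^sup>2 / (p y) + dy\<^sup>2 / y\<^sup>2\<close>. The plane of all
  \<open>(al z, be cnj z)\<close> with \<open>al\<^sup>2 + be\<^sup>2 = 1\<close> carries the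
  Euclidean metric, and the Kaehler form restricts to \<open>al\<^sup>2 - be\<^sup>2\<close> times
  its area form; this factor is the cosine. The plane needs two complex \<zeta>-coordinates, hence
  \<open>n \<ge> 3\<close>. Isometries are given as smooth bijections preserving the metric tensor,
  so their effect on distances has to be established. This is done for \<open>rho\<close>, the
  squared hyperbolic cosine of half the distance, by comparison with radial curves from the
  origin.\<close>

declare fun_upd_apply [simp del]

lemma Rn_eq: "Rn d = {x. \<forall>i\<ge>d. x i = 0}"
  by (simp add: topspace_Euclidean_space)

lemma Rn_iff: "x \<in> Rn d \<longleftrightarrow> (\<forall>i\<ge>d. x i = 0)"
  by (simp add: topspace_Euclidean_space)

lemma Euclidean_space_eq: "Euclidean_space d = top_of_set {x. \<forall>i\<ge>d. x i = 0}"
  by (simp add: Euclidean_space_def euclidean_product_topology)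

lemma openin_Rn: "openin (Euclidean_space d) U \<longleftrightarrow> (\<exists>T. open T \<and> U = Rn d \<inter> T)"
  by (auto simp: Rn_eq) (auto simp: Euclidean_space_eq openin_open)

lemma openin_Rn_subset: "openin (Euclidean_space d) U \<Longrightarrow> U \<subseteq> Rn d"
  by (rule openin_subset)

lemma subtopology_Rn:
  "U \<subseteq> Rn d \<Longrightarrow> subtopology (Euclidean_space d) U = top_of_set U"
  by (auto simp: Rn_eq Euclidean_space_eq subtopology_subtopology Int_absorb1)

lemma continuous_map_Rn:
  "U \<subseteq> Rn d \<Longrightarrow> continuous_map (subtopology (Euclidean_space d) U) euclideanreal f \<longleftrightarrow> continuous_on U f"
  by (simp add: subtopology_Rn)

lemma tendsto_fun:
  fixes f :: "'b \<Rightarrow> 'a \<Rightarrow> real"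
  assumes "\<And>i. ((\<lambda>s. f s i) \<longlongrightarrow> l i) F"
  shows "(f \<longlongrightarrow> l) F"
proof -
  have "limitin (product_topology (\<lambda>i. euclideanreal) UNIV) f l F"
    by (simp add: limitin_componentwise assms)
  then show ?thesis
    by (simp add: euclidean_product_topology)
qed

text \<open>\<open>U\<close> is open only relative to \<open>Rn d\<close>, which has no interior in
  the space of all sequences; hence the separate hypothesis that the values of \<open>c\<close>
  eventually lie in \<open>Rn d\<close>.\<close>

lemma eventually_in_open:
  assumes U: "openin (Euclidean_space d) U" and "x \<in> U"
    and c: "(c \<longlongrightarrow> x) F" and R: "eventually (\<lambda>s. c s \<in> Rn d) F"
  shows "eventually (\<lambda>s. c s \<in> U) F"
proof -
  obtain T where T: "open T" "U = Rn d \<inter> T"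
    using U openin_Rn by blast
  have "eventually (\<lambda>s. c s \<in> T) F"
    using c T assms(2) topological_tendstoD by blast
  with R show ?thesis
    by eventually_elim (simp add: T)
qed

lemma upd_in_Rn: "x \<in> Rn d \<Longrightarrow> i < d \<Longrightarrow> x(i := t) \<in> Rn d"
  by (auto simp: Rn_iff fun_upd_apply)

lemma tendsto_upd: "((\<lambda>t. x(i := t)) \<longlongrightarrow> x) (nhds (x i))"
  for x :: "'a \<Rightarrow> real"
proof (rule tendsto_fun)
  fix j
  show "((\<lambda>t. (x(i := t)) j) \<longlongrightarrow> x j) (nhds (x i))"
    by (cases "j = i") (auto simp: filterlim_ident fun_upd_apply)
qed

lemma eventually_upd:
  assumes "openin (Euclidean_space d) U" "x \<in> U" "i < d"
  shows "eventually (\<lambda>t. x(i := t) \<in> U) (nhds (x i))"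
  using assms openin_Rn_subset[OF assms(1)]
  by (intro eventually_in_open[OF assms(1,2) tendsto_upd] always_eventually allI upd_in_Rn) auto

lemma DERIV_upd_cong:
  assumes "openin (Euclidean_space d) U" "x \<in> U" "i < d" "\<And>y. y \<in> U \<Longrightarrow> f y = g y"
  shows "((\<lambda>t. f (x(i := t))) has_real_derivative D) (at (x i)) \<longleftrightarrow>
         ((\<lambda>t. g (x(i := t))) has_real_derivative D) (at (x i))"
proof (rule DERIV_cong_ev)
  show "eventually (\<lambda>t. f (x(i := t)) = g (x(i := t))) (nhds (x i))"
    using eventually_upd[OF assms(1-3)] by eventually_elim (simp add: assms(4))
qed auto

lemma partial_eqI:
  "((\<lambda>t. f (x(i := t))) has_real_derivative D) (at (x i)) \<Longrightarrow> partial i f x = D"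
  unfolding partial_def by (rule DERIV_imp_deriv)

lemma partial_cong:
  assumes "openin (Euclidean_space d) U" "x \<in> U" "i < d" "\<And>y. y \<in> U \<Longrightarrow> f y = g y"
  shows "partial i f x = partial i g x"
  unfolding partial_def
proof (rule deriv_cong_ev)
  show "eventually (\<lambda>t. f (x(i := t)) = g (x(i := t))) (nhds (x i))"
    using eventually_upd[OF assms(1-3)] by eventually_elim (simp add: assms(4))
qed auto

lemma Ck_imp_continuous_on: "U \<subseteq> Rn d \<Longrightarrow> Ck_on k d U f \<Longrightarrow> continuous_on U f"
  by (cases k) (auto simp: continuous_map_Rn)

lemma has_partial:
  assumes "Ck_on (Suc k) d U f" "x \<in> U" "i < d"
  shows "((\<lambda>t. f (x(i := t))) has_real_derivative partial i f x) (at (x i))"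
  using assms unfolding partial_def by (simp add: DERIV_deriv_iff_real_differentiable)

lemma Ck_partial: "Ck_on (Suc k) d U f \<Longrightarrow> i < d \<Longrightarrow> Ck_on k d U (partial i f)"
  by simp

text \<open>\<open>partial\<close> differentiates total functions. Agreement on \<open>U\<close>
  passes to the partials because a coordinate line through a point of the open set \<open>U\<close>
  stays in \<open>U\<close> for a while.\<close>

lemma Ck_cong:
  assumes "openin (Euclidean_space d) U" "\<And>x. x \<in> U \<Longrightarrow> f x = g x" "Ck_on k d U f"
  shows "Ck_on k d U g"
  using assms(2,3)
proof (induction k arbitrary: f g)
  case 0
  then show ?case
    using continuous_map_Rn[OF openin_Rn_subset[OF assms(1)]] continuous_on_cong by (metis Ck_on.simps(1))
next
  case (Suc k)
  have "continuous_on U f"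
    using Suc.prems(2) continuous_map_Rn[OF openin_Rn_subset[OF assms(1)]] by auto
  then have "continuous_on U g"
    using Suc.prems(1) continuous_on_cong by (metis (no_types, lifting))
  moreover have "(\<lambda>t. g (x(i := t))) differentiable (at (x i))" if "i < d" "x \<in> U" for i x
    using has_partial[OF Suc.prems(2) that(2,1)]
      DERIV_upd_cong[OF assms(1) that(2,1), of f g, OF Suc.prems(1)]
    by (auto simp: real_differentiable_def)
  moreover have "Ck_on k d U (partial i g)" if "i < d" for i
  proof (rule Suc.IH)
    show "Ck_on k d U (partial i f)"
      using Suc.prems(2) that by simp
    show "partial i f x = partial i g x" if "x \<in> U" for x
      using partial_cong[OF assms(1) that \<open>i < d\<close>] Suc.prems(1) by blast
  qed
  ultimately show ?case
    using continuous_map_Rn[OF openin_Rn_subset[OF assms(1)]] by simp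
qed

text \<open>The candidates \<open>g i\<close> have to be the partials on \<open>U\<close> only. Most
  closure properties below apply this with \<open>g\<close> read off from the corresponding calculus
  rule.\<close>

lemma Ck_SucI:
  assumes U: "openin (Euclidean_space d) U" and "continuous_on U f"
    and "\<And>i x. i < d \<Longrightarrow> x \<in> U \<Longrightarrow>
          ((\<lambda>t. f (x(i := t))) has_real_derivative g i x) (at (x i))"
    and "\<And>i. i < d \<Longrightarrow> Ck_on k d U (g i)"
  shows "Ck_on (Suc k) d U f"
proof -
  have "Ck_on k d U (partial i f)" if "i < d" for i
    by (rule Ck_cong[OF U _ assms(4)[OF that]]) (rule partial_eqI[OF assms(3)[OF that], symmetric])
  then show ?thesis
    using assms continuous_map_Rn[OF openin_Rn_subset[OF U]]
    by (auto simp: real_differentiable_def)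
qed

lemma Ck_mono: "V \<subseteq> U \<Longrightarrow> Ck_on k d U f \<Longrightarrow> Ck_on k d V f"
  by (induction k arbitrary: f) (auto intro: continuous_map_from_subtopology_mono)

lemma Ck_Suc_imp: "Ck_on (Suc k) d U f \<Longrightarrow> Ck_on k d U f"
  by (induction k arbitrary: f) auto

lemma Ck_const: "openin (Euclidean_space d) U \<Longrightarrow> Ck_on k d U (\<lambda>x. a)"
proof (induction k arbitrary: a)
  case 0
  then show ?case by (simp add: continuous_map_Rn openin_Rn_subset)
next
  case (Suc k)
  show ?case
    by (rule Ck_SucI[OF Suc.prems, where g = "\<lambda>i x. 0"]) (use Suc in auto)
qed

lemma Ck_coord: "openin (Euclidean_space d) U \<Longrightarrow> Ck_on k d U (\<lambda>x. x i)"
proof (cases k)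
  case 0
  assume "openin (Euclidean_space d) U"
  moreover have "continuous_on U (\<lambda>x. x i)"
    by (rule continuous_on_subset[OF continuous_on_product_coordinates subset_UNIV])
  ultimately show ?thesis
    by (simp add: continuous_map_Rn openin_Rn_subset 0)
next
  case (Suc k')
  assume U: "openin (Euclidean_space d) U"
  have c: "continuous_on U (\<lambda>x. x i)"
    by (rule continuous_on_subset[OF continuous_on_product_coordinates subset_UNIV])
  have *: "((\<lambda>t. (x(j := t)) i) has_real_derivative (if i = j then 1 else 0)) (at (x j))" for j and x :: "nat \<Rightarrow> real"
    by (cases "i = j") (auto simp: fun_upd_apply)
  show ?thesis unfolding Suc
    by (rule Ck_SucI[OF U, where g = "\<lambda>j x. if i = j then 1 else 0"]) (use c * Ck_const[OF U] in auto)
qed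

lemma Ck_add:
  assumes U: "openin (Euclidean_space d) U"
  shows "Ck_on k d U f \<Longrightarrow> Ck_on k d U g \<Longrightarrow> Ck_on k d U (\<lambda>x. f x + g x)"
proof (induction k arbitrary: f g)
  case 0
  then show ?case
    using continuous_map_Rn[OF openin_Rn_subset[OF U]] by (auto intro: continuous_on_add)
next
  case (Suc k)
  note c = Suc.prems[THEN Ck_imp_continuous_on[OF openin_Rn_subset[OF U]]]
  show ?case
    by (rule Ck_SucI[OF U, where g = "\<lambda>i x. partial i f x + partial i g x"])
      (use Suc.prems Suc.IH c has_partial in \<open>auto intro!: continuous_on_add DERIV_add\<close>)
qed

lemma Ck_mult:
  assumes U: "openin (Euclidean_space d) U"
  shows "Ck_on k d U f \<Longrightarrow> Ck_on k d U g \<Longrightarrow> Ck_on k d U (\<lambda>x. f x * g x)"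
proof (induction k arbitrary: f g)
  case 0
  then show ?case
    using continuous_map_Rn[OF openin_Rn_subset[OF U]] by (auto intro: continuous_on_mult)
next
  case (Suc k)
  note c = Suc.prems[THEN Ck_imp_continuous_on[OF openin_Rn_subset[OF U]]]
  show ?case
  proof (rule Ck_SucI[OF U, where g = "\<lambda>i x. partial i f x * g x + partial i g x * f x"])
    show "((\<lambda>t. f (x(i := t)) * g (x(i := t))) has_real_derivative
           partial i f x * g x + partial i g x * f x) (at (x i))" if "i < d" "x \<in> U" for i x
      using DERIV_mult[OF has_partial[OF Suc.prems(1) that(2,1)] has_partial[OF Suc.prems(2) that(2,1)]]
      by simp
    show "Ck_on k d U (\<lambda>x. partial i f x * g x + partial i g x * f x)" if "i < d" for i
      by (rule Ck_add[OF U Suc.IH Suc.IH]) (use Suc.prems that Ck_Suc_imp Ck_partial in metis)+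
    show "continuous_on U (\<lambda>x. f x * g x)"
      by (rule continuous_on_mult) (rule c)+
  qed
qed

lemma Ck_sum:
  assumes U: "openin (Euclidean_space d) U"
  shows "(\<And>j. j \<in> A \<Longrightarrow> Ck_on k d U (f j)) \<Longrightarrow> Ck_on k d U (\<lambda>x. \<Sum>j\<in>A. f j x)"
  by (induction A rule: infinite_finite_induct) (auto intro: Ck_const[OF U] Ck_add[OF U])

lemma Ck_uminus: "openin (Euclidean_space d) U \<Longrightarrow> Ck_on k d U f \<Longrightarrow> Ck_on k d U (\<lambda>x. - f x)"
  using Ck_mult[OF _ Ck_const[of d U k "-1"]] by auto

lemma Ck_inverse:
  assumes U: "openin (Euclidean_space d) U" and nz: "\<And>x. x \<in> U \<Longrightarrow> f x \<noteq> 0"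
  shows "Ck_on k d U f \<Longrightarrow> Ck_on k d U (\<lambda>x. inverse (f x))"
proof (induction k)
  case 0
  then show ?case
    using continuous_map_Rn[OF openin_Rn_subset[OF U]] nz by (auto intro: continuous_on_inverse)
next
  case (Suc k)
  note c = Suc.prems[THEN Ck_imp_continuous_on[OF openin_Rn_subset[OF U]]]
  show ?case
  proof (rule Ck_SucI[OF U, where g = "\<lambda>i x. - (inverse (f x) * partial i f x * inverse (f x))"])
    show "((\<lambda>t. inverse (f (x(i := t)))) has_real_derivative
           - (inverse (f x) * partial i f x * inverse (f x))) (at (x i))" if "i < d" "x \<in> U" for i x
      using DERIV_inverse'[OF has_partial[OF Suc.prems that(2,1)]] nz[OF that(2)] by simp
    show "Ck_on k d U (\<lambda>x. - (inverse (f x) * partial i f x * inverse (f x)))" if "i < d" for i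
      using Suc.prems that Ck_Suc_imp[OF Suc.prems] Suc.IH
      by (intro Ck_uminus[OF U] Ck_mult[OF U] Suc.IH) auto
  qed (use nz c in \<open>auto intro: continuous_on_inverse\<close>)
qed

lemma Ck_exp:
  assumes U: "openin (Euclidean_space d) U"
  shows "Ck_on k d U f \<Longrightarrow> Ck_on k d U (\<lambda>x. exp (f x))"
proof (induction k)
  case 0
  then show ?case
    using continuous_map_Rn[OF openin_Rn_subset[OF U]] by (auto intro: continuous_on_exp)
next
  case (Suc k)
  note c = Suc.prems[THEN Ck_imp_continuous_on[OF openin_Rn_subset[OF U]]]
  show ?case
  proof (rule Ck_SucI[OF U, where g = "\<lambda>i x. exp (f x) * partial i f x"])
    show "((\<lambda>t. exp (f (x(i := t)))) has_real_derivative exp (f x) * partial i f x) (at (x i))"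
      if "i < d" "x \<in> U" for i x
      using DERIV_fun_exp[OF has_partial[OF Suc.prems that(2,1)]] by simp
    show "Ck_on k d U (\<lambda>x. exp (f x) * partial i f x)" if "i < d" for i
      using Suc.prems that Ck_Suc_imp[OF Suc.prems] by (intro Ck_mult[OF U] Suc.IH) auto
  qed (use c in \<open>auto intro: continuous_on_exp\<close>)
qed

lemma Ck_ln:
  assumes U: "openin (Euclidean_space d) U" and pos: "\<And>x. x \<in> U \<Longrightarrow> f x > 0"
    and f: "Ck_on k d U f"
  shows "Ck_on k d U (\<lambda>x. ln (f x))"
proof -
  have nz: "f x \<noteq> 0" if "x \<in> U" for x
    using pos[OF that] by simp
  note c = f[THEN Ck_imp_continuous_on[OF openin_Rn_subset[OF U]]]
  show ?thesis
  proof (cases k)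
    case 0
    then show ?thesis
      using continuous_map_Rn[OF openin_Rn_subset[OF U]] c nz by (auto intro!: continuous_on_ln)
  next
    case (Suc k')
    note f' = f[unfolded Suc]
    show ?thesis unfolding Suc
    proof (rule Ck_SucI[OF U, where g = "\<lambda>i x. inverse (f x) * partial i f x"])
      show "((\<lambda>t. ln (f (x(i := t)))) has_real_derivative inverse (f x) * partial i f x) (at (x i))"
        if "i < d" "x \<in> U" for i x
        using DERIV_ln[THEN DERIV_chain2, OF _ has_partial[OF f' that(2,1)]] pos[OF that(2)] by simp
      show "Ck_on k' d U (\<lambda>x. inverse (f x) * partial i f x)" if "i < d" for i
        using f' that Ck_Suc_imp[OF f'] nz by (intro Ck_mult[OF U] Ck_inverse[OF U]) auto
    qed (use nz c in \<open>auto intro!: continuous_on_ln\<close>)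
  qed
qed

lemma Ck_sqrt:
  assumes U: "openin (Euclidean_space d) U" and pos: "\<And>x. x \<in> U \<Longrightarrow> f x > 0"
    and f: "Ck_on k d U f"
  shows "Ck_on k d U (\<lambda>x. sqrt (f x))"
proof -
  have "Ck_on k d U (\<lambda>x. exp (1/2 * ln (f x)))"
    by (intro Ck_exp[OF U] Ck_mult[OF U] Ck_const[OF U] Ck_ln[OF U] pos f)
  then show ?thesis
    by (rule Ck_cong[OF U, rotated]) (use pos in \<open>simp add: powr_half_sqrt[symmetric] powr_def less_imp_le pos less_imp_neq[THEN not_sym]\<close>)
qed

section \<open>Mean values, the chain rule and the symmetry of second partials\<close>

lemma mvt_segment:
  fixes h :: "real \<Rightarrow> real"
  assumes "\<And>t. t \<in> closed_segment a b \<Longrightarrow> (h has_real_derivative h' t) (at t)"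
  shows "\<exists>\<xi>\<in>closed_segment a b. h b - h a = (b - a) * h' \<xi>"
proof -
  consider "a < b" | "a = b" | "b < a" by linarith
  then show ?thesis
  proof cases
    case 1
    then obtain z where "a < z" "z < b" "h b - h a = (b - a) * h' z"
      using MVT2[of a b h h'] assms by (auto simp: closed_segment_eq_real_ivl)
    then show ?thesis using 1 by (auto simp: closed_segment_eq_real_ivl intro!: bexI[of _ z])
  next
    case 3
    then obtain z where z: "b < z" "z < a" "h a - h b = (a - b) * h' z"
      using MVT2[of b a h h'] assms by (auto simp: closed_segment_eq_real_ivl)
    then have "h b - h a = (b - a) * h' z" by (simp add: algebra_simps)
    then show ?thesis using z by (auto simp: closed_segment_eq_real_ivl intro!: bexI[of _ z])
  qed auto
qed

text \<open>Only coordinatewise differentiability of the curve at \<open>s0\<close> is needed: one coordinate is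
  switched on at a time and the mean value theorem is applied to it.\<close>

lemma chain_curve:
  assumes U: "openin (Euclidean_space d) U" and f: "Ck_on (Suc k) d U f"
    and c0: "c s0 \<in> U" and cR: "eventually (\<lambda>s. c s \<in> Rn d) (nhds s0)"
    and dc: "\<And>i. i < d \<Longrightarrow> ((\<lambda>s. c s i) has_real_derivative v i) (at s0)"
  shows "((\<lambda>s. f (c s)) has_real_derivative (\<Sum>i<d. v i * partial i f (c s0))) (at s0)"
proof -
  define x where "x = c s0"
  define cm where "cm m s = (\<lambda>i. if i < m then c s i else x i)" for m s
  have xU: "x \<in> U" and xR: "x \<in> Rn d" using c0 openin_Rn_subset[OF U] by (auto simp: x_def)
  have cont: "((\<lambda>s. c s i) \<longlongrightarrow> x i) (nhds s0)" if "i < d" for i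
    using DERIV_isCont[OF dc[OF that]] by (simp add: x_def isCont_def tendsto_nhds_iff)
  have cm_lim: "((\<lambda>s. cm m s i) \<longlongrightarrow> x i) (nhds s0)" if "m \<le> d" for m i
    using cont that by (cases "i < m") (auto simp: cm_def)
  have cm_R: "cm m s \<in> Rn d" if "m \<le> d" for m s
    using that xR by (auto simp: cm_def Rn_iff)
  have "((\<lambda>s. f (cm m s)) has_real_derivative (\<Sum>i<m. v i * partial i f x)) (at s0)" if "m \<le> d" for m
    using that
  proof (induction m)
    case 0
    then show ?case by (simp add: cm_def)
  next
    case (Suc m)
    then have m: "m < d" "m \<le> d" by auto
    have pair: "((\<lambda>p. (cm m (fst p))(m := snd p)) \<longlongrightarrow> x) (nhds s0 \<times>\<^sub>F nhds (x m))"
    proof (rule tendsto_fun)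
      fix i
      have a: "((\<lambda>p. cm m (fst p) i) \<longlongrightarrow> x i) (nhds s0 \<times>\<^sub>F nhds (x m))"
        by (rule filterlim_compose[OF cm_lim[OF m(2)] filterlim_fst])
      have b: "(snd \<longlongrightarrow> x m) (nhds s0 \<times>\<^sub>F nhds (x m))"
        by (rule filterlim_snd)
      show "((\<lambda>p. ((cm m (fst p))(m := snd p)) i) \<longlongrightarrow> x i) (nhds s0 \<times>\<^sub>F nhds (x m))"
        using a b by (cases "i = m") (auto simp: fun_upd_apply)
    qed
    have "eventually (\<lambda>p. (cm m (fst p))(m := snd p) \<in> U) (nhds s0 \<times>\<^sub>F nhds (x m))"
      by (rule eventually_in_open[OF U xU pair]) (simp add: upd_in_Rn cm_R m)
    then obtain P Q where P: "eventually P (nhds s0)" and Q: "eventually Q (nhds (x m))"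
      and PQ: "\<And>s t. P s \<Longrightarrow> Q t \<Longrightarrow> (cm m s)(m := t) \<in> U"
      by (auto simp: eventually_prod_filter)
    obtain e where e: "e > 0" "\<And>t. dist t (x m) < e \<Longrightarrow> Q t"
      using Q by (auto simp: eventually_nhds_metric)
    have ev: "eventually (\<lambda>s. P s \<and> dist (c s m) (x m) < e) (nhds s0)"
      using P tendstoD[OF cont[OF m(1)] e(1)] by eventually_elim simp
    have "\<exists>\<xi>. \<xi> \<in> closed_segment (x m) (c s m) \<and>
        f ((cm m s)(m := c s m)) - f ((cm m s)(m := x m)) = (c s m - x m) * partial m f ((cm m s)(m := \<xi>))"
      if "P s \<and> dist (c s m) (x m) < e" for s
    proof -
      have "\<exists>\<xi>\<in>closed_segment (x m) (c s m). f ((cm m s)(m := c s m)) - f ((cm m s)(m := x m)) =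
             (c s m - x m) * partial m f ((cm m s)(m := \<xi>))"
      proof (rule mvt_segment)
        fix t assume "t \<in> closed_segment (x m) (c s m)"
        then have "dist t (x m) < e"
          using that by (auto simp: closed_segment_eq_real_ivl dist_real_def split: if_splits)
        then have "(cm m s)(m := t) \<in> U" using PQ that e by blast
        from has_partial[OF f this m(1)]
        show "((\<lambda>t. f ((cm m s)(m := t))) has_real_derivative partial m f ((cm m s)(m := t))) (at t)"
          by (simp add: fun_upd_apply[of _ m _ m])
      qed
      then show ?thesis by blast
    qed
    then obtain \<xi> where \<xi>: "\<And>s. P s \<and> dist (c s m) (x m) < e \<Longrightarrow> \<xi> s \<in> closed_segment (x m) (c s m) \<and>
        f ((cm m s)(m := c s m)) - f ((cm m s)(m := x m)) = (c s m - x m) * partial m f ((cm m s)(m := \<xi> s))"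
      by metis
    have \<xi>lim: "(\<xi> \<longlongrightarrow> x m) (nhds s0)"
    proof -
      have "((\<lambda>s. \<xi> s - x m) \<longlongrightarrow> 0) (nhds s0)"
      proof (rule tendsto_0_le[where K = 1])
        show "((\<lambda>s. c s m - x m) \<longlongrightarrow> 0) (nhds s0)"
          using cont[OF m(1)] by (simp add: LIM_zero)
        show "eventually (\<lambda>s. norm (\<xi> s - x m) \<le> norm (c s m - x m) * 1) (nhds s0)"
          using ev
        proof eventually_elim
          case (elim s)
          from \<xi>[OF elim] show ?case
            by (auto simp: closed_segment_eq_real_ivl split: if_splits)
        qed
      qed
      then show ?thesis by (simp add: LIM_zero_cancel)
    qed
    \<comment> \<open>Only the limit of \<open>E\<close> at \<open>s0\<close> matters: its factor
      \<open>c s m - x m\<close> vanishes there, so the product is differentiable at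
      \<open>s0\<close> whether or not \<open>E\<close> is.\<close>
    define E where "E s = partial m f ((cm m s)(m := \<xi> s))" for s
    have pt: "((\<lambda>s. (cm m s)(m := \<xi> s)) \<longlongrightarrow> x) (nhds s0)"
    proof (rule tendsto_fun)
      fix i show "((\<lambda>s. ((cm m s)(m := \<xi> s)) i) \<longlongrightarrow> x i) (nhds s0)"
        using \<xi>lim cm_lim[OF m(2)] by (cases "i = m") (auto simp: fun_upd_apply)
    qed
    have ptU: "eventually (\<lambda>s. (cm m s)(m := \<xi> s) \<in> U) (nhds s0)"
      by (rule eventually_in_open[OF U xU pt]) (simp add: upd_in_Rn cm_R m)
    have "continuous_on U (partial m f)"
      using Ck_imp_continuous_on[OF openin_Rn_subset[OF U] Ck_partial[OF f m(1)]] .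
    then have "(E \<longlongrightarrow> partial m f x) (nhds s0)"
      unfolding E_def using continuous_on_tendsto_compose[OF _ pt xU ptU] by simp
    then have Elim: "(E \<longlongrightarrow> partial m f x) (at s0)"
      by (rule tendsto_mono[OF at_within_le_nhds])
    have "((\<lambda>s. (c s m - x m) * E s) has_real_derivative v m * partial m f x) (at s0)"
      unfolding has_field_derivative_iff
    proof (rule Lim_transform_eventually)
      show "((\<lambda>s. (c s m - c s0 m) / (s - s0) * E s) \<longlongrightarrow> v m * partial m f x) (at s0)"
        using dc[OF m(1)] Elim unfolding has_field_derivative_iff by (rule tendsto_mult)
      show "eventually (\<lambda>s. (c s m - c s0 m) / (s - s0) * E s =
         ((c s m - x m) * E s - (c s0 m - x m) * E s0) / (s - s0)) (at s0)"
        by (simp add: x_def)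
    qed
    from DERIV_add[OF Suc.IH[OF m(2)] this]
    have D: "((\<lambda>s. f (cm m s) + (c s m - x m) * E s) has_real_derivative
        (\<Sum>i<Suc m. v i * partial i f x)) (at s0)" by simp
    have "eventually (\<lambda>s. f (cm (Suc m) s) = f (cm m s) + (c s m - x m) * E s) (nhds s0)"
      using ev
    proof eventually_elim
      case (elim s)
      have "(cm m s)(m := c s m) = cm (Suc m) s" "(cm m s)(m := x m) = cm m s"
        by (auto simp: cm_def fun_upd_apply)
      with \<xi>[OF elim] show ?case by (simp add: E_def)
    qed
    then show ?case
      using D by (subst DERIV_cong_ev[OF refl _ refl]) auto
  qed
  from this[of d] have D: "((\<lambda>s. f (cm d s)) has_real_derivative (\<Sum>i<d. v i * partial i f x)) (at s0)"
    by simp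
  have "eventually (\<lambda>s. f (c s) = f (cm d s)) (nhds s0)"
    using cR
  proof eventually_elim
    case (elim s)
    then have "c s = cm d s" using xR by (auto simp: cm_def Rn_iff fun_eq_iff)
    then show ?case by simp
  qed
  then show ?thesis
    using D by (subst DERIV_cong_ev[OF refl _ refl]) (auto simp: x_def)
qed

lemma continuous_on_into_Rn:
  assumes "\<And>x. x \<in> U \<Longrightarrow> G x \<in> Rn m" "\<And>j. j < m \<Longrightarrow> continuous_on U (\<lambda>x. G x j)"
  shows "continuous_on U G"
proof (rule continuous_on_coordinatewise_then_product)
  fix j show "continuous_on U (\<lambda>x. G x j)"
  proof (cases "j < m")
    case False
    then have "G x j = 0" if "x \<in> U" for x using assms(1)[OF that] by (simp add: Rn_iff)
    then show ?thesis by (simp cong: continuous_on_cong)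
  qed (rule assms)
qed

text \<open>By the chain rule a partial of the composite is a sum of products of partials of
  \<open>G\<close> with the functions \<open>partial j f\<close> composed with \<open>G\<close>. The
  latter are covered by the induction hypothesis, which therefore ranges over all
  \<open>f\<close>.\<close>

lemma Ck_compose:
  assumes U: "openin (Euclidean_space d) U" and V: "openin (Euclidean_space m) V"
    and GV: "\<And>x. x \<in> U \<Longrightarrow> G x \<in> V"
  shows "(\<And>j. j < m \<Longrightarrow> Ck_on k d U (\<lambda>x. G x j)) \<Longrightarrow> Ck_on k m V f \<Longrightarrow> Ck_on k d U (\<lambda>x. f (G x))"
proof (induction k arbitrary: f)
  case 0
  have "continuous_on U G"
    using 0(1) GV openin_Rn_subset[OF V] continuous_map_Rn[OF openin_Rn_subset[OF U]]
    by (intro continuous_on_into_Rn[of _ _ m]) auto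
  moreover have "continuous_on V f"
    using 0 continuous_map_Rn[OF openin_Rn_subset[OF V]] by auto
  ultimately have "continuous_on U (\<lambda>x. f (G x))"
    using GV by (intro continuous_on_compose2[of V f U G]) auto
  then show ?case
    using continuous_map_Rn[OF openin_Rn_subset[OF U]] by auto
next
  case (Suc k)
  have cG: "continuous_on U G"
    using Suc.prems(1) GV openin_Rn_subset[OF V] Ck_imp_continuous_on[OF openin_Rn_subset[OF U]]
    by (intro continuous_on_into_Rn[of _ _ m]) blast+
  moreover have "continuous_on V f"
    using Suc Ck_imp_continuous_on[OF openin_Rn_subset[OF V]] by blast
  ultimately have cf: "continuous_on U (\<lambda>x. f (G x))"
    using GV by (intro continuous_on_compose2[of V f U G]) auto
  show ?case
  proof (rule Ck_SucI[OF U cf, where g = "\<lambda>i x. \<Sum>j<m. partial i (\<lambda>x. G x j) x * partial j f (G x)"])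
    fix i x assume i: "i < d" and x: "x \<in> U"
    have "((\<lambda>t. f (G (x(i := t)))) has_real_derivative
       (\<Sum>j<m. partial i (\<lambda>x. G x j) x * partial j f (G (x(i := x i))))) (at (x i))"
    proof (rule chain_curve[OF V Suc.prems(2)])
      show "eventually (\<lambda>t. G (x(i := t)) \<in> Rn m) (nhds (x i))"
        using eventually_upd[OF U x i]
        by eventually_elim (use GV openin_Rn_subset[OF V] in blast)
    qed (use x i GV has_partial[OF Suc.prems(1)] in auto)
    then show "((\<lambda>t. f (G (x(i := t)))) has_real_derivative
       (\<Sum>j<m. partial i (\<lambda>x. G x j) x * partial j f (G x))) (at (x i))" by simp
  next
    fix i assume i: "i < d"
    show "Ck_on k d U (\<lambda>x. \<Sum>j<m. partial i (\<lambda>x. G x j) x * partial j f (G x))"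
    proof (intro Ck_sum[OF U] Ck_mult[OF U])
      fix j assume j: "j \<in> {..<m}"
      show "Ck_on k d U (partial i (\<lambda>x. G x j))"
        using Suc.prems(1) j i Ck_partial by blast
      show "Ck_on k d U (\<lambda>x. partial j f (G x))"
        by (rule Suc.IH) (use Suc.prems j Ck_Suc_imp in auto)
    qed
  qed
qed

text \<open>The second difference of \<open>F\<close> over a small square with corner
  \<open>(a, b)\<close> is \<open>h\<^sup>2\<close> times a value of \<open>F12\<close> and also
  \<open>h\<^sup>2\<close> times a value of \<open>F21\<close>, by the mean value theorem in the two
  orders. Continuity at the corner excludes a gap between the two limits.\<close>

lemma mixed_partials_real:
  fixes F :: "real \<Rightarrow> real \<Rightarrow> real"
  assumes e: "e > 0"
    and d1: "\<And>s t. \<bar>s - a\<bar> < e \<Longrightarrow> \<bar>t - b\<bar> < e \<Longrightarrow> ((\<lambda>s. F s t) has_real_derivative F1 s t) (at s)"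
    and d2: "\<And>s t. \<bar>s - a\<bar> < e \<Longrightarrow> \<bar>t - b\<bar> < e \<Longrightarrow> ((\<lambda>t. F s t) has_real_derivative F2 s t) (at t)"
    and d12: "\<And>s t. \<bar>s - a\<bar> < e \<Longrightarrow> \<bar>t - b\<bar> < e \<Longrightarrow> ((\<lambda>t. F1 s t) has_real_derivative F12 s t) (at t)"
    and d21: "\<And>s t. \<bar>s - a\<bar> < e \<Longrightarrow> \<bar>t - b\<bar> < e \<Longrightarrow> ((\<lambda>s. F2 s t) has_real_derivative F21 s t) (at s)"
    and c12: "((\<lambda>p. F12 (fst p) (snd p)) \<longlongrightarrow> F12 a b) (nhds (a, b))"
    and c21: "((\<lambda>p. F21 (fst p) (snd p)) \<longlongrightarrow> F21 a b) (nhds (a, b))"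
  shows "F12 a b = F21 a b"
proof (rule ccontr)
  assume "F12 a b \<noteq> F21 a b"
  define r where "r = \<bar>F12 a b - F21 a b\<bar> / 2"
  have r: "r > 0" using \<open>F12 a b \<noteq> F21 a b\<close> by (simp add: r_def)
  have "eventually (\<lambda>p. dist (F12 (fst p) (snd p)) (F12 a b) < r \<and> dist (F21 (fst p) (snd p)) (F21 a b) < r) (nhds (a,b))"
    using tendstoD[OF c12 r] tendstoD[OF c21 r] by eventually_elim simp
  then obtain \<delta> where \<delta>: "\<delta> > 0" and near: "\<And>p. dist p (a,b) < \<delta> \<Longrightarrow>
      dist (F12 (fst p) (snd p)) (F12 a b) < r \<and> dist (F21 (fst p) (snd p)) (F21 a b) < r"
    by (auto simp: eventually_nhds_metric)
  \<comment> \<open>The third gives \<open>h < e\<close>, for the derivatives, and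
    \<open>2 * h < \<delta>\<close>, which keeps the whole square within distance
    \<open>\<delta>\<close> of its corner.\<close>
  define h where "h = min e \<delta> / 3"
  have h: "h > 0" "h < e" "2 * h < \<delta>" using e \<delta> by (auto simp: h_def)
  have nearh: "dist (s, t) (a, b) < \<delta>" if "\<bar>s - a\<bar> \<le> h" "\<bar>t - b\<bar> \<le> h" for s t
  proof -
    have "dist (s,t) (a,b) \<le> \<bar>s - a\<bar> + \<bar>t - b\<bar>"
      by (simp add: dist_Pair_Pair dist_real_def sqrt_sum_squares_le_sum_abs)
    then show ?thesis using that h by linarith
  qed
  have D1: "((\<lambda>s. F s (b+h) - F s b) has_real_derivative F1 s (b+h) - F1 s b) (at s)"
    if "a \<le> s" "s \<le> a + h" for s
    by (rule DERIV_diff; rule d1) (use h that in linarith)+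
  have D2: "((\<lambda>t. F (a+h) t - F a t) has_real_derivative F2 (a+h) t - F2 a t) (at t)"
    if "b \<le> t" "t \<le> b + h" for t
    by (rule DERIV_diff; rule d2) (use h that in linarith)+
  have lt: "a < a + h" "b < b + h" using h by auto
  obtain \<xi> where \<xi>: "a < \<xi>" "\<xi> < a + h"
    and 1: "(F (a+h) (b+h) - F (a+h) b) - (F a (b+h) - F a b) = h * (F1 \<xi> (b+h) - F1 \<xi> b)"
    using MVT2[OF lt(1) D1] by auto
  have D12: "((\<lambda>t. F1 \<xi> t) has_real_derivative F12 \<xi> t) (at t)" if "b \<le> t" "t \<le> b + h" for t
    by (rule d12) (use h that \<xi> in linarith)+
  obtain \<eta> where \<eta>: "b < \<eta>" "\<eta> < b + h" and 2: "F1 \<xi> (b+h) - F1 \<xi> b = h * F12 \<xi> \<eta>"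
    using MVT2[OF lt(2) D12] by auto
  obtain \<eta>' where \<eta>': "b < \<eta>'" "\<eta>' < b + h"
    and 3: "(F (a+h) (b+h) - F a (b+h)) - (F (a+h) b - F a b) = h * (F2 (a+h) \<eta>' - F2 a \<eta>')"
    using MVT2[OF lt(2) D2] by auto
  have D21: "((\<lambda>s. F2 s \<eta>') has_real_derivative F21 s \<eta>') (at s)" if "a \<le> s" "s \<le> a + h" for s
    by (rule d21) (use h that \<eta>' in linarith)+
  obtain \<xi>' where \<xi>': "a < \<xi>'" "\<xi>' < a + h" and 4: "F2 (a+h) \<eta>' - F2 a \<eta>' = h * F21 \<xi>' \<eta>'"
    using MVT2[OF lt(1) D21] by auto
  have "h * (h * F12 \<xi> \<eta>) = h * (h * F21 \<xi>' \<eta>')"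
    using 1 2 3 4 by (simp add: algebra_simps)
  then have "F12 \<xi> \<eta> = F21 \<xi>' \<eta>'" using h by simp
  moreover have "dist (F12 \<xi> \<eta>) (F12 a b) < r"
    using near[OF nearh[of \<xi> \<eta>]] \<xi> \<eta> by auto
  moreover have "dist (F21 \<xi>' \<eta>') (F21 a b) < r"
    using near[OF nearh[of \<xi>' \<eta>']] \<xi>' \<eta>' by auto
  ultimately have "\<bar>F12 a b - F21 a b\<bar> < 2 * r"
    unfolding dist_real_def by linarith
  then show False
    by (simp add: r_def)
qed

text \<open>Freezing all coordinates except \<open>i\<close> and \<open>j\<close> leaves a function
  of two real variables.\<close>

lemma partial_commute:
  assumes U: "openin (Euclidean_space d) U" and f: "Ck_on (Suc (Suc k)) d U f"
    and x: "x \<in> U" and i: "i < d" and j: "j < d"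
  shows "partial i (partial j f) x = partial j (partial i f) x"
proof (cases "i = j")
  case False
  have xR: "x \<in> Rn d" using x openin_Rn_subset[OF U] by auto
  define X where "X s t = x(i := s, j := t)" for s t
  have Xji: "(X s t)(i := s') = X s' t" "(X s t)(j := t') = X s t'" for s t s' t'
    using False by (auto simp: X_def fun_upd_apply)
  have lim: "((\<lambda>p. X (fst p) (snd p)) \<longlongrightarrow> x) (nhds (x i, x j))"
  proof (rule tendsto_fun)
    fix l
    have "(fst \<longlongrightarrow> x i) (nhds (x i, x j))" "(snd \<longlongrightarrow> x j) (nhds (x i, x j))"
      by (auto simp: nhds_prod filterlim_fst filterlim_snd)
    then show "((\<lambda>p. X (fst p) (snd p) l) \<longlongrightarrow> x l) (nhds (x i, x j))"
      using False by (cases "l = i"; cases "l = j") (auto simp: X_def fun_upd_apply)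
  qed
  have XR: "X s t \<in> Rn d" for s t unfolding X_def by (intro upd_in_Rn xR i j)
  have ev: "eventually (\<lambda>p. X (fst p) (snd p) \<in> U) (nhds (x i, x j))"
    by (rule eventually_in_open[OF U x lim]) (simp add: XR)
  then obtain \<delta> where \<delta>: "\<delta> > 0" "\<And>p. dist p (x i, x j) < \<delta> \<Longrightarrow> X (fst p) (snd p) \<in> U"
    by (auto simp: eventually_nhds_metric)
  have inU: "X s t \<in> U" if "\<bar>s - x i\<bar> < \<delta>/2" "\<bar>t - x j\<bar> < \<delta>/2" for s t
  proof -
    have "dist (s,t) (x i, x j) \<le> \<bar>s - x i\<bar> + \<bar>t - x j\<bar>"
      by (simp add: dist_Pair_Pair dist_real_def sqrt_sum_squares_le_sum_abs)
    then show ?thesis using \<delta>(2)[of "(s,t)"] that by simp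
  qed
  have Di: "((\<lambda>s. g (X s t)) has_real_derivative partial i g (X s t)) (at s)"
    if "Ck_on (Suc l) d U g" "X s t \<in> U" for g l s t
  proof -
    have "((\<lambda>s'. g ((X s t)(i := s'))) has_real_derivative partial i g (X s t)) (at (X s t i))"
      using has_partial[OF that i] .
    moreover have "X s t i = s" using False by (simp add: X_def fun_upd_apply)
    ultimately show ?thesis
      by (simp add: Xji)
  qed
  have Dj: "((\<lambda>t. g (X s t)) has_real_derivative partial j g (X s t)) (at t)"
    if "Ck_on (Suc l) d U g" "X s t \<in> U" for g l s t
  proof -
    have "((\<lambda>s'. g ((X s t)(j := s'))) has_real_derivative partial j g (X s t)) (at (X s t j))"
      using has_partial[OF that j] .
    moreover have "X s t j = t" by (simp add: X_def fun_upd_apply)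
    ultimately show ?thesis
      by (simp add: Xji)
  qed
  have X0: "X (x i) (x j) = x" by (simp add: X_def)
  have lim2: "((\<lambda>p. g (X (fst p) (snd p))) \<longlongrightarrow> g (X (x i) (x j))) (nhds (x i, x j))"
    if "Ck_on l d U g" for g l
    using continuous_on_tendsto_compose[OF Ck_imp_continuous_on[OF openin_Rn_subset[OF U] that] lim x ev]
    by (simp add: X0)
  have fi: "Ck_on (Suc k) d U (partial i f)" and fj: "Ck_on (Suc k) d U (partial j f)"
    using f i j Ck_partial by blast+
  have "partial j (partial i f) (X (x i) (x j)) = partial i (partial j f) (X (x i) (x j))"
    by (rule mixed_partials_real[where e = "\<delta>/2" and F = "\<lambda>s t. f (X s t)"
          and ?F1.0 = "\<lambda>s t. partial i f (X s t)" and ?F2.0 = "\<lambda>s t. partial j f (X s t)"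
          and ?F12.0 = "\<lambda>s t. partial j (partial i f) (X s t)"
          and ?F21.0 = "\<lambda>s t. partial i (partial j f) (X s t)"])
      (use \<delta>(1) in simp, (rule Di[OF f inU] Dj[OF f inU] Dj[OF fi inU] Di[OF fj inU]; assumption),
        (rule Di[OF f inU] Dj[OF f inU] Dj[OF fi inU] Di[OF fj inU]; assumption),
        (rule Di[OF f inU] Dj[OF f inU] Dj[OF fi inU] Di[OF fj inU]; assumption),
        (rule Di[OF f inU] Dj[OF f inU] Dj[OF fi inU] Di[OF fj inU]; assumption),
        rule lim2[OF Ck_partial[OF fi j]], rule lim2[OF Ck_partial[OF fj i]])
  then show ?thesis by (simp add: X0)
qed simp

subsection \<open>Smooth functions\<close>

text \<open>Openness of the domain is part of the predicate, so that the closure rules can be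
  chained without carrying it along.\<close>

definition smooth_on :: "nat \<Rightarrow> (nat \<Rightarrow> real) set \<Rightarrow> ((nat \<Rightarrow> real) \<Rightarrow> real) \<Rightarrow> bool" where
  "smooth_on d U f \<longleftrightarrow> openin (Euclidean_space d) U \<and> (\<forall>k. Ck_on k d U f)"

definition csmooth_on :: "nat \<Rightarrow> (nat \<Rightarrow> real) set \<Rightarrow> ((nat \<Rightarrow> real) \<Rightarrow> complex) \<Rightarrow> bool" where
  "csmooth_on d U f \<longleftrightarrow> smooth_on d U (\<lambda>x. Re (f x)) \<and> smooth_on d U (\<lambda>x. Im (f x))"

lemma smooth_on_const: "openin (Euclidean_space d) U \<Longrightarrow> smooth_on d U (\<lambda>x. a)"
  by (simp add: smooth_on_def Ck_const)

lemma smooth_on_coord: "openin (Euclidean_space d) U \<Longrightarrow> smooth_on d U (\<lambda>x. x i)"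
  by (simp add: smooth_on_def Ck_coord)

lemma smooth_on_add: "smooth_on d U f \<Longrightarrow> smooth_on d U g \<Longrightarrow> smooth_on d U (\<lambda>x. f x + g x)"
  by (simp add: smooth_on_def Ck_add)

lemma smooth_on_mult: "smooth_on d U f \<Longrightarrow> smooth_on d U g \<Longrightarrow> smooth_on d U (\<lambda>x. f x * g x)"
  by (simp add: smooth_on_def Ck_mult)

lemma smooth_on_uminus: "smooth_on d U f \<Longrightarrow> smooth_on d U (\<lambda>x. - f x)"
  by (simp add: smooth_on_def Ck_uminus)

lemma smooth_on_diff: "smooth_on d U f \<Longrightarrow> smooth_on d U g \<Longrightarrow> smooth_on d U (\<lambda>x. f x - g x)"
  using smooth_on_add[OF _ smooth_on_uminus] by fastforce

lemma smooth_on_power2: "smooth_on d U f \<Longrightarrow> smooth_on d U (\<lambda>x. (f x)\<^sup>2)"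
  by (simp add: power2_eq_square smooth_on_mult)

lemma smooth_on_inverse:
  "smooth_on d U f \<Longrightarrow> (\<And>x. x \<in> U \<Longrightarrow> f x \<noteq> 0) \<Longrightarrow> smooth_on d U (\<lambda>x. inverse (f x))"
  by (simp add: smooth_on_def Ck_inverse)

lemma smooth_on_exp: "smooth_on d U f \<Longrightarrow> smooth_on d U (\<lambda>x. exp (f x))"
  by (simp add: smooth_on_def Ck_exp)

lemma smooth_on_ln:
  "smooth_on d U f \<Longrightarrow> (\<And>x. x \<in> U \<Longrightarrow> f x > 0) \<Longrightarrow> smooth_on d U (\<lambda>x. ln (f x))"
  by (simp add: smooth_on_def Ck_ln)

lemma smooth_on_sqrt:
  "smooth_on d U f \<Longrightarrow> (\<And>x. x \<in> U \<Longrightarrow> f x > 0) \<Longrightarrow> smooth_on d U (\<lambda>x. sqrt (f x))"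
  by (simp add: smooth_on_def Ck_sqrt)

lemma smooth_on_sum:
  "openin (Euclidean_space d) U \<Longrightarrow> (\<And>j. j \<in> A \<Longrightarrow> smooth_on d U (f j)) \<Longrightarrow>
   smooth_on d U (\<lambda>x. \<Sum>j\<in>A. f j x)"
  by (simp add: smooth_on_def Ck_sum)

lemma smooth_on_cong:
  "smooth_on d U f \<Longrightarrow> (\<And>x. x \<in> U \<Longrightarrow> f x = g x) \<Longrightarrow> smooth_on d U g"
  unfolding smooth_on_def using Ck_cong by metis

lemma smooth_on_subset:
  "smooth_on d U f \<Longrightarrow> openin (Euclidean_space d) V \<Longrightarrow> V \<subseteq> U \<Longrightarrow> smooth_on d V f"
  unfolding smooth_on_def using Ck_mono by blast

lemma smooth_on_compose:
  assumes "openin (Euclidean_space d) U" "\<And>x. x \<in> U \<Longrightarrow> G x \<in> V"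
    and "\<And>j. j < m \<Longrightarrow> smooth_on d U (\<lambda>x. G x j)" and "smooth_on m V f"
  shows "smooth_on d U (\<lambda>x. f (G x))"
  using assms Ck_compose[of d U m V G _ f] by (auto simp: smooth_on_def)

lemma smooth_on_openin: "smooth_on d U f \<Longrightarrow> openin (Euclidean_space d) U"
  by (simp add: smooth_on_def)

lemma smooth_on_continuous: "smooth_on d U f \<Longrightarrow> continuous_on U f"
  unfolding smooth_on_def using Ck_imp_continuous_on openin_Rn_subset by blast

lemma csmooth_on_const: "openin (Euclidean_space d) U \<Longrightarrow> csmooth_on d U (\<lambda>x. a)"
  by (simp add: csmooth_on_def smooth_on_const)

lemma csmooth_on_of_real: "smooth_on d U f \<Longrightarrow> csmooth_on d U (\<lambda>x. complex_of_real (f x))"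
  by (auto simp: csmooth_on_def intro: smooth_on_const smooth_on_openin)

lemma csmooth_on_Re: "csmooth_on d U f \<Longrightarrow> smooth_on d U (\<lambda>x. Re (f x))"
  by (simp add: csmooth_on_def)

lemma csmooth_on_Im: "csmooth_on d U f \<Longrightarrow> smooth_on d U (\<lambda>x. Im (f x))"
  by (simp add: csmooth_on_def)

lemma csmooth_on_add: "csmooth_on d U f \<Longrightarrow> csmooth_on d U g \<Longrightarrow> csmooth_on d U (\<lambda>x. f x + g x)"
  by (simp add: csmooth_on_def smooth_on_add)

lemma csmooth_on_uminus: "csmooth_on d U f \<Longrightarrow> csmooth_on d U (\<lambda>x. - f x)"
  by (simp add: csmooth_on_def smooth_on_uminus)

lemma csmooth_on_diff: "csmooth_on d U f \<Longrightarrow> csmooth_on d U g \<Longrightarrow> csmooth_on d U (\<lambda>x. f x - g x)"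
  by (simp add: csmooth_on_def smooth_on_diff)

lemma csmooth_on_mult: "csmooth_on d U f \<Longrightarrow> csmooth_on d U g \<Longrightarrow> csmooth_on d U (\<lambda>x. f x * g x)"
  by (simp add: csmooth_on_def smooth_on_add smooth_on_diff smooth_on_mult)

lemma csmooth_on_cnj: "csmooth_on d U f \<Longrightarrow> csmooth_on d U (\<lambda>x. cnj (f x))"
  by (simp add: csmooth_on_def smooth_on_uminus)

lemma smooth_on_norm_sq: "csmooth_on d U f \<Longrightarrow> smooth_on d U (\<lambda>x. (cmod (f x))\<^sup>2)"
  unfolding cmod_power2 by (intro smooth_on_add smooth_on_power2) (auto simp: csmooth_on_def)

lemma csmooth_on_inverse:
  assumes "csmooth_on d U f" "\<And>x. x \<in> U \<Longrightarrow> f x \<noteq> 0"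
  shows "csmooth_on d U (\<lambda>x. inverse (f x))"
proof -
  have U: "openin (Euclidean_space d) U"
    using assms(1) by (auto simp: csmooth_on_def smooth_on_def)
  have "csmooth_on d U (\<lambda>x. cnj (f x) * complex_of_real (inverse ((cmod (f x))\<^sup>2)))"
    by (intro csmooth_on_mult csmooth_on_cnj csmooth_on_of_real smooth_on_inverse smooth_on_norm_sq)
      (use assms in auto)
  moreover have "cnj (f x) * complex_of_real (inverse ((cmod (f x))\<^sup>2)) = inverse (f x)" for x
  proof (cases "f x = 0")
    case False
    have "f x * cnj (f x) = complex_of_real ((cmod (f x))\<^sup>2)"
      using complex_norm_square by simp
    then show ?thesis using False by (simp add: field_simps)
  qed simp
  ultimately show ?thesis by simp
qed

lemma csmooth_on_divide:
  "csmooth_on d U f \<Longrightarrow> csmooth_on d U g \<Longrightarrow> (\<And>x. x \<in> U \<Longrightarrow> g x \<noteq> 0) \<Longrightarrow> csmooth_on d U (\<lambda>x. f x / g x)"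
  by (simp add: divide_inverse csmooth_on_mult csmooth_on_inverse)

lemma csmooth_on_sum:
  "openin (Euclidean_space d) U \<Longrightarrow> (\<And>j. j \<in> A \<Longrightarrow> csmooth_on d U (f j)) \<Longrightarrow>
   csmooth_on d U (\<lambda>x. \<Sum>j\<in>A. f j x)"
  by (simp add: csmooth_on_def smooth_on_sum)

lemma csmooth_on_cplx: "openin (Euclidean_space d) U \<Longrightarrow> csmooth_on d U (\<lambda>x. cplx x j)"
  by (simp add: csmooth_on_def cplx_def smooth_on_coord)

lemma csmooth_on_continuous: "csmooth_on d U f \<Longrightarrow> continuous_on U f"
proof -
  assume "csmooth_on d U f"
  then have "continuous_on U (\<lambda>x. Complex (Re (f x)) (Im (f x)))"
    unfolding csmooth_on_def by (intro continuous_on_Complex smooth_on_continuous) auto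
  then show ?thesis by simp
qed

lemma smooth_coord_iff:
  "openin (Euclidean_space d) U \<Longrightarrow> smooth_coord d U m F \<longleftrightarrow> (\<forall>j<m. smooth_on d U (\<lambda>x. F x j))"
  by (auto simp: smooth_coord_def smooth_on_def)

lemma smooth_coord_cong:
  assumes "openin (Euclidean_space d) U" "\<And>x. x \<in> U \<Longrightarrow> F x = G x"
  shows "smooth_coord d U m F \<longleftrightarrow> smooth_coord d U m G"
  unfolding smooth_coord_iff[OF assms(1)] using assms(2)
  by (metis (no_types, lifting) smooth_on_cong)

lemma smooth_coord_compose:
  assumes "openin (Euclidean_space d) U" "openin (Euclidean_space m) V" "\<And>x. x \<in> U \<Longrightarrow> G x \<in> V"
    and "smooth_coord d U m G" "smooth_coord m V l F"
  shows "smooth_coord d U l (\<lambda>x. F (G x))"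
  using assms smooth_on_compose[of d U G V m] by (auto simp: smooth_coord_iff)

subsection \<open>Velocities of curves\<close>

text \<open>Taken coordinatewise, since the space of all sequences has no norm to define a
  derivative with.\<close>

definition has_velocity :: "(real \<Rightarrow> nat \<Rightarrow> real) \<Rightarrow> (nat \<Rightarrow> real) \<Rightarrow> real \<Rightarrow> bool" where
  "has_velocity c v s \<longleftrightarrow> (\<forall>i. ((\<lambda>s. c s i) has_real_derivative v i) (at s))"

lemma has_velocity_unique: "has_velocity c v s \<Longrightarrow> has_velocity c w s \<Longrightarrow> v = w"
  by (auto simp: has_velocity_def intro!: ext intro: DERIV_unique)

lemma has_velocity_tendsto: "has_velocity c v s \<Longrightarrow> (c \<longlongrightarrow> c s) (nhds s)"
  unfolding has_velocity_def
  by (intro tendsto_fun) (metis DERIV_isCont isCont_def tendsto_nhds_iff)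

lemma has_velocity_line: "has_velocity (\<lambda>s i. x i + s * v i) v s"
  unfolding has_velocity_def by (auto intro!: derivative_eq_intros)

lemma has_velocity_map:
  assumes U: "openin (Euclidean_space d) U" and F: "smooth_coord d U m F"
    and FR: "\<And>x. x \<in> U \<Longrightarrow> F x \<in> Rn m"
    and c: "has_velocity c v s" "c s \<in> U" "eventually (\<lambda>t. c t \<in> Rn d) (nhds s)"
  shows "has_velocity (\<lambda>t. F (c t)) (jacobian d m F (c s) v) s"
  unfolding has_velocity_def
proof
  fix j
  have ev: "eventually (\<lambda>t. c t \<in> U) (nhds s)"
    by (rule eventually_in_open[OF U c(2) has_velocity_tendsto[OF c(1)] c(3)])
  show "((\<lambda>t. F (c t) j) has_real_derivative jacobian d m F (c s) v j) (at s)"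
  proof (cases "j < m")
    case True
    have "Ck_on (Suc 0) d U (\<lambda>x. F x j)"
      using F True unfolding smooth_coord_def by blast
    from chain_curve[OF U this c(2,3), of v] c(1) True
    show ?thesis by (simp add: jacobian_def has_velocity_def)
  next
    case False
    have "eventually (\<lambda>t. F (c t) j = 0) (nhds s)"
      using ev by eventually_elim (use FR False in \<open>auto simp: Rn_iff\<close>)
    then show ?thesis
      using False by (subst DERIV_cong_ev[OF refl _ refl]) (auto simp: jacobian_def)
  qed
qed

lemma line_in_Rn: "x \<in> Rn d \<Longrightarrow> v \<in> Rn d \<Longrightarrow> (\<lambda>i. x i + s * v i) \<in> Rn d"
  by (simp add: Rn_iff)

lemma jacobian_in_Rn: "jacobian d m F x v \<in> Rn m"
  by (simp add: jacobian_def Rn_iff)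

text \<open>Reads a Jacobian off the velocity of the image of a straight line, without computing
  partials.\<close>

lemma jacobian_eqI:
  assumes U: "openin (Euclidean_space d) U" and F: "smooth_coord d U m F"
    and FR: "\<And>x. x \<in> U \<Longrightarrow> F x \<in> Rn m" and x: "x \<in> U" and v: "v \<in> Rn d"
    and w: "has_velocity (\<lambda>s. F (\<lambda>i. x i + s * v i)) w 0"
  shows "jacobian d m F x v = w"
proof -
  have "has_velocity (\<lambda>s. F (\<lambda>i. x i + s * v i)) (jacobian d m F (\<lambda>i. x i + 0 * v i) v) 0"
  proof (rule has_velocity_map[OF U F FR has_velocity_line])
    show "eventually (\<lambda>s. (\<lambda>i. x i + s * v i) \<in> Rn d) (nhds 0)"
      using line_in_Rn v x openin_Rn_subset[OF U] by (intro always_eventually) auto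
    have "(\<lambda>i. x i + 0 * v i) = x" by simp
    then show "(\<lambda>i. x i + 0 * v i) \<in> U" using x by (simp only:)
  qed
  then show ?thesis using has_velocity_unique[OF _ w] by simp
qed

lemma jacobian_cong:
  assumes "openin (Euclidean_space d) U" "x \<in> U" "\<And>y. y \<in> U \<Longrightarrow> F y = G y"
  shows "jacobian d m F x v = jacobian d m G x v"
proof -
  have "partial i (\<lambda>y. F y j) x = partial i (\<lambda>y. G y j) x" if "i < d" for i j
    by (rule partial_cong[OF assms(1,2) that]) (simp add: assms(3))
  then show ?thesis by (auto simp: jacobian_def fun_eq_iff intro!: sum.cong)
qed

lemma jacobian_compose:
  assumes U: "openin (Euclidean_space d) U" and V: "openin (Euclidean_space m) V"
    and G: "smooth_coord d U m G" "\<And>x. x \<in> U \<Longrightarrow> G x \<in> V"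
    and F: "smooth_coord m V l F" "\<And>x. x \<in> V \<Longrightarrow> F x \<in> Rn l"
    and x: "x \<in> U" and v: "v \<in> Rn d"
  shows "jacobian d l (\<lambda>x. F (G x)) x v = jacobian m l F (G x) (jacobian d m G x v)"
proof (rule jacobian_eqI[OF U])
  show "smooth_coord d U l (\<lambda>x. F (G x))"
    by (rule smooth_coord_compose[OF U V G(2,1) F(1)])
  have GR: "G x \<in> Rn m" if "x \<in> U" for x using G(2)[OF that] openin_Rn_subset[OF V] by auto
  let ?c = "\<lambda>s i. x i + s * v i"
  have c0: "?c 0 = x" by simp
  have cR: "eventually (\<lambda>s. ?c s \<in> Rn d) (nhds 0)"
    using line_in_Rn v x openin_Rn_subset[OF U] by (intro always_eventually) auto
  have 1: "has_velocity (\<lambda>s. G (?c s)) (jacobian d m G (?c 0) v) 0"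
    by (rule has_velocity_map[OF U G(1) GR has_velocity_line _ cR]) (assumption, subst c0, rule x)
  have "eventually (\<lambda>s. ?c s \<in> U) (nhds 0)"
    using eventually_in_open[OF U _ has_velocity_tendsto[OF has_velocity_line[of x v 0]] cR] x
    unfolding c0 by blast
  then have 2: "eventually (\<lambda>s. G (?c s) \<in> Rn m) (nhds 0)"
    by eventually_elim (rule GR)
  have "has_velocity (\<lambda>s. F (G (?c s))) (jacobian m l F (G (?c 0)) (jacobian d m G (?c 0) v)) 0"
    by (rule has_velocity_map[OF V F 1 _ 2]) (assumption, subst c0, rule G(2)[OF x])
  then show "has_velocity (\<lambda>s. F (G (?c s))) (jacobian m l F (G x) (jacobian d m G x v)) 0"
    unfolding c0 .
qed (use F G x v in auto)

lemma has_velocity_cplx: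
  "has_velocity c v s \<Longrightarrow> ((\<lambda>t. cplx (c t) j) has_vector_derivative cplx v j) (at s)"
  unfolding has_velocity_def cplx_def
  by (auto simp: has_vector_derivative_complex_iff has_real_derivative_iff_has_vector_derivative)

subsection \<open>Manifolds with the identity as global chart\<close>

definition dom_manifold :: "nat \<Rightarrow> (nat \<Rightarrow> real) set \<Rightarrow> (nat \<Rightarrow> real) manifold" where
  "dom_manifold d U = \<lparr> mtop = subtopology (Euclidean_space d) U, mdim = d, atlas = {(U, \<lambda>x. x)} \<rparr>"

lemma dom_manifold_simps [simp]:
  "mtop (dom_manifold d U) = subtopology (Euclidean_space d) U"
  "mdim (dom_manifold d U) = d"
  "atlas (dom_manifold d U) = {(U, \<lambda>x. x)}"
  by (simp_all add: dom_manifold_def)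

lemma riem_manifold_dom: "riem_manifold R = dom_manifold (rdim R) (rset R)"
  by (simp add: riem_manifold_def dom_manifold_def)

lemma inv_into_ident: "y \<in> U \<Longrightarrow> inv_into U (\<lambda>x. x) y = y"
  by (metis f_inv_into_f image_ident)

lemma second_countable_top_of_set:
  fixes S :: "'a::second_countable_topology set"
  shows "second_countable (top_of_set S)"
proof (rule second_countable_subtopology)
  obtain B :: "'a set set" where B: "countable B" "topological_basis B"
    using ex_countable_basis by blast
  show "second_countable (euclidean :: 'a topology)"
    unfolding second_countable_def
  proof (intro exI[of _ B] conjI B(1) ballI allI impI)
    show "openin euclidean V" if "V \<in> B" for V using that topological_basis_open[OF B(2)] by simp
    fix U :: "'a set" and x assume "openin euclidean U \<and> x \<in> U"
    then show "\<exists>V\<in>B. x \<in> V \<and> V \<subseteq> U"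
      using topological_basisE[OF B(2), of U x] by auto
  qed
qed

lemma smooth_manifold_dom:
  assumes U: "openin (Euclidean_space d) U"
  shows "smooth_manifold (dom_manifold d U)"
proof -
  have sub: "U \<subseteq> Rn d" by (rule openin_Rn_subset[OF U])
  have "chart (subtopology (Euclidean_space d) U) d (U, \<lambda>x. x)"
    unfolding chart_def using U
    by (simp add: subtopology_subtopology homeomorphic_map_id[unfolded id_def] openin_subtopology_refl sub)
  moreover have "transition_smooth d (U, \<lambda>x. x) (U, \<lambda>x. x)"
    unfolding transition_smooth_def using U
    by (auto simp: smooth_coord_iff comp_def inv_into_ident intro: smooth_on_cong[OF smooth_on_coord])
  ultimately show ?thesis
    unfolding smooth_manifold_def using sub
    by (simp add: Int_absorb1 Hausdorff_space_subtopology Hausdorff_Euclidean_space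
      second_countable_top_of_set subtopology_Rn[OF sub])
qed

lemma smooth_coord_continuous:
  assumes U: "openin (Euclidean_space d) U" and F: "smooth_coord d U m F" "\<And>x. x \<in> U \<Longrightarrow> F x \<in> Rn m"
  shows "continuous_on U F"
  by (rule continuous_on_into_Rn[OF F(2)])
    (use F(1) smooth_on_continuous in \<open>auto simp: smooth_coord_iff[OF U]\<close>)

lemma smooth_map_dom_iff:
  assumes U: "openin (Euclidean_space d) U" and V: "openin (Euclidean_space m) V"
    and f: "\<And>x. x \<in> U \<Longrightarrow> f x \<in> V"
  shows "smooth_map (dom_manifold d U) (dom_manifold m V) f \<longleftrightarrow> smooth_coord d U m f"
proof -
  have UV: "U \<inter> f -` V = U" using f by auto
  have "smooth_coord d U m ((\<lambda>x. x) \<circ> f \<circ> inv_into U (\<lambda>x. x)) \<longleftrightarrow> smooth_coord d U m f"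
    by (rule smooth_coord_cong[OF U]) (simp add: inv_into_ident)
  moreover have "continuous_map (top_of_set U) (top_of_set V) f" if "smooth_coord d U m f"
  proof -
    have "continuous_on U f"
      by (rule smooth_coord_continuous[OF U that]) (use f openin_Rn_subset[OF V] in auto)
    then show ?thesis using f by auto
  qed
  ultimately show ?thesis
    unfolding smooth_map_def
    by (auto simp: UV subtopology_Rn[OF openin_Rn_subset[OF U]]
      subtopology_Rn[OF openin_Rn_subset[OF V]])
qed

text \<open>The chart of \<open>prod_manifold\<close> packs two coordinate tuples into one;
  \<open>fstR\<close> keeps the first \<open>a\<close> entries, \<open>sndR\<close> shifts the
  remaining ones down.\<close>

definition fstR :: "nat \<Rightarrow> (nat \<Rightarrow> real) \<Rightarrow> nat \<Rightarrow> real" where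
  "fstR a z = (\<lambda>i. if i < a then z i else 0)"

definition sndR :: "nat \<Rightarrow> (nat \<Rightarrow> real) \<Rightarrow> nat \<Rightarrow> real" where
  "sndR a z = (\<lambda>i. z (i + a))"

text \<open>The image of \<open>U \<times> V\<close> under the chart of the product
  manifold.\<close>

definition join_dom :: "nat \<Rightarrow> nat \<Rightarrow> (nat \<Rightarrow> real) set \<Rightarrow> (nat \<Rightarrow> real) set \<Rightarrow> (nat \<Rightarrow> real) set" where
  "join_dom a b U V = {z \<in> Rn (a + b). fstR a z \<in> U \<and> sndR a z \<in> V}"

lemma openin_join_dom:
  assumes "openin (Euclidean_space a) U" "openin (Euclidean_space b) V"
  shows "openin (Euclidean_space (a + b)) (join_dom a b U V)"
proof -
  obtain S T where S: "open S" "U = Rn a \<inter> S" and T: "open T" "V = Rn b \<inter> T"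
    using assms openin_Rn by metis
  have "continuous_on UNIV (fstR a)" "continuous_on UNIV (sndR a)"
    unfolding fstR_def sndR_def
  proof -
    have "continuous_on UNIV (\<lambda>z::nat \<Rightarrow> real. if i < a then z i else 0)" for i
      by (cases "i < a") auto
    then show "continuous_on UNIV (\<lambda>z i. if i < a then z i else 0 :: real)"
      by (rule continuous_on_coordinatewise_then_product)
    show "continuous_on UNIV (\<lambda>z i. z (i + a) :: real)"
      by (rule continuous_on_coordinatewise_then_product) simp
  qed
  then have "open (fstR a -` S \<inter> sndR a -` T)"
    using S(1) T(1) by (intro open_Int open_vimage)
  moreover have "join_dom a b U V = Rn (a + b) \<inter> (fstR a -` S \<inter> sndR a -` T)"
    by (auto simp: join_dom_def S(2) T(2) Rn_iff fstR_def sndR_def)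
  ultimately show ?thesis unfolding openin_Rn by blast
qed

lemma csmooth_on_cplx_fstR:
  "openin (Euclidean_space d) U \<Longrightarrow> csmooth_on d U (\<lambda>z. cplx (fstR a z) j)"
  unfolding csmooth_on_def cplx_def fstR_def complex.sel
  by (cases "2 * j < a"; cases "2 * j + 1 < a") (simp_all add: smooth_on_coord smooth_on_const)

lemma csmooth_on_cplx_sndR:
  "openin (Euclidean_space d) U \<Longrightarrow> csmooth_on d U (\<lambda>z. cplx (sndR a z) j)"
  by (auto simp: csmooth_on_def cplx_def sndR_def smooth_on_coord)

text \<open>Both factors have a single chart, so smoothness is one condition on
  \<open>join_dom\<close>; continuity for the product topology is obtained from continuity in these
  coordinates.\<close>

lemma smooth_map_prod_dom:
  assumes U: "openin (Euclidean_space a) U" and V: "openin (Euclidean_space b) V"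
    and W: "openin (Euclidean_space m) W"
    and f: "\<And>x y. x \<in> U \<Longrightarrow> y \<in> V \<Longrightarrow> f (x, y) \<in> W"
    and s: "smooth_coord (a + b) (join_dom a b U V) m (\<lambda>z. f (fstR a z, sndR a z))"
  shows "smooth_map (prod_manifold (dom_manifold a U) (dom_manifold b V)) (dom_manifold m W) f"
proof -
  define \<phi> where "\<phi> = (\<lambda>(x, y) i. if i < a then x i else y (i - a) :: real)"
  note subs = openin_Rn_subset[OF U] openin_Rn_subset[OF V] openin_Rn_subset[OF W]
  have split: "fstR a (\<phi> (x, y)) = x" "sndR a (\<phi> (x, y)) = y" if "x \<in> U" "y \<in> V" for x y
    using that subs by (auto simp: \<phi>_def fstR_def sndR_def Rn_iff fun_eq_iff subset_iff)
  have join: "\<phi> (fstR a z, sndR a z) = z" for z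
    by (auto simp: \<phi>_def fstR_def sndR_def)
  have inD: "\<phi> (x, y) \<in> join_dom a b U V" if "x \<in> U" "y \<in> V" for x y
    using split[OF that] that subs by (auto simp: join_dom_def \<phi>_def Rn_iff subset_iff)
  have img: "\<phi> ` (U \<times> V) = join_dom a b U V"
  proof
    show "\<phi> ` (U \<times> V) \<subseteq> join_dom a b U V" using inD by auto
    show "join_dom a b U V \<subseteq> \<phi> ` (U \<times> V)"
    proof
      fix z assume "z \<in> join_dom a b U V"
      then show "z \<in> \<phi> ` (U \<times> V)"
        using join[of z] by (intro image_eqI[where x = "(fstR a z, sndR a z)"]) (auto simp: join_dom_def)
    qed
  qed
  have inv: "inv_into (U \<times> V) \<phi> z = (fstR a z, sndR a z)" if "z \<in> join_dom a b U V" for z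
  proof (rule inv_into_f_eq)
    show "inj_on \<phi> (U \<times> V)"
      by (rule inj_on_inverseI[of _ "\<lambda>z. (fstR a z, sndR a z)"]) (use split in auto)
  qed (use that join in \<open>auto simp: join_dom_def\<close>)
  have D: "openin (Euclidean_space (a + b)) (join_dom a b U V)"
    by (rule openin_join_dom[OF U V])
  have *: "smooth_coord (a + b) (join_dom a b U V) m ((\<lambda>x. x) \<circ> f \<circ> inv_into (U \<times> V) \<phi>)"
    by (subst smooth_coord_cong[OF D, of _ "\<lambda>z. f (fstR a z, sndR a z)"]) (auto simp: inv s)
  have vim: "(U \<times> V) \<inter> f -` W = U \<times> V" using f by auto
  have "continuous_on (join_dom a b U V) (\<lambda>z. f (fstR a z, sndR a z))"
    by (rule smooth_coord_continuous[OF D s]) (use f subs in \<open>auto simp: join_dom_def\<close>)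
  moreover have "continuous_on (U \<times> V) \<phi>"
  proof (rule continuous_on_coordinatewise_then_product)
    fix i
    have "continuous_on (U \<times> V) (\<lambda>p. fst p i)" "continuous_on (U \<times> V) (\<lambda>p. snd p (i - a))"
      by (rule continuous_on_product_then_coordinatewise,
          rule continuous_on_fst continuous_on_snd, rule continuous_on_id)+
    then show "continuous_on (U \<times> V) (\<lambda>p. \<phi> p i)"
      by (cases "i < a") (simp_all add: \<phi>_def case_prod_beta)
  qed
  ultimately have "continuous_on (U \<times> V) (\<lambda>p. f (fstR a (\<phi> p), sndR a (\<phi> p)))"
    by (rule continuous_on_compose2[of "join_dom a b U V" _ "U \<times> V" \<phi>]) (use inD in auto)
  then have "continuous_on (U \<times> V) f"
    by (rule continuous_on_eq) (use split in auto)
  then have "continuous_map (prod_topology (top_of_set U) (top_of_set V)) (top_of_set W) f"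
    using f by (auto simp: prod_topology_subtopology_eu)
  moreover have "prod_manifold (dom_manifold a U) (dom_manifold b V) =
    \<lparr> mtop = prod_topology (top_of_set U) (top_of_set V), mdim = a + b, atlas = {(U \<times> V, \<phi>)} \<rparr>"
    by (simp add: prod_manifold_def \<phi>_def subtopology_Rn subs cong: if_cong)
  ultimately show ?thesis
    unfolding smooth_map_def
    using * by (simp add: subtopology_Rn subs vim img)
qed

section \<open>Siegel coordinates on complex hyperbolic space\<close>

text \<open>
  The Cayley transform sends the boundary point \<open>(1, 0, \<dots>, 0)\<close> to infinity: with
  \<open>\<omega> = (1 + z\<^sub>0) / (1 - z\<^sub>0)\<close> and \<open>\<zeta>\<^sub>j = z\<^sub>j / (1 - z\<^sub>0)\<close> the ball becomes the
  Siegel domain \<open>Re \<omega> > \<Sum>\<bar>\<zeta>\<^sub>j\<bar>\<^sup>2\<close>, on which the horospherical group acts by affine maps.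
\<close>

abbreviation ball_CH :: "nat \<Rightarrow> (nat \<Rightarrow> real) set" where
  "ball_CH n \<equiv> rset (CH n)"

definition om :: "(nat \<Rightarrow> real) \<Rightarrow> complex" where
  "om z = (1 + cplx z 0) / (1 - cplx z 0)"

definition ze :: "(nat \<Rightarrow> real) \<Rightarrow> nat \<Rightarrow> complex" where
  "ze z j = cplx z j / (1 - cplx z 0)"

definition dot :: "nat \<Rightarrow> (nat \<Rightarrow> complex) \<Rightarrow> (nat \<Rightarrow> complex) \<Rightarrow> complex" where
  "dot n v w = (\<Sum>j=1..<n. v j * cnj (w j))"

text \<open>Its level sets are the horospheres centred at the boundary point that the Cayley
  transform sends to infinity.\<close>

definition ht :: "nat \<Rightarrow> (nat \<Rightarrow> real) \<Rightarrow> real" where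
  "ht n z = Re (om z) - Re (dot n (ze z) (ze z))"

text \<open>The differential of \<open>om\<close> at \<open>z\<close>, applied to \<open>v\<close>;
  likewise \<open>dze\<close> is that of \<open>ze\<close>.\<close>

definition dom :: "(nat \<Rightarrow> real) \<Rightarrow> (nat \<Rightarrow> real) \<Rightarrow> complex" where
  "dom z v = 2 * cplx v 0 / (1 - cplx z 0)\<^sup>2"

definition dze :: "(nat \<Rightarrow> real) \<Rightarrow> (nat \<Rightarrow> real) \<Rightarrow> nat \<Rightarrow> complex" where
  "dze z v j = cplx v j / (1 - cplx z 0) + cplx z j * cplx v 0 / (1 - cplx z 0)\<^sup>2"

text \<open>Twice its real part is the differential of \<open>ht\<close>. Subtracting the
  \<zeta>-term makes the metric diagonal in \<open>bet\<close> and \<open>dze\<close>.\<close>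

definition bet :: "nat \<Rightarrow> (nat \<Rightarrow> real) \<Rightarrow> (nat \<Rightarrow> real) \<Rightarrow> complex" where
  "bet n z v = dom z v / 2 - dot n (dze z v) (ze z)"

definition cvec :: "nat \<Rightarrow> (nat \<Rightarrow> complex) \<Rightarrow> nat \<Rightarrow> real" where
  "cvec n c = (\<lambda>i. if i < 2 * n then (if even i then Re (c (i div 2)) else Im (c (i div 2))) else 0)"

text \<open>The inverse Cayley transform. Coordinate 0 comes from \<open>w\<close>, so
  \<open>\<zeta>\<close> is read only at indices from 1 on.\<close>

definition of_siegel :: "nat \<Rightarrow> complex \<Rightarrow> (nat \<Rightarrow> complex) \<Rightarrow> nat \<Rightarrow> real" where
  "of_siegel n w \<zeta> = cvec n (\<lambda>j. if j = 0 then (w - 1) / (w + 1) else 2 * \<zeta> j / (w + 1))"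

section \<open>The Hermitian product on the \<zeta>-coordinates, and the ball\<close>

lemma dot_add_left: "dot n (\<lambda>j. v j + w j) x = dot n v x + dot n w x"
  by (simp add: dot_def sum.distrib algebra_simps)

lemma dot_add_right: "dot n x (\<lambda>j. v j + w j) = dot n x v + dot n x w"
  by (simp add: dot_def sum.distrib algebra_simps)

lemma dot_scale_left: "dot n (\<lambda>j. a * v j) x = a * dot n v x"
  by (simp add: dot_def sum_distrib_left mult.assoc)

lemma dot_scale_right: "dot n x (\<lambda>j. a * v j) = cnj a * dot n x v"
  by (simp add: dot_def sum_distrib_left algebra_simps)

lemma dot_cnj: "cnj (dot n v w) = dot n w v"
  by (simp add: dot_def mult.commute)

lemma dot_cong: "(\<And>j. 1 \<le> j \<Longrightarrow> j < n \<Longrightarrow> v j = v' j) \<Longrightarrow> (\<And>j. 1 \<le> j \<Longrightarrow> j < n \<Longrightarrow> w j = w' j) \<Longrightarrow> dot n v w = dot n v' w'"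
  by (simp add: dot_def)

lemma dot_self: "dot n v v = complex_of_real (\<Sum>j=1..<n. (cmod (v j))\<^sup>2)"
  by (simp add: dot_def complex_norm_square del: of_real_power)

lemma dot_self_Im [simp]: "Im (dot n v v) = 0"
  by (simp add: dot_self)

lemma dot_self_ge_0: "0 \<le> Re (dot n v v)"
  by (simp add: dot_self sum_nonneg)

lemma dot_self_eq_0: "Re (dot n v v) = 0 \<Longrightarrow> 1 \<le> j \<Longrightarrow> j < n \<Longrightarrow> v j = 0"
  by (simp add: dot_self sum_nonneg_eq_0_iff)

lemma herm_dot: "0 < n \<Longrightarrow> herm n v w = cplx v 0 * cnj (cplx w 0) + dot n (cplx v) (cplx w)"
  by (simp add: herm_def dot_def lessThan_atLeast0 sum.atLeast_Suc_lessThan)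

lemma sum_pairs: "(\<Sum>i<2 * n. f i) = (\<Sum>j<n. f (2 * j) + f (2 * j + 1))" for f :: "nat \<Rightarrow> real"
  by (induction n) auto

lemma Re_herm: "Re (herm n v w) = (\<Sum>i<2 * n. v i * w i)"
  by (simp add: herm_def sum_pairs cplx_def)

lemma ball_CH_iff: "z \<in> ball_CH n \<longleftrightarrow> z \<in> Rn (2 * n) \<and> Re (herm n z z) < 1"
  by (simp add: CH_def Re_herm power2_eq_square)

lemma rdim_CH [simp]: "rdim (CH n) = 2 * n"
  by (simp add: CH_def)

lemma ball_CH_subset: "ball_CH n \<subseteq> Rn (2 * n)"
  using ball_CH_iff by blast

lemma openin_ball_CH: "openin (Euclidean_space (2 * n)) (ball_CH n)"
proof -
  have "open {z :: nat \<Rightarrow> real. (\<Sum>i<2 * n. (z i)\<^sup>2) < 1}"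
    by (intro open_Collect_less continuous_on_sum continuous_on_power continuous_on_product_coordinates continuous_on_const)
  moreover have "ball_CH n = Rn (2 * n) \<inter> {z. (\<Sum>i<2 * n. (z i)\<^sup>2) < 1}"
    by (auto simp: CH_def)
  ultimately show ?thesis unfolding openin_Rn by blast
qed

lemma cplx_vec: "j < n \<Longrightarrow> cplx (cvec n c) j = c j"
  by (auto simp: cplx_def cvec_def)

lemma vec_in_Rn: "cvec n c \<in> Rn (2 * n)"
  by (simp add: Rn_iff cvec_def)

lemma cplx_eqI: "x \<in> Rn (2 * n) \<Longrightarrow> y \<in> Rn (2 * n) \<Longrightarrow> (\<And>j. j < n \<Longrightarrow> cplx x j = cplx y j) \<Longrightarrow> x = y"
proof
  fix i assume a: "x \<in> Rn (2 * n)" "y \<in> Rn (2 * n)" "\<And>j. j < n \<Longrightarrow> cplx x j = cplx y j"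
  show "x i = y i"
  proof (cases "i < 2 * n")
    case True
    then have "cplx x (i div 2) = cplx y (i div 2)" using a(3) by auto
    then show ?thesis by (cases "even i") (auto simp: cplx_def elim!: evenE oddE)
  qed (use a in \<open>auto simp: Rn_iff\<close>)
qed

lemma cplx0_norm:
  assumes "z \<in> ball_CH n" "0 < n"
  shows "cmod (cplx z 0) < 1"
proof -
  have "(cmod (cplx z 0))\<^sup>2 \<le> Re (herm n z z)"
    using dot_self_ge_0[of n "cplx z"]
    unfolding cmod_power2 by (simp add: herm_dot[OF assms(2)] power2_eq_square)
  then have "(cmod (cplx z 0))\<^sup>2 < 1" using assms by (simp add: ball_CH_iff)
  then show ?thesis by (simp add: power_less_one_iff abs_square_less_1)
qed

lemma one_minus_cplx0:
  assumes "z \<in> ball_CH n" "0 < n"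
  shows "1 - cplx z 0 \<noteq> 0"
  using cplx0_norm[OF assms] by auto

section \<open>The height and the Bergman metric in Siegel coordinates\<close>

lemma ht_eq:
  assumes "z \<in> ball_CH n" "0 < n"
  shows "ht n z = (1 - Re (herm n z z)) / (cmod (1 - cplx z 0))\<^sup>2"
proof -
  define D where "D = 1 - cplx z 0"
  have D: "D \<noteq> 0" using one_minus_cplx0[OF assms] by (simp add: D_def)
  have "dot n (ze z) (ze z) = dot n (cplx z) (cplx z) / (D * cnj D)"
    by (simp add: dot_def ze_def D_def sum_divide_distrib)
  also have "D * cnj D = complex_of_real ((cmod D)\<^sup>2)"
    using complex_norm_square by simp
  finally have 1: "Re (dot n (ze z) (ze z)) = Re (dot n (cplx z) (cplx z)) / (cmod D)\<^sup>2"
    by simp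
  have "om z = (1 + cplx z 0) * cnj D / (D * cnj D)"
    using D by (simp add: om_def D_def)
  also have "D * cnj D = complex_of_real ((cmod D)\<^sup>2)"
    using complex_norm_square by simp
  finally have "Re (om z) = Re ((1 + cplx z 0) * cnj D) / (cmod D)\<^sup>2"
    by simp
  moreover have "Re ((1 + cplx z 0) * cnj D) = 1 - Re (cplx z 0 * cnj (cplx z 0))"
    by (simp add: D_def algebra_simps)
  ultimately show ?thesis
    using 1 by (simp add: ht_def herm_dot[OF assms(2)] D_def diff_divide_distrib add_divide_distrib algebra_simps)
qed

lemma ht_pos: "z \<in> ball_CH n \<Longrightarrow> 0 < n \<Longrightarrow> 0 < ht n z"
  using one_minus_cplx0[of z n] by (simp add: ht_eq ball_CH_iff)

text \<open>What remains of \<open>rmetric_siegel\<close> after clearing denominators. Primed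
  letters stand for conjugates but are free variables here, which makes it a polynomial identity.
  \<open>m\<close> is \<open>1 - herm n z z\<close>; \<open>a\<close>, \<open>b\<close>,
  \<open>c\<close> are the Hermitian products of \<open>v, w\<close>, of \<open>v, z\<close> and of
  \<open>z, w\<close> over the coordinates from 1 on.\<close>

lemma siegel_metric_identity:
  fixes z0 z0' v0 w0' a b c m :: complex
  shows "m * (a * ((1 - z0) * (1 - z0')) + b * (1 - z0) * w0' + c * v0 * (1 - z0') + (1 - z0 * z0' - m) * v0 * w0')
    + (v0 * (1 - z0') - b * (1 - z0) - (1 - z0 * z0' - m) * v0) * (w0' * (1 - z0) - c * (1 - z0') - (1 - z0 * z0' - m) * w0')
    = (1 - z0) * (1 - z0') * (m * (v0 * w0' + a) + (v0 * z0' + b) * (z0 * w0' + c))"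
  by algebra

text \<open>Siegel coordinates split a tangent vector into orthogonal parts \<open>dze\<close> and
  \<open>bet\<close>, weighted by powers of the height. The affine maps, the orbits and the sections
  are all treated in this form.\<close>

lemma rmetric_siegel:
  assumes z: "z \<in> ball_CH n" "0 < n"
  shows "rmetric (CH n) z v w =
    4 * Re (dot n (dze z v) (dze z w) / ht n z + bet n z v * cnj (bet n z w) / (ht n z)\<^sup>2)"
proof -
  define D D' where "D = 1 - cplx z 0" and "D' = cnj D"
  have D: "D \<noteq> 0" "D' \<noteq> 0" using one_minus_cplx0[OF assms] by (simp_all add: D_def D'_def)
  define v0 w0 where "v0 = cplx v 0" and "w0 = cnj (cplx w 0)"
  define a b c e where "a = dot n (cplx v) (cplx w)" and "b = dot n (cplx v) (cplx z)"
    and "c = dot n (cplx z) (cplx w)" and "e = dot n (cplx z) (cplx z)"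
  define m where "m = 1 - herm n z z"
  have e: "e = 1 - cplx z 0 * cnj (cplx z 0) - m"
    by (simp add: m_def e_def herm_dot[OF z(2)])
  have mreal: "m = complex_of_real (Re m)"
    by (simp add: m_def complex_eq_iff herm_dot[OF z(2)])
  have Rem: "Re m > 0" using z(1) by (simp add: m_def ball_CH_iff)
  then have m0: "m \<noteq> 0" using mreal by auto
  have DD: "D * D' = complex_of_real ((cmod D)\<^sup>2)"
    using complex_norm_square D'_def by simp
  have "ht n z = Re m / (cmod D)\<^sup>2"
    by (simp add: ht_eq[OF z] m_def D_def)
  then have ht: "complex_of_real (ht n z) = m / (D * D')"
    using DD mreal by simp
  then have ht2: "complex_of_real ((ht n z)\<^sup>2) = (m / (D * D'))\<^sup>2"
    by simp
  have dv: "dze z v j = (cplx v j * D + cplx z j * v0) / D\<^sup>2" for j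
    using D by (simp add: dze_def D_def[symmetric] v0_def field_simps power2_eq_square)
  have dw: "cnj (dze z w j) = (cnj (cplx w j) * D' + cnj (cplx z j) * w0) / D'\<^sup>2" for j
    using D by (simp add: dze_def D_def[symmetric] D'_def w0_def field_simps power2_eq_square)
  have "dot n (dze z v) (dze z w) =
      (\<Sum>j=1..<n. (D * D' * (cplx v j * cnj (cplx w j)) + D * w0 * (cplx v j * cnj (cplx z j))
         + v0 * D' * (cplx z j * cnj (cplx w j)) + v0 * w0 * (cplx z j * cnj (cplx z j))) / (D * D')\<^sup>2)"
    unfolding dot_def dv dw by (intro sum.cong refl) (simp add: field_simps power2_eq_square)
  also have "\<dots> = (D * D' * a + D * w0 * b + v0 * D' * c + v0 * w0 * e) / (D * D')\<^sup>2"
    by (simp add: a_def b_def c_def e_def dot_def sum_distrib_left sum_divide_distrib sum.distrib add_divide_distrib)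
  finally have A: "dot n (dze z v) (dze z w) = (D * D' * a + D * w0 * b + v0 * D' * c + v0 * w0 * e) / (D * D')\<^sup>2" .
  have "dot n (dze z v) (ze z) = (\<Sum>j=1..<n. (D * (cplx v j * cnj (cplx z j)) + v0 * (cplx z j * cnj (cplx z j))) / (D\<^sup>2 * D'))"
    unfolding dot_def dv ze_def
    by (intro sum.cong refl) (simp add: D_def[symmetric] D'_def field_simps power2_eq_square)
  also have "\<dots> = (D * b + v0 * e) / (D\<^sup>2 * D')"
    by (simp add: b_def e_def dot_def sum_distrib_left sum_divide_distrib sum.distrib add_divide_distrib)
  finally have "bet n z v = v0 / D\<^sup>2 - (D * b + v0 * e) / (D\<^sup>2 * D')"
    by (simp add: bet_def dom_def D_def v0_def)
  then have B: "bet n z v = (v0 * D' - b * D - e * v0) / (D\<^sup>2 * D')"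
    using D by (simp add: field_simps)
  have "cnj (dot n (dze z w) (ze z)) = (\<Sum>j=1..<n. (D' * (cplx z j * cnj (cplx w j)) + w0 * (cplx z j * cnj (cplx z j))) / (D'\<^sup>2 * D))"
    unfolding dot_def cnj_sum complex_cnj_mult dw ze_def complex_cnj_cnj
    by (intro sum.cong refl) (simp add: D_def[symmetric] D'_def field_simps power2_eq_square)
  also have "\<dots> = (D' * c + w0 * e) / (D'\<^sup>2 * D)"
    by (simp add: c_def e_def dot_def sum_distrib_left sum_divide_distrib sum.distrib add_divide_distrib)
  finally have "cnj (bet n z w) = w0 / D'\<^sup>2 - (D' * c + w0 * e) / (D'\<^sup>2 * D)"
    by (simp add: bet_def dom_def D_def D'_def w0_def)
  then have C: "cnj (bet n z w) = (w0 * D - c * D' - e * w0) / (D'\<^sup>2 * D)"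
    using D by (simp add: field_simps)
  have "dot n (dze z v) (dze z w) / ht n z + bet n z v * cnj (bet n z w) / (ht n z)\<^sup>2
     = (m * (a * (D * D') + b * D * w0 + c * v0 * D' + e * v0 * w0)
        + (v0 * D' - b * D - e * v0) * (w0 * D - c * D' - e * w0)) / (D * D' * m\<^sup>2)"
    unfolding A B C ht ht2 using D m0 by (simp add: divide_simps) (simp add: algebra_simps power2_eq_square)
  also have "\<dots> = (D * D' * (m * (v0 * w0 + a) + (v0 * cnj (cplx z 0) + b) * (cplx z 0 * w0 + c))) / (D * D' * m\<^sup>2)"
    using siegel_metric_identity[of m a "cplx z 0" "cnj (cplx z 0)" b w0 c v0]
    by (simp add: e D'_def D_def)
  also have "\<dots> = (v0 * w0 + a) / m + (v0 * cnj (cplx z 0) + b) * (cplx z 0 * w0 + c) / m\<^sup>2"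
    using D m0 by (simp add: divide_simps) (simp add: algebra_simps power2_eq_square)
  also have "\<dots> = herm n v w / (1 - herm n z z) + herm n v z * herm n z w / (1 - herm n z z)\<^sup>2"
    by (simp add: m_def[symmetric]) (simp add: herm_dot[OF z(2)] a_def b_def c_def v0_def w0_def)
  finally show ?thesis by (simp add: CH_def)
qed

section \<open>The inverse Cayley transform; smoothness and differentials of the coordinates\<close>

lemma om_of_siegel: "w + 1 \<noteq> 0 \<Longrightarrow> 0 < n \<Longrightarrow> om (of_siegel n w \<zeta>) = w"
proof -
  assume w: "w + 1 \<noteq> 0" "0 < n"
  have "1 + (w - 1) / (w + 1) = 2 * w / (w + 1)" "1 - (w - 1) / (w + 1) = 2 / (w + 1)"
    using w(1) by (simp_all add: divide_simps)
  then show ?thesis using w by (simp add: om_def of_siegel_def cplx_vec)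
qed

lemma ze_of_siegel: "w + 1 \<noteq> 0 \<Longrightarrow> 0 < n \<Longrightarrow> j < n \<Longrightarrow> 1 \<le> j \<Longrightarrow> ze (of_siegel n w \<zeta>) j = \<zeta> j"
proof -
  assume w: "w + 1 \<noteq> 0" "0 < n" "j < n" "1 \<le> j"
  have "1 - (w - 1) / (w + 1) = 2 / (w + 1)"
    using w(1) by (simp add: divide_simps)
  then show ?thesis using w by (simp add: ze_def of_siegel_def cplx_vec)
qed

lemma siegel_nz:
  assumes "Re (dot n \<zeta> \<zeta>) < Re w"
  shows "w + 1 \<noteq> 0"
  using dot_self_ge_0[of n \<zeta>] assms by (auto simp: complex_eq_iff)

lemma of_siegel_in_ball:
  assumes "Re (dot n \<zeta> \<zeta>) < Re w" "0 < n"
  shows "of_siegel n w \<zeta> \<in> ball_CH n"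
proof -
  define d where "d = complex_of_real ((cmod (w + 1))\<^sup>2)"
  have d: "d = (w + 1) * cnj (w + 1)" using complex_norm_square d_def by simp
  have "herm n (of_siegel n w \<zeta>) (of_siegel n w \<zeta>) =
      ((w - 1) * cnj (w - 1) + 4 * dot n \<zeta> \<zeta>) / d"
    by (simp add: herm_dot[OF assms(2)] of_siegel_def cplx_vec assms(2) dot_def sum_distrib_left d
        sum_divide_distrib add_divide_distrib)
  then have "Re (herm n (of_siegel n w \<zeta>) (of_siegel n w \<zeta>)) =
      (Re ((w - 1) * cnj (w - 1)) + 4 * Re (dot n \<zeta> \<zeta>)) / (cmod (w + 1))\<^sup>2"
    by (simp add: d_def)
  also have "\<dots> < 1"
  proof -
    have "Re ((w - 1) * cnj (w - 1)) + 4 * Re (dot n \<zeta> \<zeta>) < (cmod (w + 1))\<^sup>2"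
      using assms(1) unfolding cmod_power2 by (simp add: power2_eq_square algebra_simps)
    then show ?thesis using siegel_nz[OF assms(1)] by (simp add: divide_less_eq)
  qed
  finally show ?thesis
    by (simp add: ball_CH_iff of_siegel_def vec_in_Rn)
qed

lemma of_siegel_inverse:
  assumes z: "z \<in> ball_CH n" "0 < n"
  shows "of_siegel n (om z) (ze z) = z"
proof (rule cplx_eqI)
  have D: "1 - cplx z 0 \<noteq> 0" by (rule one_minus_cplx0[OF z])
  have 1: "om z + 1 = 2 / (1 - cplx z 0)" "om z - 1 = 2 * cplx z 0 / (1 - cplx z 0)"
    using D by (simp_all add: om_def field_simps)
  show "cplx (of_siegel n (om z) (ze z)) j = cplx z j" if "j < n" for j
    using that D by (simp add: of_siegel_def cplx_vec 1 ze_def)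
qed (use z ball_CH_subset in \<open>auto simp: of_siegel_def vec_in_Rn\<close>)

lemma siegel_eqI:
  assumes "z \<in> ball_CH n" "z' \<in> ball_CH n" "0 < n" "om z = om z'"
    and "\<And>j. 1 \<le> j \<Longrightarrow> j < n \<Longrightarrow> ze z j = ze z' j"
  shows "z = z'"
proof -
  have "of_siegel n (om z) (ze z) = of_siegel n (om z') (ze z')"
    unfolding of_siegel_def cvec_def using assms(3-5) by (auto simp: fun_eq_iff)
  then show ?thesis using of_siegel_inverse assms by metis
qed

lemma csmooth_on_om:
  assumes "0 < n" shows "csmooth_on (2 * n) (ball_CH n) om"
  unfolding om_def[abs_def]
  by (intro csmooth_on_divide csmooth_on_add csmooth_on_diff csmooth_on_const csmooth_on_cplx openin_ball_CH)
    (rule one_minus_cplx0[OF _ assms])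

lemma csmooth_on_ze:
  assumes "0 < n" shows "csmooth_on (2 * n) (ball_CH n) (\<lambda>z. ze z j)"
  unfolding ze_def
  by (intro csmooth_on_divide csmooth_on_diff csmooth_on_const csmooth_on_cplx openin_ball_CH)
    (rule one_minus_cplx0[OF _ assms])

lemma csmooth_on_dot:
  "openin (Euclidean_space d) U \<Longrightarrow> (\<And>j. csmooth_on d U (\<lambda>x. f x j)) \<Longrightarrow> (\<And>j. csmooth_on d U (\<lambda>x. g x j)) \<Longrightarrow>
   csmooth_on d U (\<lambda>x. dot n (f x) (g x))"
  unfolding dot_def by (intro csmooth_on_sum csmooth_on_mult csmooth_on_cnj)

lemma smooth_on_ht: "0 < n \<Longrightarrow> smooth_on (2 * n) (ball_CH n) (ht n)"
  unfolding ht_def[abs_def]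
  by (intro smooth_on_diff csmooth_on_Re csmooth_on_om csmooth_on_dot csmooth_on_ze openin_ball_CH)

lemma smooth_coord_vec:
  assumes U: "openin (Euclidean_space d) U" and "\<And>j. j < n \<Longrightarrow> csmooth_on d U (\<lambda>x. c x j)"
  shows "smooth_coord d U (2 * n) (\<lambda>x. cvec n (c x))"
proof -
  have "smooth_on d U (\<lambda>x. cvec n (c x) i)" if "i < 2 * n" for i
  proof -
    have "csmooth_on d U (\<lambda>x. c x (i div 2))" by (rule assms(2)) (use that in auto)
    then show ?thesis using that by (cases "even i") (auto simp: cvec_def csmooth_on_def)
  qed
  then show ?thesis by (simp add: smooth_coord_iff[OF U])
qed

lemma smooth_coord_of_siegel:
  assumes U: "openin (Euclidean_space d) U" and "csmooth_on d U w" "\<And>j. 1 \<le> j \<Longrightarrow> j < n \<Longrightarrow> csmooth_on d U (\<lambda>x. \<zeta> x j)"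
    and "\<And>x. x \<in> U \<Longrightarrow> w x + 1 \<noteq> 0"
  shows "smooth_coord d U (2 * n) (\<lambda>x. of_siegel n (w x) (\<zeta> x))"
  unfolding of_siegel_def
proof (rule smooth_coord_vec[OF U])
  fix j assume "j < n"
  show "csmooth_on d U (\<lambda>x. if j = 0 then (w x - 1) / (w x + 1) else 2 * \<zeta> x j / (w x + 1))"
    using assms \<open>j < n\<close>
    by (cases "j = 0") (auto intro!: csmooth_on_divide csmooth_on_diff csmooth_on_add csmooth_on_mult csmooth_on_const)
qed

lemma om_velocity:
  assumes "has_velocity c v s" "c s \<in> ball_CH n" "0 < n"
  shows "((\<lambda>t. om (c t)) has_vector_derivative dom (c s) v) (at s)"
proof -
  have "((\<lambda>t. cplx (c t) 0) has_vector_derivative cplx v 0) (at s)"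
    by (rule has_velocity_cplx[OF assms(1)])
  moreover have "((\<lambda>x. (1 + x) / (1 - x)) has_field_derivative 2 / (1 - cplx (c s) 0)\<^sup>2) (at (cplx (c s) 0))"
    using one_minus_cplx0[OF assms(2,3)]
    by (auto intro!: derivative_eq_intros simp: field_simps power2_eq_square)
  ultimately have "((\<lambda>x. (1 + x) / (1 - x)) \<circ> (\<lambda>t. cplx (c t) 0) has_vector_derivative
      cplx v 0 * (2 / (1 - cplx (c s) 0)\<^sup>2)) (at s)"
    by (rule field_vector_diff_chain_at)
  then show ?thesis by (simp add: om_def dom_def comp_def mult.commute)
qed

lemma ze_velocity:
  assumes "has_velocity c v s" "c s \<in> ball_CH n" "0 < n"
  shows "((\<lambda>t. ze (c t) j) has_vector_derivative dze (c s) v j) (at s)"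
proof -
  note d = has_velocity_cplx[OF assms(1)]
  have "((\<lambda>x. inverse (1 - x)) has_field_derivative 1 / (1 - cplx (c s) 0)\<^sup>2) (at (cplx (c s) 0))"
    using one_minus_cplx0[OF assms(2,3)]
    by (auto intro!: derivative_eq_intros simp: field_simps power2_eq_square)
  from field_vector_diff_chain_at[OF d[of 0] this]
  have "((\<lambda>t. inverse (1 - cplx (c t) 0)) has_vector_derivative
      cplx v 0 * (1 / (1 - cplx (c s) 0)\<^sup>2)) (at s)" by (simp add: comp_def)
  from has_vector_derivative_mult[OF d[of j] this]
  show ?thesis by (simp add: ze_def dze_def divide_inverse algebra_simps)
qed

section \<open>Affine maps of the Siegel domain\<close>

text \<open>The map is the diagonal unitary \<open>L\<close>, followed by the Heisenberg translation
  with horizontal part \<open>t\<close> and central part \<open>u\<close>, followed by the dilation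
  by \<open>a\<close>.\<close>

definition siegel_om :: "nat \<Rightarrow> real \<Rightarrow> (nat \<Rightarrow> complex) \<Rightarrow> (nat \<Rightarrow> complex) \<Rightarrow> real \<Rightarrow> (nat \<Rightarrow> real) \<Rightarrow> complex" where
  "siegel_om n a L t u z =
     complex_of_real (a\<^sup>2) * (om z + 2 * dot n (\<lambda>j. L j * ze z j) t + dot n t t + \<i> * complex_of_real u)"

definition siegel_ze :: "real \<Rightarrow> (nat \<Rightarrow> complex) \<Rightarrow> (nat \<Rightarrow> complex) \<Rightarrow> (nat \<Rightarrow> real) \<Rightarrow> nat \<Rightarrow> complex" where
  "siegel_ze a L t z j = complex_of_real a * (L j * ze z j + t j)"

definition smap :: "nat \<Rightarrow> real \<Rightarrow> (nat \<Rightarrow> complex) \<Rightarrow> (nat \<Rightarrow> complex) \<Rightarrow> real \<Rightarrow> (nat \<Rightarrow> real) \<Rightarrow> nat \<Rightarrow> real" where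
  "smap n a L t u z = of_siegel n (siegel_om n a L t u z) (siegel_ze a L t z)"

text \<open>The squared hyperbolic cosine of half the distance. The numerator polarises the height:
  for \<open>p = q\<close> the expression inside \<open>cmod\<close> is
  \<open>2 * ht n p\<close>.\<close>

definition rho :: "nat \<Rightarrow> (nat \<Rightarrow> real) \<Rightarrow> (nat \<Rightarrow> real) \<Rightarrow> real" where
  "rho n p q = (cmod (om p + cnj (om q) - 2 * dot n (ze p) (ze q)))\<^sup>2 / (4 * ht n p * ht n q)"

lemma dot_unimodular:
  assumes "\<And>j. 1 \<le> j \<Longrightarrow> j < n \<Longrightarrow> cmod (L j) = 1"
  shows "dot n (\<lambda>j. L j * v j) (\<lambda>j. L j * w j) = dot n v w"
  unfolding dot_def
proof (intro sum.cong refl)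
  fix j assume "j \<in> {1..<n}"
  then have "L j * cnj (L j) = 1"
    using assms[of j] complex_norm_square[of "L j"] by simp
  moreover have "L j * v j * cnj (L j * w j) = (L j * cnj (L j)) * (v j * cnj (w j))"
    by (simp add: algebra_simps)
  ultimately show "L j * v j * cnj (L j * w j) = v j * cnj (w j)" by simp
qed

lemma has_vector_derivative_eventually_cong:
  assumes "(f has_vector_derivative D) (at x)" "eventually (\<lambda>y. f y = g y) (nhds x)"
  shows "(g has_vector_derivative D) (at x)"
  using assms has_vector_derivative_cong_ev[of UNIV f g x D] eventually_nhds_x_imp_x by auto

locale siegel_map =
  fixes n :: nat and a :: real and L t :: "nat \<Rightarrow> complex" and u :: real
  assumes n: "0 < n" and a: "0 < a" and L: "\<And>j. 1 \<le> j \<Longrightarrow> j < n \<Longrightarrow> cmod (L j) = 1"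
begin

lemma dot_L: "dot n (\<lambda>j. L j * v j) (\<lambda>j. L j * w j) = dot n v w"
  by (rule dot_unimodular) (rule L)

text \<open>The terms that \<open>t\<close> adds to the real part of \<omega> are those it adds to
  the squared norm of \<zeta>, and \<open>u\<close> changes the imaginary part only.\<close>

lemma siegel_height:
  "Re (siegel_om n a L t u z) - Re (dot n (siegel_ze a L t z) (siegel_ze a L t z)) = a\<^sup>2 * ht n z"
proof -
  have "Re (dot n t (\<lambda>j. L j * ze z j)) = Re (dot n (\<lambda>j. L j * ze z j) t)"
    using dot_cnj[of n t "\<lambda>j. L j * ze z j"] by (metis complex_cnj(1) complex_surj complex.sel(1) cnj.sel(1))
  then have "Re (dot n (siegel_ze a L t z) (siegel_ze a L t z)) =
     a\<^sup>2 * (Re (dot n (ze z) (ze z)) + 2 * Re (dot n (\<lambda>j. L j * ze z j) t) + Re (dot n t t))"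
    unfolding siegel_ze_def dot_scale_left dot_scale_right dot_add_left dot_add_right
    by (simp add: dot_L power2_eq_square algebra_simps)
  then show ?thesis
    by (simp add: siegel_om_def ht_def algebra_simps)
qed

lemma siegel_in: "z \<in> ball_CH n \<Longrightarrow>
    Re (dot n (siegel_ze a L t z) (siegel_ze a L t z)) < Re (siegel_om n a L t u z)"
  using siegel_height[of z] ht_pos[of z n] n a by (smt (verit) mult_pos_pos zero_less_power)

lemma smap_in_ball: "z \<in> ball_CH n \<Longrightarrow> smap n a L t u z \<in> ball_CH n"
  unfolding smap_def by (rule of_siegel_in_ball[OF siegel_in n])

lemma om_smap: "z \<in> ball_CH n \<Longrightarrow> om (smap n a L t u z) = siegel_om n a L t u z"
  unfolding smap_def by (rule om_of_siegel[OF siegel_nz[OF siegel_in] n])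

lemma ze_smap: "z \<in> ball_CH n \<Longrightarrow> 1 \<le> j \<Longrightarrow> j < n \<Longrightarrow> ze (smap n a L t u z) j = siegel_ze a L t z j"
  unfolding smap_def by (rule ze_of_siegel[OF siegel_nz[OF siegel_in] n])

lemma dot_ze_smap:
  "z \<in> ball_CH n \<Longrightarrow> w \<in> ball_CH n \<Longrightarrow>
   dot n (ze (smap n a L t u z)) (ze (smap n a L t u w)) = dot n (siegel_ze a L t z) (siegel_ze a L t w)"
  by (rule dot_cong) (simp_all add: ze_smap)

lemma ht_smap: "z \<in> ball_CH n \<Longrightarrow> ht n (smap n a L t u z) = a\<^sup>2 * ht n z"
  unfolding ht_def[of n "smap n a L t u z"] by (simp add: om_smap dot_ze_smap siegel_height)

text \<open>The polarised height is multiplied by \<open>a\<^sup>2\<close>, just as the height is: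
  the terms with \<open>t\<close> cancel as in \<open>siegel_height\<close>, and the central part
  cancels against its conjugate.\<close>

lemma rho_smap:
  assumes "z \<in> ball_CH n" "w \<in> ball_CH n"
  shows "rho n (smap n a L t u z) (smap n a L t u w) = rho n z w"
proof -
  have "om (smap n a L t u z) + cnj (om (smap n a L t u w))
      - 2 * dot n (ze (smap n a L t u z)) (ze (smap n a L t u w))
    = complex_of_real (a\<^sup>2) * (om z + cnj (om w) - 2 * dot n (ze z) (ze w))"
    unfolding om_smap[OF assms(1)] om_smap[OF assms(2)] dot_ze_smap[OF assms]
      siegel_om_def siegel_ze_def dot_scale_left dot_scale_right dot_add_left dot_add_right
      dot_L complex_cnj_add complex_cnj_mult dot_cnj
    by (simp add: power2_eq_square algebra_simps)
  then have "(cmod (om (smap n a L t u z) + cnj (om (smap n a L t u w))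
      - 2 * dot n (ze (smap n a L t u z)) (ze (smap n a L t u w))))\<^sup>2
    = (a\<^sup>2)\<^sup>2 * (cmod (om z + cnj (om w) - 2 * dot n (ze z) (ze w)))\<^sup>2"
    by (simp only: norm_mult norm_of_real power_mult_distrib) simp
  then show ?thesis
    using a by (simp add: rho_def ht_smap assms field_simps power2_eq_square)
qed

lemma csmooth_on_siegel_om: "csmooth_on (2 * n) (ball_CH n) (siegel_om n a L t u)"
  unfolding siegel_om_def[abs_def]
  by (intro csmooth_on_mult csmooth_on_add csmooth_on_const csmooth_on_om csmooth_on_dot csmooth_on_ze openin_ball_CH n)

lemma csmooth_on_siegel_ze: "csmooth_on (2 * n) (ball_CH n) (\<lambda>z. siegel_ze a L t z j)"
  unfolding siegel_ze_def
  by (intro csmooth_on_mult csmooth_on_add csmooth_on_const csmooth_on_ze openin_ball_CH n)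

lemma smooth_coord_smap: "smooth_coord (2 * n) (ball_CH n) (2 * n) (smap n a L t u)"
  unfolding smap_def[abs_def]
  by (rule smooth_coord_of_siegel[OF openin_ball_CH csmooth_on_siegel_om csmooth_on_siegel_ze])
    (use siegel_nz[OF siegel_in] in auto)

lemma smap_in_Rn: "smap n a L t u z \<in> Rn (2 * n)"
  by (simp add: smap_def of_siegel_def vec_in_Rn)

lemma jacobian_smap:
  assumes z: "z \<in> ball_CH n" and v: "v \<in> Rn (2 * n)"
  defines "V \<equiv> jacobian (2 * n) (2 * n) (smap n a L t u) z v"
  shows "dom (smap n a L t u z) V = complex_of_real (a\<^sup>2) * (dom z v + 2 * dot n (\<lambda>j. L j * dze z v j) t)"
    and "1 \<le> j \<Longrightarrow> j < n \<Longrightarrow> dze (smap n a L t u z) V j = complex_of_real a * (L j * dze z v j)"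
proof -
  let ?c = "\<lambda>s i. z i + s * v i"
  have c0: "?c 0 = z" by simp
  have cv: "has_velocity ?c v 0" by (rule has_velocity_line)
  have cR: "eventually (\<lambda>s. ?c s \<in> Rn (2 * n)) (nhds 0)"
    using line_in_Rn v z ball_CH_subset by (intro always_eventually) blast
  have cz: "?c 0 \<in> ball_CH n" unfolding c0 by (rule z)
  have ev: "eventually (\<lambda>s. ?c s \<in> ball_CH n) (nhds 0)"
    by (rule eventually_in_open[OF openin_ball_CH cz has_velocity_tendsto[OF cv] cR])
  have V: "has_velocity (\<lambda>s. smap n a L t u (?c s)) V 0"
    using has_velocity_map[OF openin_ball_CH smooth_coord_smap smap_in_Rn cv cz cR] unfolding c0 V_def .
  have Sz: "smap n a L t u (?c 0) \<in> ball_CH n"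
    by (rule smap_in_ball[OF cz])
  have d1: "((\<lambda>s. om (smap n a L t u (?c s))) has_vector_derivative dom (smap n a L t u z) V) (at 0)"
    using om_velocity[OF V Sz n] unfolding c0 .
  have d2: "((\<lambda>s. ze (smap n a L t u (?c s)) j) has_vector_derivative dze (smap n a L t u z) V j) (at 0)" for j
    using ze_velocity[OF V Sz n] unfolding c0 .
  have o: "((\<lambda>s. om (?c s)) has_vector_derivative dom z v) (at 0)"
    using om_velocity[OF cv cz n] unfolding c0 .
  have zd: "((\<lambda>s. ze (?c s) j) has_vector_derivative dze z v j) (at 0)" for j
    using ze_velocity[OF cv cz n] unfolding c0 .
  have "((\<lambda>s. siegel_om n a L t u (?c s)) has_vector_derivative
      complex_of_real (a\<^sup>2) * (dom z v + 2 * dot n (\<lambda>j. L j * dze z v j) t)) (at 0)"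
    unfolding siegel_om_def dot_def
    by (auto intro!: derivative_eq_intros o zd simp: algebra_simps)
  then have "((\<lambda>s. om (smap n a L t u (?c s))) has_vector_derivative
      complex_of_real (a\<^sup>2) * (dom z v + 2 * dot n (\<lambda>j. L j * dze z v j) t)) (at 0)"
    by (rule has_vector_derivative_eventually_cong)
      (use ev om_smap in \<open>auto elim: eventually_mono\<close>)
  then show "dom (smap n a L t u z) V = complex_of_real (a\<^sup>2) * (dom z v + 2 * dot n (\<lambda>j. L j * dze z v j) t)"
    using vector_derivative_unique_at[OF d1] by blast
  assume j: "1 \<le> j" "j < n"
  have "((\<lambda>s. siegel_ze a L t (?c s) j) has_vector_derivative complex_of_real a * (L j * dze z v j)) (at 0)"
    unfolding siegel_ze_def by (auto intro!: derivative_eq_intros zd simp: algebra_simps)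
  then have "((\<lambda>s. ze (smap n a L t u (?c s)) j) has_vector_derivative complex_of_real a * (L j * dze z v j)) (at 0)"
    by (rule has_vector_derivative_eventually_cong)
      (use ev ze_smap j in \<open>auto elim: eventually_mono\<close>)
  then show "dze (smap n a L t u z) V j = complex_of_real a * (L j * dze z v j)"
    using vector_derivative_unique_at[OF d2] by blast
qed

text \<open>\<open>dze\<close> is rotated by \<open>L\<close> and scaled by \<open>a\<close>, while
  \<open>bet\<close> and the height are scaled by \<open>a\<^sup>2\<close>: the
  \<open>t\<close>-term in the differential of \<omega> is cancelled by the translation inside
  \<open>ze\<close>.\<close>

lemma rmetric_smap:
  assumes z: "z \<in> ball_CH n" and v: "v \<in> Rn (2 * n)" and w: "w \<in> Rn (2 * n)"
  shows "rmetric (CH n) (smap n a L t u z) (jacobian (2 * n) (2 * n) (smap n a L t u) z v)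
      (jacobian (2 * n) (2 * n) (smap n a L t u) z w) = rmetric (CH n) z v w"
proof -
  let ?S = "smap n a L t u z" and ?J = "jacobian (2 * n) (2 * n) (smap n a L t u) z"
  have A: "complex_of_real a \<noteq> 0" "complex_of_real (ht n z) \<noteq> 0" using a ht_pos[OF z n] by auto
  have b: "bet n ?S (?J v) = complex_of_real (a\<^sup>2) * bet n z v" if v: "v \<in> Rn (2 * n)" for v
  proof -
    have "dot n (dze ?S (?J v)) (ze ?S) = dot n (\<lambda>j. complex_of_real a * (L j * dze z v j)) (siegel_ze a L t z)"
      by (rule dot_cong) (simp_all add: jacobian_smap[OF z v] ze_smap[OF z])
    also have "\<dots> = complex_of_real (a\<^sup>2) * (dot n (dze z v) (ze z) + dot n (\<lambda>j. L j * dze z v j) t)"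
      unfolding siegel_ze_def dot_scale_left dot_scale_right dot_add_right dot_L
      by (simp add: power2_eq_square)
    finally have 1: "dot n (dze ?S (?J v)) (ze ?S) =
      complex_of_real (a\<^sup>2) * (dot n (dze z v) (ze z) + dot n (\<lambda>j. L j * dze z v j) t)" .
    show ?thesis
      unfolding bet_def jacobian_smap(1)[OF z v] 1 by (simp add: algebra_simps)
  qed
  have "dot n (dze ?S (?J v)) (dze ?S (?J w))
    = dot n (\<lambda>j. complex_of_real a * (L j * dze z v j)) (\<lambda>j. complex_of_real a * (L j * dze z w j))"
    by (rule dot_cong) (simp_all add: jacobian_smap z v w)
  then have d: "dot n (dze ?S (?J v)) (dze ?S (?J w)) = complex_of_real (a\<^sup>2) * dot n (dze z v) (dze z w)"
    unfolding dot_scale_left dot_scale_right dot_L by (simp add: power2_eq_square)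
  have h: "complex_of_real (ht n ?S) = complex_of_real (a\<^sup>2) * complex_of_real (ht n z)"
    by (simp add: ht_smap[OF z])
  show ?thesis
    unfolding rmetric_siegel[OF smap_in_ball[OF z] n] rmetric_siegel[OF z n] b[OF v] b[OF w] d of_real_power h
    using A by (simp add: power2_eq_square divide_simps)
qed

end

section \<open>Isometries preserve the distance function\<close>

text \<open>Translates the \<zeta>-part of \<open>p\<close> and the imaginary part of its \<omega>
  away, then rescales the height to 1, its value at the origin.\<close>

definition to_origin :: "nat \<Rightarrow> (nat \<Rightarrow> real) \<Rightarrow> (nat \<Rightarrow> real) \<Rightarrow> nat \<Rightarrow> real" where
  "to_origin n p = smap n (1 / sqrt (ht n p)) (\<lambda>_. 1) (\<lambda>j. - ze p j) (- Im (om p))"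

text \<open>The dilation acts after the translation, so the coordinates of \<open>p\<close> enter
  divided by the factors that the dilation restores.\<close>

definition from_origin :: "nat \<Rightarrow> (nat \<Rightarrow> real) \<Rightarrow> (nat \<Rightarrow> real) \<Rightarrow> nat \<Rightarrow> real" where
  "from_origin n p =
     smap n (sqrt (ht n p)) (\<lambda>_. 1) (\<lambda>j. ze p j / complex_of_real (sqrt (ht n p))) (Im (om p) / ht n p)"

lemma zero_in_ball: "(\<lambda>_. 0) \<in> ball_CH n"
  by (simp add: ball_CH_iff Rn_iff Re_herm)

lemma siegel_origin: "om (\<lambda>_. 0) = 1" "ze (\<lambda>_. 0) j = 0" "ht n (\<lambda>_. 0) = 1"
  by (simp_all add: om_def ze_def ht_def cplx_def dot_def zero_complex.code[symmetric])

context
  fixes n :: nat and p :: "nat \<Rightarrow> real"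
  assumes n: "0 < n" and p: "p \<in> ball_CH n"
begin

lemma to_origin_map: "siegel_map n (1 / sqrt (ht n p)) (\<lambda>_. 1)"
  using n ht_pos[OF p n] by unfold_locales auto

lemma from_origin_map: "siegel_map n (sqrt (ht n p)) (\<lambda>_. 1)"
  using n ht_pos[OF p n] by unfold_locales auto

lemma to_origin_self: "to_origin n p p = (\<lambda>_. 0)"
proof (rule siegel_eqI[OF _ zero_in_ball n])
  interpret siegel_map n "1 / sqrt (ht n p)" "\<lambda>_. 1" "\<lambda>j. - ze p j" "- Im (om p)"
    by (rule to_origin_map)
  have h: "ht n p > 0" by (rule ht_pos[OF p n])
  show "to_origin n p p \<in> ball_CH n" unfolding to_origin_def by (rule smap_in_ball[OF p])
  have "dot n (\<lambda>j. 1 * ze p j) (\<lambda>j. - ze p j) = - dot n (ze p) (ze p)"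
    "dot n (\<lambda>j. - ze p j) (\<lambda>j. - ze p j) = dot n (ze p) (ze p)"
    by (simp_all add: dot_def sum_negf)
  then have "siegel_om n (1 / sqrt (ht n p)) (\<lambda>_. 1) (\<lambda>j. - ze p j) (- Im (om p)) p =
     complex_of_real (1 / ht n p) * (om p - dot n (ze p) (ze p) - \<i> * complex_of_real (Im (om p)))"
    using h by (simp add: siegel_om_def power_divide)
  also have "om p - dot n (ze p) (ze p) - \<i> * complex_of_real (Im (om p)) = complex_of_real (ht n p)"
    by (simp add: ht_def complex_eq_iff)
  finally show "om (to_origin n p p) = om (\<lambda>_. 0)"
    using h unfolding to_origin_def by (simp add: om_smap[OF p] siegel_origin)
  show "ze (to_origin n p p) j = ze (\<lambda>_. 0) j" if "1 \<le> j" "j < n" for j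
    unfolding to_origin_def using that by (simp add: ze_smap[OF p] siegel_ze_def siegel_origin)
qed

lemma from_to_origin:
  assumes z: "z \<in> ball_CH n"
  shows "from_origin n p (to_origin n p z) = z"
proof (rule siegel_eqI[OF _ z n])
  define h where "h = sqrt (ht n p)"
  have h: "h > 0" "ht n p = h * h" using ht_pos[OF p n] by (simp_all add: h_def)
  interpret A: siegel_map n "1 / h" "\<lambda>_. 1" "\<lambda>j. - ze p j" "- Im (om p)"
    unfolding h_def by (rule to_origin_map)
  interpret B: siegel_map n h "\<lambda>_. 1" "\<lambda>j. ze p j / complex_of_real h" "Im (om p) / ht n p"
    unfolding h_def by (rule from_origin_map)
  note f = from_origin_def[of n p, folded h_def] and t = to_origin_def[of n p, folded h_def]
  have tz: "to_origin n p z \<in> ball_CH n" unfolding t by (rule A.smap_in_ball[OF z])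
  show "from_origin n p (to_origin n p z) \<in> ball_CH n" unfolding f by (rule B.smap_in_ball[OF tz])
  show "ze (from_origin n p (to_origin n p z)) j = ze z j" if "1 \<le> j" "j < n" for j
    using that tz h unfolding f B.ze_smap[OF tz that]
    by (simp add: siegel_ze_def t A.ze_smap[OF z that] field_simps)
  have "dot n (\<lambda>j. 1 * ze (to_origin n p z) j) (\<lambda>j. ze p j / complex_of_real h)
     = dot n (\<lambda>j. complex_of_real (1 / h) * (ze z j + - ze p j)) (\<lambda>j. complex_of_real (1 / h) * ze p j)"
    by (rule dot_cong) (simp_all add: t A.ze_smap[OF z] siegel_ze_def)
  also have "\<dots> = (dot n (ze z) (ze p) - dot n (ze p) (ze p)) / complex_of_real (h * h)"
    unfolding dot_scale_left dot_scale_right dot_add_left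
    by (simp add: dot_def sum_negf diff_divide_distrib)
  finally have 1: "dot n (\<lambda>j. 1 * ze (to_origin n p z) j) (\<lambda>j. ze p j / complex_of_real h)
     = (dot n (ze z) (ze p) - dot n (ze p) (ze p)) / complex_of_real (h * h)" .
  have 2: "dot n (\<lambda>j. ze p j / complex_of_real h) (\<lambda>j. ze p j / complex_of_real h) =
      dot n (ze p) (ze p) / complex_of_real (h * h)"
    by (simp add: dot_def sum_divide_distrib)
  have 3: "dot n (\<lambda>j. 1 * ze z j) (\<lambda>j. - ze p j) = - dot n (ze z) (ze p)"
    "dot n (\<lambda>j. - ze p j) (\<lambda>j. - ze p j) = dot n (ze p) (ze p)"
    by (simp_all add: dot_def sum_negf)
  show "om (from_origin n p (to_origin n p z)) = om z"
    unfolding f B.om_smap[OF tz] siegel_om_def 1 2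
    unfolding t A.om_smap[OF z] siegel_om_def 3 h(2)
    using h(1) by (simp add: field_simps power2_eq_square)
qed

lemma from_origin_zero: "from_origin n p (\<lambda>_. 0) = p"
  using from_to_origin[OF p] by (simp add: to_origin_self)

lemma to_origin_in_ball: "z \<in> ball_CH n \<Longrightarrow> to_origin n p z \<in> ball_CH n"
  unfolding to_origin_def by (rule siegel_map.smap_in_ball[OF to_origin_map])

lemma rho_to_origin:
  "z \<in> ball_CH n \<Longrightarrow> w \<in> ball_CH n \<Longrightarrow> rho n (to_origin n p z) (to_origin n p w) = rho n z w"
  unfolding to_origin_def by (rule siegel_map.rho_smap[OF to_origin_map])

end

text \<open>The right-hand side grows with the Euclidean norm of \<open>q\<close>; in this way
  comparisons of norms become comparisons of \<open>rho\<close>.\<close>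

lemma rho_origin:
  assumes q: "q \<in> ball_CH n" "0 < n"
  shows "rho n (\<lambda>_. 0) q = 1 / (1 - Re (herm n q q))"
proof -
  define D where "D = 1 - cplx q 0"
  have D: "D \<noteq> 0" using one_minus_cplx0[OF q] by (simp add: D_def)
  have "1 + cnj (om q) = cnj (1 + om q)" by simp
  also have "1 + om q = 2 / D" using D by (simp add: om_def D_def field_simps)
  finally have "(cmod (1 + cnj (om q)))\<^sup>2 = 4 / (cmod D)\<^sup>2"
    by (simp add: norm_divide power_divide)
  moreover have "dot n (ze (\<lambda>_. 0)) (ze q) = 0" by (simp add: dot_def siegel_origin)
  ultimately show ?thesis
    using D by (simp add: rho_def siegel_origin ht_eq[OF q] D_def[symmetric]) (simp add: divide_simps)
qed

section \<open>Comparison with radial curves\<close>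

lemma rmetric_self:
  assumes "z \<in> ball_CH n"
  shows "rmetric (CH n) z v v = 4 * (Re (herm n v v) / (1 - Re (herm n z z))
    + (cmod (herm n v z))\<^sup>2 / (1 - Re (herm n z z))\<^sup>2)"
proof -
  have r: "herm n v v = complex_of_real (Re (herm n v v))" for v
    by (simp add: complex_eq_iff herm_def)
  have "herm n z v = cnj (herm n v z)" by (simp add: herm_def mult.commute)
  then have "herm n v z * herm n z v = complex_of_real ((cmod (herm n v z))\<^sup>2)"
    using complex_norm_square by simp
  moreover have "1 - herm n z z = complex_of_real (1 - Re (herm n z z))"
    using r[of z] by simp
  ultimately have "herm n v v / (1 - herm n z z) + herm n v z * herm n z v / (1 - herm n z z)\<^sup>2
     = complex_of_real (Re (herm n v v) / (1 - Re (herm n z z))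
       + (cmod (herm n v z))\<^sup>2 / (1 - Re (herm n z z))\<^sup>2)"
    using r[of v] by (metis of_real_add of_real_divide of_real_power)
  then have "Re (herm n v v / (1 - herm n z z) + herm n v z * herm n z v / (1 - herm n z z)\<^sup>2)
    = Re (herm n v v) / (1 - Re (herm n z z)) + (cmod (herm n v z))\<^sup>2 / (1 - Re (herm n z z))\<^sup>2"
    by (simp only: Re_complex_of_real)
  then show ?thesis unfolding CH_def by simp
qed

text \<open>The radial part of the velocity is controlled by the metric, with equality for
  radial curves; \<open>artanh\<close> of the Euclidean norm is half the distance from the origin.\<close>

lemma radial_speed_bound:
  fixes N2 V R r S :: real
  assumes "0 < N2" "N2 < 1" "R\<^sup>2 \<le> H" "R\<^sup>2 \<le> V * N2" "0 \<le> K" "V / (1 - N2) + H / (1 - N2)\<^sup>2 = K\<^sup>2"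
  shows "R / (sqrt N2 * (1 - N2)) \<le> K"
proof -
  have 1: "R\<^sup>2 / N2 \<le> V" using assms by (simp add: divide_le_eq)
  have "(R / (sqrt N2 * (1 - N2)))\<^sup>2 = R\<^sup>2 / (N2 * (1 - N2)\<^sup>2)"
    using assms by (simp add: power_divide power_mult_distrib)
  also have "\<dots> = (R\<^sup>2 / N2) / (1 - N2) + R\<^sup>2 / (1 - N2)\<^sup>2"
  proof -
    have "1 - N2 \<noteq> 0" "N2 \<noteq> 0" using assms by auto
    then show ?thesis by (simp add: divide_simps) (simp add: power2_eq_square algebra_simps)
  qed
  also have "\<dots> \<le> V / (1 - N2) + H / (1 - N2)\<^sup>2"
    using 1 assms by (intro add_mono divide_right_mono) auto
  also have "\<dots> = K\<^sup>2" by (rule assms)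
  finally show ?thesis by (rule power2_le_imp_le[OF _ assms(5)])
qed

lemma artanh_le_imp_le:
  fixes x y :: real
  assumes "artanh x \<le> artanh y" "-1 < x" "x < 1" "-1 < y" "y < 1"
  shows "x \<le> y"
proof -
  have "(1 + x) / (1 - x) \<le> (1 + y) / (1 - y)"
    using assms by (simp add: artanh_def)
  then have "(1 + x) * (1 - y) \<le> (1 + y) * (1 - x)"
    using assms by (simp add: divide_simps)
  then show ?thesis by (simp add: algebra_simps)
qed

text \<open>\<open>met\<close> prescribes the speed of the radial curve \<open>s b\<close> with
  \<open>b\<close> of norm \<open>r\<close>. A curve of this speed that starts at the origin cannot
  end further out; \<open>E\<close> is its lead in radial distance, in the scale of
  \<open>artanh\<close>.\<close>

lemma radial_bound:
  fixes c v :: "real \<Rightarrow> nat \<Rightarrow> real" and r :: real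
  assumes r: "0 \<le> r" "r < 1"
    and vel: "\<And>s. 0 \<le> s \<Longrightarrow> s \<le> 1 \<Longrightarrow> has_velocity c (v s) s"
    and ball: "\<And>s. 0 \<le> s \<Longrightarrow> s \<le> 1 \<Longrightarrow> c s \<in> ball_CH n"
    and met: "\<And>s. 0 \<le> s \<Longrightarrow> s \<le> 1 \<Longrightarrow>
       rmetric (CH n) (c s) (v s) (v s) = 4 * (r / (1 - (s * r)\<^sup>2))\<^sup>2"
    and c0: "c 0 = (\<lambda>_. 0)"
  shows "Re (herm n (c 1) (c 1)) \<le> r\<^sup>2"
proof -
  define M where "M s = Re (herm n (c s) (c s))" for s
  define E where "E s = artanh (sqrt (M s)) - artanh (s * r)" for s
  have M: "0 \<le> M s" for s by (simp add: M_def Re_herm sum_nonneg)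
  have M1: "M s < 1" if "0 \<le> s" "s \<le> 1" for s using ball[OF that] by (simp add: M_def ball_CH_iff)
  have sr: "\<bar>s * r\<bar> < 1" if "0 \<le> s" "s \<le> 1" for s
  proof -
    have "s * r \<le> 1 * r" using that r by (intro mult_right_mono) auto
    then show ?thesis using that r by (simp add: abs_mult)
  qed
  have dM: "(M has_real_derivative 2 * Re (herm n (v s) (c s))) (at s)" if "0 \<le> s" "s \<le> 1" for s
    using vel[OF that] unfolding M_def Re_herm has_velocity_def
    by (auto intro!: derivative_eq_intros simp: sum_distrib_left algebra_simps)
  have cM: "continuous_on {0..1} M"
    by (rule continuous_at_imp_continuous_on) (auto intro: DERIV_isCont[OF dM])
  have contE: "continuous_on {0..1} E"
    unfolding E_def using M1 M sr
    by (intro continuous_intros continuous_on_real_sqrt cM)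
      (auto simp: abs_less_iff less_le_trans[OF _ real_sqrt_ge_zero])
  have E0: "E 0 \<le> 0" by (simp add: E_def M_def c0 Re_herm)
  have "E 1 \<le> 0"
  proof (rule ccontr)
    assume "\<not> E 1 \<le> 0"
    then have E1: "0 < E 1" by simp
    \<comment> \<open>\<open>sqrt\<close> is not differentiable at 0, so the derivative of
      \<open>E\<close> is studied only after the last time with \<open>E s \<le> 0\<close>: from
      then on \<open>0 < E s\<close> keeps the curve away from the origin.\<close>
    define Z where "Z = {s \<in> {0..1}. E s \<le> 0}"
    have "compact Z"
    proof -
      have "closed Z" unfolding Z_def
        using continuous_closed_preimage[OF contE closed_real_atLeastAtMost closed_atMost[of 0]]
        by (rule back_subst[of closed]) auto
      moreover have "bounded Z"
        by (rule bounded_subset[OF bounded_closed_interval[of 0 1]]) (auto simp: Z_def)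
      ultimately show ?thesis by (simp add: compact_eq_bounded_closed)
    qed
    moreover have "0 \<in> Z" using E0 by (simp add: Z_def)
    then have "Z \<noteq> {}" by (metis empty_iff)
    ultimately have "\<exists>s\<in>Z. \<forall>t\<in>Z. t \<le> s" by (rule compact_attains_sup)
    then obtain s1 where s1: "s1 \<in> Z" "\<And>s. s \<in> Z \<Longrightarrow> s \<le> s1"
      by auto
    have "0 \<le> s1" "s1 \<le> 1" "E s1 \<le> 0" using s1(1) by (simp_all add: Z_def)
    moreover have "s1 \<noteq> 1" using \<open>E s1 \<le> 0\<close> E1 by auto
    ultimately have s1': "0 \<le> s1" "s1 < 1" "E s1 \<le> 0" by simp_all
    have d: "\<exists>y. (E has_real_derivative y) (at s) \<and> y \<le> 0" if s: "s1 < s" "s < 1" for s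
    proof -
      have s': "0 \<le> s" "s \<le> 1" using s s1' by auto
      have Es: "0 < E s"
      proof (rule ccontr)
        assume "\<not> 0 < E s"
        then have "s \<in> Z" using s' by (simp add: Z_def)
        then show False using s1(2) s by fastforce
      qed
      have "0 \<le> artanh (s * r)"
        using sr[OF s'] s' r by (simp add: artanh_def ln_ge_zero_iff divide_simps abs_less_iff)
      then have Mp: "0 < M s" using Es M[of s] by (cases "M s = 0") (auto simp: E_def)
      have ds: "((\<lambda>s. sqrt (M s)) has_real_derivative
          inverse (sqrt (M s)) / 2 * (2 * Re (herm n (v s) (c s)))) (at s)"
        by (rule DERIV_chain2[OF DERIV_real_sqrt[OF Mp] dM[OF s']])
      have "((\<lambda>s. artanh (sqrt (M s))) has_real_derivative
          1 / (1 - (sqrt (M s))\<^sup>2) * (inverse (sqrt (M s)) / 2 * (2 * Re (herm n (v s) (c s))))) (at s)"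
        by (rule DERIV_chain2[OF artanh_real_has_field_derivative ds])
          (use Mp M1[OF s'] in simp)
      moreover have dl: "((\<lambda>s. s * r) has_real_derivative r) (at s)"
        by (auto intro!: derivative_eq_intros)
      have "((\<lambda>s. artanh (s * r)) has_real_derivative 1 / (1 - (s * r)\<^sup>2) * r) (at s)"
        by (rule DERIV_chain2[OF artanh_real_has_field_derivative dl]) (rule sr[OF s'])
      ultimately have dE: "(E has_real_derivative
          1 / (1 - (sqrt (M s))\<^sup>2) * (inverse (sqrt (M s)) / 2 * (2 * Re (herm n (v s) (c s))))
             - 1 / (1 - (s * r)\<^sup>2) * r) (at s)"
        unfolding E_def by (rule DERIV_diff)
      have k: "0 \<le> r / (1 - (s * r)\<^sup>2)"
        using sr[OF s'] r by (simp add: abs_square_less_1 less_imp_le)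
      have cs: "(Re (herm n (v s) (c s)))\<^sup>2 \<le> Re (herm n (v s) (v s)) * M s"
        using Cauchy_Schwarz_ineq_sum[of "v s" "c s" "{..<2 * n}"]
        by (simp add: M_def Re_herm power2_eq_square)
      have "Re (herm n (v s) (c s)) / (sqrt (M s) * (1 - M s)) \<le> r / (1 - (s * r)\<^sup>2)"
      proof (rule radial_speed_bound[OF Mp M1[OF s'] _ cs k])
        show "(Re (herm n (v s) (c s)))\<^sup>2 \<le> (cmod (herm n (v s) (c s)))\<^sup>2"
          by (simp add: cmod_power2)
        show "Re (herm n (v s) (v s)) / (1 - M s) + (cmod (herm n (v s) (c s)))\<^sup>2 / (1 - M s)\<^sup>2
            = (r / (1 - (s * r)\<^sup>2))\<^sup>2"
          unfolding M_def
          by (rule mult_left_cancel[THEN iffD1, OF _ met[OF s', unfolded rmetric_self[OF ball[OF s']]]]) simp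
      qed
      moreover have eq: "1 / (1 - (sqrt (M s))\<^sup>2) * (inverse (sqrt (M s)) / 2 * (2 * Re (herm n (v s) (c s))))
         = Re (herm n (v s) (c s)) / (sqrt (M s) * (1 - M s))"
        unfolding real_sqrt_pow2[OF M] using Mp M1[OF s'] by (simp add: divide_simps)
      ultimately have "1 / (1 - (sqrt (M s))\<^sup>2) * (inverse (sqrt (M s)) / 2 * (2 * Re (herm n (v s) (c s))))
             - 1 / (1 - (s * r)\<^sup>2) * r \<le> 0"
        by (metis diff_le_0_iff_le mult_1 times_divide_eq_left)
      then show ?thesis using dE by blast
    qed
    have "E 1 \<le> E s1"
      by (rule DERIV_nonpos_imp_decreasing_open[OF less_imp_le[OF s1'(2)] d])
        (use s1' in \<open>auto intro: continuous_on_subset[OF contE]\<close>)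
    then show False using E1 s1' by simp
  qed
  then have "artanh (sqrt (M 1)) \<le> artanh r" by (simp add: E_def)
  moreover have "sqrt (M 1) < 1" using M1[of 1] by simp
  moreover have "-1 < sqrt (M 1)" using real_sqrt_ge_zero[OF M[of 1]] by linarith
  moreover have "-1 < r" using r by linarith
  ultimately have "sqrt (M 1) \<le> r"
    using r(2) artanh_le_imp_le by blast
  then show ?thesis
    unfolding M_def[symmetric] by (rule sqrt_le_D)
qed

text \<open>Affine maps move \<open>p\<close> and \<open>f p\<close> to the origin. The segment from
  the origin to \<open>b\<close> then becomes a curve from the origin with unchanged metric speed,
  and \<open>radial_bound\<close> keeps its endpoint within the norm \<open>r\<close> of
  \<open>b\<close>.\<close>

lemma rho_le_of_metric_preserving:
  assumes n: "0 < n"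
    and f: "smooth_coord (2 * n) (ball_CH n) (2 * n) f" "\<And>z. z \<in> ball_CH n \<Longrightarrow> f z \<in> ball_CH n"
    and iso: "\<And>z v. z \<in> ball_CH n \<Longrightarrow> v \<in> Rn (2 * n) \<Longrightarrow>
      rmetric (CH n) (f z) (jacobian (2 * n) (2 * n) f z v) (jacobian (2 * n) (2 * n) f z v)
       = rmetric (CH n) z v v"
    and p: "p \<in> ball_CH n" and q: "q \<in> ball_CH n"
  shows "rho n (f p) (f q) \<le> rho n p q"
proof -
  define b where "b = to_origin n p q"
  define r where "r = sqrt (Re (herm n b b))"
  define k where "k = from_origin n p"
  define h where "h = to_origin n (f p)"
  interpret k: siegel_map n "sqrt (ht n p)" "\<lambda>_. 1" "\<lambda>j. ze p j / complex_of_real (sqrt (ht n p))" "Im (om p) / ht n p"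
    by (rule from_origin_map[OF n p])
  interpret h: siegel_map n "1 / sqrt (ht n (f p))" "\<lambda>_. 1" "\<lambda>j. - ze (f p) j" "- Im (om (f p))"
    by (rule to_origin_map[OF n f(2)[OF p]])
  note kdef = k_def[unfolded from_origin_def[abs_def]] and hdef = h_def[unfolded to_origin_def[abs_def]]
  have b: "b \<in> ball_CH n" unfolding b_def by (rule to_origin_in_ball[OF n p q])
  have bR: "b \<in> Rn (2 * n)" using b ball_CH_subset by auto
  have r2: "Re (herm n b b) = r\<^sup>2" by (simp add: r_def Re_herm sum_nonneg)
  have r: "0 \<le> r" "r < 1" using b by (simp_all add: r_def Re_herm sum_nonneg ball_CH_iff)
  define l where "l = (\<lambda>s i. s * b i)"
  have lR: "l s \<in> Rn (2 * n)" for s using bR by (simp add: l_def Rn_iff)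
  have lherm: "herm n (l s) (l s) = s\<^sup>2 * herm n b b" "herm n b (l s) = s * herm n b b" for s
    by (simp_all add: herm_def l_def cplx_def sum_distrib_left complex_eq_iff power2_eq_square algebra_simps)
  have lb: "l s \<in> ball_CH n" if "0 \<le> s" "s \<le> 1" for s
  proof -
    have "s\<^sup>2 * r\<^sup>2 \<le> 1 * r\<^sup>2" using that by (intro mult_right_mono) (auto simp: power_le_one)
    then have "Re (herm n (l s) (l s)) < 1"
      using b r2 unfolding lherm by (simp add: ball_CH_iff)
    then show ?thesis by (simp add: ball_CH_iff lR)
  qed
  let ?J = "jacobian (2 * n) (2 * n)"
  define v where "v s = ?J h (f (k (l s))) (?J f (k (l s)) (?J k (l s) b))" for s
  have kb: "k z \<in> ball_CH n" if "z \<in> ball_CH n" for z unfolding kdef by (rule k.smap_in_ball[OF that])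
  have hb: "h z \<in> ball_CH n" if "z \<in> ball_CH n" for z unfolding hdef by (rule h.smap_in_ball[OF that])
  have vel: "has_velocity (\<lambda>s. h (f (k (l s)))) (v s) s" if s: "0 \<le> s" "s \<le> 1" for s
  proof -
    have 0: "has_velocity l b s"
      unfolding l_def using has_velocity_line[of "\<lambda>_. 0" b s] by simp
    have ev: "eventually (\<lambda>t. l t \<in> ball_CH n) (nhds s)"
      by (rule eventually_in_open[OF openin_ball_CH lb[OF s] has_velocity_tendsto[OF 0]])
        (simp add: lR)
    have 1: "has_velocity (\<lambda>t. k (l t)) (?J k (l s) b) s"
      unfolding kdef
      by (rule has_velocity_map[OF openin_ball_CH k.smooth_coord_smap k.smap_in_Rn 0 lb[OF s]]) (simp add: lR)
    have 2: "has_velocity (\<lambda>t. f (k (l t))) (?J f (k (l s)) (?J k (l s) b)) s"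
          proof (rule has_velocity_map[OF openin_ball_CH f(1) _ 1 kb[OF lb[OF s]]])
      show "eventually (\<lambda>t. k (l t) \<in> Rn (2 * n)) (nhds s)"
        using ev by eventually_elim (use kb ball_CH_subset in blast)
    qed (use f(2) ball_CH_subset in blast)
    show ?thesis
      unfolding v_def hdef
    proof (rule has_velocity_map[OF openin_ball_CH h.smooth_coord_smap h.smap_in_Rn 2 f(2)[OF kb[OF lb[OF s]]]])
      show "eventually (\<lambda>t. f (k (l t)) \<in> Rn (2 * n)) (nhds s)"
        using ev by eventually_elim (use kb f(2) ball_CH_subset in blast)
    qed
  qed
  have met: "rmetric (CH n) (h (f (k (l s)))) (v s) (v s) = 4 * (r / (1 - (s * r)\<^sup>2))\<^sup>2"
    if s: "0 \<le> s" "s \<le> 1" for s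
  proof -
    have JR: "?J g x w \<in> Rn (2 * n)" for g x w by (rule jacobian_in_Rn)
    have "rmetric (CH n) (h (f (k (l s)))) (v s) (v s)
        = rmetric (CH n) (f (k (l s))) (?J f (k (l s)) (?J k (l s) b)) (?J f (k (l s)) (?J k (l s) b))"
      unfolding v_def hdef by (rule h.rmetric_smap[OF f(2)[OF kb[OF lb[OF s]]] JR JR])
    also have "\<dots> = rmetric (CH n) (k (l s)) (?J k (l s) b) (?J k (l s) b)"
      by (rule iso[OF kb[OF lb[OF s]] JR])
    also have "\<dots> = rmetric (CH n) (l s) b b"
      unfolding kdef by (rule k.rmetric_smap[OF lb[OF s] bR bR])
    also have "\<dots> = 4 * (r\<^sup>2 / (1 - s\<^sup>2 * r\<^sup>2) + (cmod (s * herm n b b))\<^sup>2 / (1 - s\<^sup>2 * r\<^sup>2)\<^sup>2)"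
      unfolding rmetric_self[OF lb[OF s]] lherm by (simp add: r2)
    also have "cmod (s * herm n b b) = s * r\<^sup>2"
    proof -
      have "herm n b b = complex_of_real (r\<^sup>2)" unfolding r2[symmetric] by (simp add: complex_eq_iff herm_def)
      then show ?thesis using s by (simp add: norm_mult norm_power)
    qed
    also have "4 * (r\<^sup>2 / (1 - s\<^sup>2 * r\<^sup>2) + (s * r\<^sup>2)\<^sup>2 / (1 - s\<^sup>2 * r\<^sup>2)\<^sup>2) = 4 * (r / (1 - (s * r)\<^sup>2))\<^sup>2"
    proof -
      have "Re (herm n (l s) (l s)) < 1" using lb[OF s] by (simp add: ball_CH_iff)
      then have "1 - s\<^sup>2 * r\<^sup>2 \<noteq> 0" unfolding lherm by (simp add: r2)
      then show ?thesis
        by (simp add: power_mult_distrib divide_simps) (simp add: power2_eq_square power4_eq_xxxx algebra_simps)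
    qed
    finally show ?thesis .
  qed
  have l0: "l 0 = (\<lambda>_. 0)" and l1: "l 1 = b" by (simp_all add: l_def)
  have c0: "h (f (k (l 0))) = (\<lambda>_. 0)"
    unfolding l0 k_def from_origin_zero[OF n p] h_def by (rule to_origin_self[OF n f(2)[OF p]])
  have c1: "h (f (k (l 1))) = h (f q)"
    unfolding l1 k_def b_def from_to_origin[OF n p q] ..
  have "Re (herm n (h (f (k (l 1)))) (h (f (k (l 1))))) \<le> r\<^sup>2"
  proof (rule radial_bound[where c = "\<lambda>s. h (f (k (l s)))" and v = v])
    show "h (f (k (l s))) \<in> ball_CH n" if "0 \<le> s" "s \<le> 1" for s
      by (rule hb[OF f(2)[OF kb[OF lb[OF that]]]])
  qed (rule r vel met c0; assumption?)+
  then have le: "Re (herm n (h (f q)) (h (f q))) \<le> Re (herm n b b)" unfolding c1 r2 .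
  have fq: "f q \<in> ball_CH n" "f p \<in> ball_CH n" using f(2) p q by auto
  have "rho n (f p) (f q) = rho n (h (f p)) (h (f q))"
    unfolding h_def using rho_to_origin[OF n fq(2) fq(2) fq(1)] by simp
  also have "h (f p) = (\<lambda>_. 0)" unfolding h_def by (rule to_origin_self[OF n fq(2)])
  also have "rho n (\<lambda>_. 0) (h (f q)) = 1 / (1 - Re (herm n (h (f q)) (h (f q))))"
    by (rule rho_origin[OF hb[OF fq(1)] n])
  also have "\<dots> \<le> 1 / (1 - Re (herm n b b))"
    using le b by (intro divide_left_mono) (auto simp: ball_CH_iff)
  also have "\<dots> = rho n (\<lambda>_. 0) b" by (rule rho_origin[OF b n, symmetric])
  also have "\<dots> = rho n (to_origin n p p) (to_origin n p q)"
    by (simp add: to_origin_self[OF n p] b_def)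
  also have "\<dots> = rho n p q" by (rule rho_to_origin[OF n p p q])
  finally show ?thesis .
qed

lemma isometry_CH_iff:
  "isometry (CH n) (CH n) f \<longleftrightarrow> bij_betw f (ball_CH n) (ball_CH n) \<and>
     smooth_coord (2 * n) (ball_CH n) (2 * n) f \<and>
     smooth_coord (2 * n) (ball_CH n) (2 * n) (inv_into (ball_CH n) f) \<and>
     (\<forall>p\<in>ball_CH n. \<forall>v\<in>Rn (2 * n). \<forall>w\<in>Rn (2 * n).
        rmetric (CH n) (f p) (jacobian (2 * n) (2 * n) f p v) (jacobian (2 * n) (2 * n) f p w)
          = rmetric (CH n) p v w)"
proof -
  have "smooth_map (riem_manifold (CH n)) (riem_manifold (CH n)) f \<longleftrightarrow> smooth_coord (2 * n) (ball_CH n) (2 * n) f"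
    "smooth_map (riem_manifold (CH n)) (riem_manifold (CH n)) (inv_into (ball_CH n) f) \<longleftrightarrow>
      smooth_coord (2 * n) (ball_CH n) (2 * n) (inv_into (ball_CH n) f)"
    if "bij_betw f (ball_CH n) (ball_CH n)"
    unfolding riem_manifold_dom rdim_CH
    using bij_betwE[OF that] bij_betwE[OF bij_betw_inv_into[OF that]]
    by (intro smooth_map_dom_iff[OF openin_ball_CH openin_ball_CH]; blast)+
  note * = this
  show ?thesis
  proof (cases "bij_betw f (ball_CH n) (ball_CH n)")
    case True
    then show ?thesis by (simp only: isometry_def rdim_CH *[OF True])
  qed (simp add: isometry_def)
qed

text \<open>The inequality is applied to \<open>f\<close> and to its inverse. The inverse preserves
  the metric because, by the chain rule, its Jacobian is a right inverse of that of
  \<open>f\<close>.\<close>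

lemma isometry_rho:
  assumes n: "0 < n" and f: "isometry (CH n) (CH n) f" and p: "p \<in> ball_CH n" and q: "q \<in> ball_CH n"
  shows "rho n (f p) (f q) = rho n p q"
proof -
  define g where "g = inv_into (ball_CH n) f"
  note F = f[unfolded isometry_CH_iff, folded g_def]
  have bij: "bij_betw f (ball_CH n) (ball_CH n)" using F by blast
  have sf: "smooth_coord (2 * n) (ball_CH n) (2 * n) f" using F by blast
  have met: "rmetric (CH n) (f z) (jacobian (2 * n) (2 * n) f z v) (jacobian (2 * n) (2 * n) f z v)
       = rmetric (CH n) z v v" if "z \<in> ball_CH n" "v \<in> Rn (2 * n)" for z v
    using F that by blast
  have fb: "f z \<in> ball_CH n" if "z \<in> ball_CH n" for z using bij that bij_betwE by blast
  have gb: "g z \<in> ball_CH n" if "z \<in> ball_CH n" for z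
    using bij_betw_inv_into[OF bij] that bij_betwE unfolding g_def by blast
  have fg: "f (g z) = z" if "z \<in> ball_CH n" for z
    unfolding g_def using bij_betw_inv_into_right[OF bij that] .
  have gf: "g (f z) = z" if "z \<in> ball_CH n" for z
    unfolding g_def using bij_betw_inv_into_left[OF bij that] .
  have "rho n (f p) (f q) \<le> rho n p q"
    by (rule rho_le_of_metric_preserving[OF n sf fb met p q])
  moreover have "rho n (g (f p)) (g (f q)) \<le> rho n (f p) (f q)"
  proof (rule rho_le_of_metric_preserving[OF n _ gb _ fb[OF p] fb[OF q]])
    show sg: "smooth_coord (2 * n) (ball_CH n) (2 * n) g" using F by blast

    fix z v assume z: "z \<in> ball_CH n" and v: "v \<in> Rn (2 * n)"
    let ?J = "jacobian (2 * n) (2 * n)"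
    have "?J f (g z) (?J g z v) = ?J (\<lambda>x. f (g x)) z v"
      by (rule jacobian_compose[symmetric, OF openin_ball_CH openin_ball_CH sg gb sf _ z v])
        (use fb ball_CH_subset in auto)
    also have "\<dots> = ?J (\<lambda>x. x) z v"
      by (rule jacobian_cong[OF openin_ball_CH z]) (rule fg)
    also have "\<dots> = v"
      by (rule jacobian_eqI[OF openin_ball_CH _ _ z v has_velocity_line])
        (use ball_CH_subset openin_ball_CH in \<open>auto simp: smooth_coord_iff smooth_on_coord\<close>)
    finally have "?J f (g z) (?J g z v) = v" .
    moreover have "rmetric (CH n) (f (g z)) (?J f (g z) (?J g z v)) (?J f (g z) (?J g z v))
        = rmetric (CH n) (g z) (?J g z v) (?J g z v)"
      by (rule met[OF gb[OF z] jacobian_in_Rn])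
    ultimately show "rmetric (CH n) (g z) (?J g z v) (?J g z v) = rmetric (CH n) z v v"
      by (simp add: fg[OF z])
  qed
  ultimately show ?thesis by (simp add: gf p q)
qed

section \<open>The groups\<close>

text \<open>
  The group is the product of a circle acting on the first two \<open>\<zeta>\<close>-coordinates by
  \<open>diag(\<lambda>, cnj \<lambda>)\<close>, and of horospherical translations \<open>\<tau>\<close> in the orthogonal complement of the
  real plane of all \<open>(al z, be cnj z, 0, \<dots>, 0)\<close>, together with the centre \<open>u\<close> of the Heisenberg group.
  Circle and centre are packed into one nonzero complex number \<open>\<lambda> exp u\<close>, so that a single chart suffices.
\<close>

definition Gset :: "nat \<Rightarrow> (nat \<Rightarrow> real) set" where
  "Gset n = {g \<in> Rn (2 * (n - 1)). cplx g 0 \<noteq> 0}"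

definition glam :: "(nat \<Rightarrow> real) \<Rightarrow> complex" where
  "glam g = cplx g 0 / complex_of_real (cmod (cplx g 0))"

definition gu :: "(nat \<Rightarrow> real) \<Rightarrow> real" where
  "gu g = ln (cmod (cplx g 0))"

definition grot :: "(nat \<Rightarrow> real) \<Rightarrow> nat \<Rightarrow> complex" where
  "grot g j = (if j = 1 then glam g else if j = 2 then cnj (glam g) else 1)"

text \<open>The pairs \<open>(be c, - al cnj c)\<close> form the orthogonal complement of the plane
  inside the first two coordinates, so the single number \<open>cplx g 1\<close> describes them. The
  other entries are shifted by one, as entry 0 of a group element holds circle and centre.\<close>

definition gtau :: "real \<Rightarrow> real \<Rightarrow> (nat \<Rightarrow> real) \<Rightarrow> nat \<Rightarrow> complex" where
  "gtau al be g j = (if j = 1 then complex_of_real be * cplx g 1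
     else if j = 2 then - complex_of_real al * cnj (cplx g 1) else cplx g (j - 1))"

text \<open>The exponential is the cocycle of the Heisenberg group: composing two translations adds
  twice the imaginary part of a Hermitian product to the centre, that is, it multiplies the modulus
  of entry 0.\<close>

definition gmul :: "nat \<Rightarrow> real \<Rightarrow> real \<Rightarrow> (nat \<Rightarrow> real) \<Rightarrow> (nat \<Rightarrow> real) \<Rightarrow> nat \<Rightarrow> real" where
  "gmul n al be g h = cvec (n - 1) (\<lambda>k.
     if k = 0 then cplx g 0 * cplx h 0 *
       complex_of_real (exp (2 * Im (dot n (\<lambda>j. grot g j * gtau al be h j) (gtau al be g))))
     else if k = 1 then glam g * cplx h 1 + cplx g 1 else cplx h k + cplx g k)"

definition gone :: "nat \<Rightarrow> nat \<Rightarrow> real" where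
  "gone n = cvec (n - 1) (\<lambda>k. if k = 0 then 1 else 0)"

definition ginv :: "nat \<Rightarrow> (nat \<Rightarrow> real) \<Rightarrow> nat \<Rightarrow> real" where
  "ginv n g = cvec (n - 1) (\<lambda>k. if k = 0 then inverse (cplx g 0)
     else if k = 1 then - cnj (glam g) * cplx g 1 else - cplx g k)"

definition gact :: "nat \<Rightarrow> real \<Rightarrow> real \<Rightarrow> (nat \<Rightarrow> real) \<Rightarrow> (nat \<Rightarrow> real) \<Rightarrow> nat \<Rightarrow> real" where
  "gact n al be g = smap n 1 (grot g) (gtau al be g) (gu g)"

definition Ggrp :: "nat \<Rightarrow> real \<Rightarrow> real \<Rightarrow> (nat \<Rightarrow> real) monoid" where
  "Ggrp n al be = \<lparr> carrier = Gset n, monoid.mult = gmul n al be, one = gone n \<rparr>"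

text \<open>The maps are restricted to the ball because the bijections behind
  \<open>group_action\<close> have to be extensional.\<close>

definition Gact :: "nat \<Rightarrow> real \<Rightarrow> real \<Rightarrow> (nat \<Rightarrow> real) lie_action" where
  "Gact n al be = \<lparr> grp = Ggrp n al be, lie = dom_manifold (2 * (n - 1)) (Gset n),
     act = (\<lambda>g. restrict (gact n al be g) (ball_CH n)) \<rparr>"

text \<open>The components of \<open>\<zeta>\<close> in the distinguished real plane and in its orthogonal complement
  inside the first two coordinates.\<close>

definition zp :: "real \<Rightarrow> real \<Rightarrow> (nat \<Rightarrow> complex) \<Rightarrow> complex" where
  "zp al be \<zeta> = complex_of_real al * \<zeta> 1 + complex_of_real be * cnj (\<zeta> 2)"

definition wp :: "real \<Rightarrow> real \<Rightarrow> (nat \<Rightarrow> complex) \<Rightarrow> complex" where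
  "wp al be \<zeta> = complex_of_real be * \<zeta> 1 - complex_of_real al * cnj (\<zeta> 2)"

lemma glam_norm: "cplx g 0 \<noteq> 0 \<Longrightarrow> cmod (glam g) = 1"
  by (simp add: glam_def norm_divide)

lemma grot_norm: "cplx g 0 \<noteq> 0 \<Longrightarrow> cmod (grot g j) = 1"
  by (simp add: grot_def glam_norm)

lemma glam_cnj: "cplx g 0 \<noteq> 0 \<Longrightarrow> glam g * cnj (glam g) = 1"
  using complex_norm_square[of "glam g"] by (simp add: glam_norm)

locale polar_family =
  fixes n :: nat and al be :: real
  assumes n3: "3 \<le> n" and albe: "al\<^sup>2 + be\<^sup>2 = 1"
begin

abbreviation "G \<equiv> Gset n"
abbreviation "tau \<equiv> gtau al be"
abbreviation "mul \<equiv> gmul n al be"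
abbreviation "Act \<equiv> Gact n al be"
abbreviation "D \<equiv> 2 * (n - 1)"
abbreviation "calbe \<equiv> complex_of_real"

lemma n0: "0 < n" and n1: "0 < n - 1" "1 < n - 1" using n3 by auto

lemma albe_c: "calbe al * calbe al + calbe be * calbe be = 1"
  by (metis albe of_real_1 of_real_add of_real_mult power2_eq_square)

lemma G_nz: "g \<in> G \<Longrightarrow> cplx g 0 \<noteq> 0" and G_Rn: "g \<in> G \<Longrightarrow> g \<in> Rn D"
  by (auto simp: Gset_def)

lemma vec_in_G: "c 0 \<noteq> 0 \<Longrightarrow> cvec (n - 1) c \<in> G"
  using n1 by (simp add: Gset_def vec_in_Rn cplx_vec)

lemma zp_wp: "\<zeta> 1 = calbe al * zp al be \<zeta> + calbe be * wp al be \<zeta>"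
    "\<zeta> 2 = calbe be * cnj (zp al be \<zeta>) - calbe al * cnj (wp al be \<zeta>)"
proof -
  have "calbe al * zp al be \<zeta> + calbe be * wp al be \<zeta> = (calbe al * calbe al + calbe be * calbe be) * \<zeta> 1"
    by (simp add: zp_def wp_def algebra_simps)
  then show "\<zeta> 1 = calbe al * zp al be \<zeta> + calbe be * wp al be \<zeta>" by (simp add: albe_c)
  have "calbe be * cnj (zp al be \<zeta>) - calbe al * cnj (wp al be \<zeta>) = (calbe al * calbe al + calbe be * calbe be) * \<zeta> 2"
    by (simp add: zp_def wp_def algebra_simps)
  then show "\<zeta> 2 = calbe be * cnj (zp al be \<zeta>) - calbe al * cnj (wp al be \<zeta>)" by (simp add: albe_c)
qed

lemma mul_in_G: "g \<in> G \<Longrightarrow> h \<in> G \<Longrightarrow> mul g h \<in> G"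
  unfolding gmul_def by (rule vec_in_G) (simp add: G_nz)

lemma one_in_G: "gone n \<in> G"
  unfolding gone_def by (rule vec_in_G) simp

lemma inv_in_G: "g \<in> G \<Longrightarrow> ginv n g \<in> G"
  unfolding ginv_def by (rule vec_in_G) (simp add: G_nz)

lemma cplx_mul:
  "cplx (mul g h) 0 = cplx g 0 * cplx h 0 *
       complex_of_real (exp (2 * Im (dot n (\<lambda>j. grot g j * tau h j) (tau g))))"
  "cplx (mul g h) 1 = glam g * cplx h 1 + cplx g 1"
  "2 \<le> k \<Longrightarrow> k < n - 1 \<Longrightarrow> cplx (mul g h) k = cplx h k + cplx g k"
  using n1 by (simp_all add: gmul_def cplx_vec)

lemma glam_mul: "g \<in> G \<Longrightarrow> h \<in> G \<Longrightarrow> glam (mul g h) = glam g * glam h"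
  by (simp add: glam_def cplx_mul norm_mult)

lemma gu_mul: "g \<in> G \<Longrightarrow> h \<in> G \<Longrightarrow>
   gu (mul g h) = gu g + gu h + 2 * Im (dot n (\<lambda>j. grot g j * tau h j) (tau g))"
  using G_nz[of g] G_nz[of h] by (simp add: gu_def cplx_mul norm_mult ln_mult)

lemma grot_mul: "g \<in> G \<Longrightarrow> h \<in> G \<Longrightarrow> grot (mul g h) j = grot g j * grot h j"
  by (simp add: grot_def glam_mul)

lemma tau_mul:
  assumes "1 \<le> j" "j < n"
  shows "tau (mul g h) j = grot g j * tau h j + tau g j"
proof -
  consider "j = 1" | "j = 2" | "3 \<le> j" using assms by linarith
  then show ?thesis
  proof cases
    case 3
    then have "2 \<le> j - 1" "j - 1 < n - 1" using assms by auto
    then show ?thesis using 3 by (simp add: gtau_def grot_def cplx_mul(3))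
  qed (simp_all add: gtau_def grot_def cplx_mul(2)[unfolded One_nat_def] algebra_simps)
qed

lemma dot_rot:
  "g \<in> G \<Longrightarrow> dot n (\<lambda>j. grot g j * v j) (\<lambda>j. grot g j * w j) = dot n v w"
  by (rule dot_unimodular) (simp add: grot_norm G_nz)

lemma G_eqI:
  assumes "g \<in> G" "h \<in> G" "cplx g 0 = cplx h 0" "cplx g 1 = cplx h 1"
    "\<And>k. 2 \<le> k \<Longrightarrow> k < n - 1 \<Longrightarrow> cplx g k = cplx h k"
  shows "g = h"
proof (rule cplx_eqI[OF G_Rn[OF assms(1)] G_Rn[OF assms(2)]])
  fix j assume "j < n - 1"
  then consider "j = 0" | "j = 1" | "2 \<le> j" "j < n - 1" by linarith
  then show "cplx g j = cplx h j" using assms by cases auto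
qed

text \<open>Entry 0 needs the cocycle identity, which holds because \<open>grot g\<close> preserves
  the Hermitian product.\<close>

lemma mul_assoc:
  assumes "g \<in> G" "h \<in> G" "k \<in> G"
  shows "mul (mul g h) k = mul g (mul h k)"
proof (rule G_eqI)
  have a: "dot n (\<lambda>j. grot (mul g h) j * tau k j) (tau (mul g h))
     = dot n (\<lambda>j. grot g j * (grot h j * tau k j)) (\<lambda>j. grot g j * tau h j + tau g j)"
    by (rule dot_cong) (simp_all add: tau_mul grot_mul assms)
  have b: "dot n (\<lambda>j. grot g j * tau (mul h k) j) (tau g)
     = dot n (\<lambda>j. grot g j * (grot h j * tau k j) + grot g j * tau h j) (tau g)"
    by (rule dot_cong) (simp_all add: tau_mul algebra_simps)
  show "cplx (mul (mul g h) k) 0 = cplx (mul g (mul h k)) 0"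
    unfolding cplx_mul(1)[of "mul g h" k] cplx_mul(1)[of g "mul h k"] a b
    unfolding cplx_mul dot_add_left dot_add_right dot_rot[OF assms(1)]
    by (simp add: exp_add algebra_simps)
  show "cplx (mul (mul g h) k) 1 = cplx (mul g (mul h k)) 1"
    using assms unfolding cplx_mul glam_mul[OF assms(1,2)] by (simp add: algebra_simps)
qed (use assms in \<open>simp_all add: mul_in_G cplx_mul\<close>)

lemma cplx_one: "cplx (gone n) 0 = 1" "1 \<le> k \<Longrightarrow> k < n - 1 \<Longrightarrow> cplx (gone n) k = 0"
  using n1 by (simp_all add: gone_def cplx_vec)

lemma one_params: "glam (gone n) = 1" "gu (gone n) = 0" "grot (gone n) j = 1"
  "1 \<le> j \<Longrightarrow> j < n \<Longrightarrow> tau (gone n) j = 0"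
  using n1 by (auto simp: glam_def gu_def grot_def gtau_def cplx_one cplx_one(2)[of 1, unfolded One_nat_def])

lemma one_mul: assumes "g \<in> G" shows "mul (gone n) g = g"
proof (rule G_eqI)
  have "dot n (\<lambda>j. grot (gone n) j * tau g j) (tau (gone n)) = dot n (tau g) (\<lambda>j. 0)"
    by (rule dot_cong) (simp_all add: one_params)
  then show "cplx (mul (gone n) g) 0 = cplx g 0"
    unfolding cplx_mul by (simp add: dot_def cplx_one)
  show "cplx (mul (gone n) g) 1 = cplx g 1"
    unfolding cplx_mul using n1 by (simp add: one_params cplx_one(2)[of 1, unfolded One_nat_def])
qed (use assms in \<open>simp_all add: mul_in_G one_in_G cplx_mul cplx_one\<close>)

lemma cplx_inv: "cplx (ginv n g) 0 = inverse (cplx g 0)" "cplx (ginv n g) 1 = - cnj (glam g) * cplx g 1"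
  "2 \<le> k \<Longrightarrow> k < n - 1 \<Longrightarrow> cplx (ginv n g) k = - cplx g k"
  using n1 by (simp_all add: ginv_def cplx_vec)

lemma inv_mul: assumes g: "g \<in> G" shows "mul (ginv n g) g = gone n"
proof (rule G_eqI)
  have nz: "cplx g 0 \<noteq> 0" by (rule G_nz[OF g])
  have lam: "glam (ginv n g) = cnj (glam g)"
  proof -
    have "glam (ginv n g) = inverse (glam g)"
      by (simp add: glam_def cplx_inv norm_inverse divide_inverse)
    also have "\<dots> = cnj (glam g)"
      using glam_cnj[OF nz] by (metis inverse_unique)
    finally show ?thesis .
  qed
  have "tau (ginv n g) j = - (grot (ginv n g) j * tau g j)" if j: "1 \<le> j" "j < n" for j
  proof -
    consider "j = 1" | "j = 2" | "3 \<le> j" using j by linarith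
    then show ?thesis
    proof cases
      case 3
      then have "2 \<le> j - 1" "j - 1 < n - 1" using j by auto
      then show ?thesis using 3 by (simp add: gtau_def grot_def cplx_inv(3))
    qed (simp_all add: gtau_def grot_def lam cplx_inv(2)[unfolded One_nat_def])
  qed
  then have "dot n (\<lambda>j. grot (ginv n g) j * tau g j) (tau (ginv n g))
    = dot n (\<lambda>j. grot (ginv n g) j * tau g j) (\<lambda>j. - (grot (ginv n g) j * tau g j))"
    by (intro dot_cong) simp_all
  \<comment> \<open>The product of a vector with its negative is real, so the cocycle
    vanishes.\<close>
  also have "\<dots> = - dot n (\<lambda>j. grot (ginv n g) j * tau g j) (\<lambda>j. grot (ginv n g) j * tau g j)"
    by (simp add: dot_def sum_negf)
  finally show "cplx (mul (ginv n g) g) 0 = cplx (gone n) 0"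
    unfolding cplx_mul using nz by (simp add: cplx_inv cplx_one)
  show "cplx (mul (ginv n g) g) 1 = cplx (gone n) 1"
    unfolding cplx_mul using n1 by (simp add: lam cplx_inv(2)[unfolded One_nat_def] cplx_one(2)[of 1, unfolded One_nat_def])
qed (use assms in \<open>simp_all add: mul_in_G one_in_G inv_in_G cplx_mul cplx_one cplx_inv\<close>)

lemma group_G: "group (Ggrp n al be)"
proof (rule groupI)
  fix g assume "g \<in> carrier (Ggrp n al be)"
  then show "\<exists>h\<in>carrier (Ggrp n al be). h \<otimes>\<^bsub>Ggrp n al be\<^esub> g = \<one>\<^bsub>Ggrp n al be\<^esub>"
    using inv_mul inv_in_G by (auto simp: Ggrp_def)
qed (simp_all add: Ggrp_def mul_in_G one_in_G mul_assoc one_mul)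

lemma inv_G: "g \<in> G \<Longrightarrow> inv\<^bsub>Ggrp n al be\<^esub> g = ginv n g"
  using group.inv_equality[OF group_G, of "ginv n g" g] by (simp add: Ggrp_def inv_mul inv_in_G)

lemma openin_G: "openin (Euclidean_space D) G"
proof -
  have "open {g :: nat \<Rightarrow> real. g 0 \<noteq> 0}" "open {g :: nat \<Rightarrow> real. g 1 \<noteq> 0}"
    by (intro open_Collect_neq continuous_on_product_coordinates continuous_on_const)+
  then have "open ({g :: nat \<Rightarrow> real. g 0 \<noteq> 0} \<union> {g. g 1 \<noteq> 0})" by (rule open_Un)
  moreover have "G = Rn D \<inter> ({g. g 0 \<noteq> 0} \<union> {g. g 1 \<noteq> 0})"
    by (auto simp: Gset_def cplx_def complex_eq_iff)
  ultimately show ?thesis unfolding openin_Rn by blast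
qed

subsection \<open>Smoothness\<close>

context
  fixes d U and F :: "(nat \<Rightarrow> real) \<Rightarrow> nat \<Rightarrow> real"
  assumes F: "\<And>k. csmooth_on d U (\<lambda>x. cplx (F x) k)"
begin

lemma U_open: "openin (Euclidean_space d) U"
  using F[of 0] by (simp add: csmooth_on_def smooth_on_def)

lemma csmooth_tau: "csmooth_on d U (\<lambda>x. tau (F x) j)"
  unfolding gtau_def
  by (cases "j = 1"; cases "j = 2")
    (auto intro!: csmooth_on_mult csmooth_on_const csmooth_on_cnj csmooth_on_uminus F U_open)

lemma smooth_cmod: assumes "\<And>x. x \<in> U \<Longrightarrow> cplx (F x) 0 \<noteq> 0" shows "smooth_on d U (\<lambda>x. cmod (cplx (F x) 0))"
proof -
  have "smooth_on d U (\<lambda>x. sqrt ((cmod (cplx (F x) 0))\<^sup>2))"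
    by (rule smooth_on_sqrt[OF smooth_on_norm_sq[OF F]]) (simp add: assms)
  then show ?thesis by simp
qed

lemma csmooth_glam: assumes "\<And>x. x \<in> U \<Longrightarrow> cplx (F x) 0 \<noteq> 0" shows "csmooth_on d U (\<lambda>x. glam (F x))"
  unfolding glam_def
  by (rule csmooth_on_divide[OF F csmooth_on_of_real[OF smooth_cmod]]) (simp_all add: assms)

lemma smooth_gu: assumes "\<And>x. x \<in> U \<Longrightarrow> cplx (F x) 0 \<noteq> 0" shows "smooth_on d U (\<lambda>x. gu (F x))"
  unfolding gu_def by (rule smooth_on_ln[OF smooth_cmod]) (simp_all add: assms)

lemma csmooth_grot: assumes "\<And>x. x \<in> U \<Longrightarrow> cplx (F x) 0 \<noteq> 0" shows "csmooth_on d U (\<lambda>x. grot (F x) j)"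
  unfolding grot_def using csmooth_glam[OF assms]
  by (cases "j = 1"; cases "j = 2") (auto intro!: csmooth_on_const csmooth_on_cnj U_open)

lemma csmooth_om_comp: assumes "\<And>x. x \<in> U \<Longrightarrow> F x \<in> ball_CH n" shows "csmooth_on d U (\<lambda>x. om (F x))"
  unfolding om_def
  by (intro csmooth_on_divide csmooth_on_add csmooth_on_diff csmooth_on_const F U_open)
    (rule one_minus_cplx0[OF assms n0])

lemma csmooth_ze_comp: assumes "\<And>x. x \<in> U \<Longrightarrow> F x \<in> ball_CH n" shows "csmooth_on d U (\<lambda>x. ze (F x) j)"
  unfolding ze_def
  by (intro csmooth_on_divide csmooth_on_diff csmooth_on_const F U_open)
    (rule one_minus_cplx0[OF assms n0])

end

lemma lie_group_G: "lie_group (Ggrp n al be) (dom_manifold D G)"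
proof -
  have 1: "smooth_map (prod_manifold (dom_manifold D G) (dom_manifold D G)) (dom_manifold D G) (\<lambda>(g, h). mul g h)"
  proof (rule smooth_map_prod_dom[OF openin_G openin_G openin_G])
    let ?U = "join_dom D D G G"
    have U: "openin (Euclidean_space (D + D)) ?U" by (rule openin_join_dom[OF openin_G openin_G])
    note F = csmooth_on_cplx_fstR[OF U, of D] and S = csmooth_on_cplx_sndR[OF U, of D]
    have nz: "cplx (fstR D x) 0 \<noteq> 0" if "x \<in> ?U" for x
      using that by (simp add: join_dom_def Gset_def)
    have "smooth_coord (D + D) ?U (2 * (n - 1)) (\<lambda>z. mul (fstR D z) (sndR D z))"
      unfolding gmul_def
    proof (rule smooth_coord_vec[OF U])
      fix j assume "j < n - 1"
      have e: "csmooth_on (D + D) ?U (\<lambda>z. complex_of_real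
          (exp (2 * Im (dot n (\<lambda>j. grot (fstR D z) j * tau (sndR D z) j) (tau (fstR D z))))))"
        by (intro csmooth_on_of_real smooth_on_exp smooth_on_mult smooth_on_const U csmooth_on_Im csmooth_on_dot
            csmooth_on_mult csmooth_tau F S csmooth_grot nz)
      have l: "csmooth_on (D + D) ?U (\<lambda>z. glam (fstR D z))" by (rule csmooth_glam[OF F nz])
      consider "j = 0" | "j = 1" | "2 \<le> j" by linarith
      then show "csmooth_on (D + D) ?U (\<lambda>z. if j = 0 then cplx (fstR D z) 0 * cplx (sndR D z) 0 * complex_of_real
          (exp (2 * Im (dot n (\<lambda>j. grot (fstR D z) j * tau (sndR D z) j) (tau (fstR D z)))))
          else if j = 1 then glam (fstR D z) * cplx (sndR D z) 1 + cplx (fstR D z) 1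
          else cplx (sndR D z) j + cplx (fstR D z) j)"
      proof cases
        case 1 then show ?thesis by (simp only: refl if_True) (intro csmooth_on_mult F S e)
      next
        case 2 then show ?thesis
          by (simp only: refl if_True if_False one_neq_zero) (intro csmooth_on_mult csmooth_on_add F S l)
      next
        case 3
        then have "j \<noteq> 0" "j \<noteq> 1" by auto
        then show ?thesis by (simp only: if_False) (intro csmooth_on_add F S)
      qed
    qed
    then show "smooth_coord (D + D) ?U D (\<lambda>z. case (fstR D z, sndR D z) of (g, h) \<Rightarrow> mul g h)"
      by simp
  qed (simp add: mul_in_G)
  have "smooth_coord D G D (ginv n)"
  proof -
    note C = csmooth_on_cplx[OF openin_G]
    have l: "csmooth_on D G glam" using csmooth_glam[of D G "\<lambda>x. x", OF C] G_nz by simp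
    have "smooth_coord D G (2 * (n - 1)) (\<lambda>g. ginv n g)"
      unfolding ginv_def
    proof (rule smooth_coord_vec[OF openin_G])
      fix j assume "j < n - 1"
      consider "j = 0" | "j = 1" | "2 \<le> j" by linarith
      then show "csmooth_on D G (\<lambda>g. if j = 0 then inverse (cplx g 0)
          else if j = 1 then - cnj (glam g) * cplx g 1 else - cplx g j)"
      proof cases
        case 1 then show ?thesis by (simp only: refl if_True) (rule csmooth_on_inverse[OF C G_nz])
      next
        case 2 then show ?thesis
          by (simp only: refl if_True if_False one_neq_zero)
            (intro csmooth_on_mult csmooth_on_cnj csmooth_on_uminus C l)
      next
        case 3
        then have "j \<noteq> 0" "j \<noteq> 1" by auto
        then show ?thesis by (simp only: if_False) (intro csmooth_on_uminus C)
      qed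
    qed
    then show ?thesis by simp
  qed
  then have "smooth_coord D G D (\<lambda>g. inv\<^bsub>Ggrp n al be\<^esub> g)"
    by (subst smooth_coord_cong[OF openin_G, of _ "ginv n"]) (simp_all add: inv_G)
  then have 2: "smooth_map (dom_manifold D G) (dom_manifold D G) (\<lambda>g. inv\<^bsub>Ggrp n al be\<^esub> g)"
    by (subst smooth_map_dom_iff[OF openin_G openin_G]) (simp_all add: inv_G inv_in_G)
  have "points (dom_manifold D G) = G"
    using openin_Rn_subset[OF openin_G] by (simp add: Int_absorb1)
  then show ?thesis
    unfolding lie_group_def using group_G smooth_manifold_dom[OF openin_G] 1 2 by (simp add: Ggrp_def)
qed

subsection \<open>The action\<close>

lemma gact_map: "g \<in> G \<Longrightarrow> siegel_map n 1 (grot g)"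
  by unfold_locales (simp_all add: n0 grot_norm G_nz)

lemma gact_in_ball: "g \<in> G \<Longrightarrow> z \<in> ball_CH n \<Longrightarrow> gact n al be g z \<in> ball_CH n"
  unfolding gact_def by (rule siegel_map.smap_in_ball[OF gact_map])

lemma ze_gact: "g \<in> G \<Longrightarrow> z \<in> ball_CH n \<Longrightarrow> 1 \<le> j \<Longrightarrow> j < n \<Longrightarrow>
    ze (gact n al be g z) j = grot g j * ze z j + tau g j"
  unfolding gact_def by (simp add: siegel_map.ze_smap[OF gact_map] siegel_ze_def)

lemma om_gact: "g \<in> G \<Longrightarrow> z \<in> ball_CH n \<Longrightarrow> om (gact n al be g z) =
    om z + 2 * dot n (\<lambda>j. grot g j * ze z j) (tau g) + dot n (tau g) (tau g) + \<i> * complex_of_real (gu g)"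
  unfolding gact_def by (simp add: siegel_map.om_smap[OF gact_map] siegel_om_def)

lemma ht_gact: "g \<in> G \<Longrightarrow> z \<in> ball_CH n \<Longrightarrow> ht n (gact n al be g z) = ht n z"
  unfolding gact_def by (simp add: siegel_map.ht_smap[OF gact_map])

lemma gact_mul:
  assumes g: "g \<in> G" and h: "h \<in> G" and z: "z \<in> ball_CH n"
  shows "gact n al be (mul g h) z = gact n al be g (gact n al be h z)"
proof (rule siegel_eqI[OF gact_in_ball[OF mul_in_G[OF g h] z] gact_in_ball[OF g gact_in_ball[OF h z]] n0])
  note hz = gact_in_ball[OF h z]
  show "ze (gact n al be (mul g h) z) j = ze (gact n al be g (gact n al be h z)) j" if "1 \<le> j" "j < n" for j
    unfolding ze_gact[OF mul_in_G[OF g h] z that] ze_gact[OF g hz that] ze_gact[OF h z that]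
      grot_mul[OF g h] tau_mul[OF that] by (simp add: algebra_simps)
  have 1: "dot n (\<lambda>j. grot (mul g h) j * ze z j) (tau (mul g h))
    = dot n (\<lambda>j. grot g j * (grot h j * ze z j)) (\<lambda>j. grot g j * tau h j + tau g j)"
    by (rule dot_cong) (simp_all add: tau_mul grot_mul g h)
  have 2: "dot n (tau (mul g h)) (tau (mul g h))
    = dot n (\<lambda>j. grot g j * tau h j + tau g j) (\<lambda>j. grot g j * tau h j + tau g j)"
    by (rule dot_cong) (simp_all add: tau_mul)
  have 3: "dot n (\<lambda>j. grot g j * ze (gact n al be h z) j) (tau g)
    = dot n (\<lambda>j. grot g j * (grot h j * ze z j) + grot g j * tau h j) (tau g)"
    by (rule dot_cong) (simp_all add: ze_gact[OF h z] algebra_simps)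
  define X where "X = dot n (\<lambda>j. grot g j * tau h j) (tau g)"
  have X: "dot n (tau g) (\<lambda>j. grot g j * tau h j) = cnj X" by (simp add: X_def dot_cnj)
  \<comment> \<open>The cocycle term turns the \<open>X + cnj X\<close> from the squared translation
    into the \<open>2 * X\<close> that the two successive actions produce.\<close>
  have X2: "2 * \<i> * complex_of_real (Im X) + cnj X = X" by (simp add: complex_eq_iff)
  show "om (gact n al be (mul g h) z) = om (gact n al be g (gact n al be h z))"
    unfolding om_gact[OF mul_in_G[OF g h] z] om_gact[OF g hz] om_gact[OF h z] 1 2 3 gu_mul[OF g h]
      dot_add_left dot_add_right dot_rot[OF g] X X_def[symmetric]
    using X2 by (simp add: algebra_simps)
qed

lemma gact_one: "z \<in> ball_CH n \<Longrightarrow> gact n al be (gone n) z = z"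
proof (rule siegel_eqI[OF gact_in_ball[OF one_in_G] _ n0])
  assume z: "z \<in> ball_CH n"
  have "dot n (\<lambda>j. grot (gone n) j * ze z j) (tau (gone n)) = dot n (ze z) (\<lambda>_. 0)"
    "dot n (tau (gone n)) (tau (gone n)) = dot n (\<lambda>_. 0) (\<lambda>_. 0)"
    by (rule dot_cong; simp add: one_params)+
  then show "om (gact n al be (gone n) z) = om z"
    by (simp add: om_gact[OF one_in_G z] one_params dot_def)
  show "ze (gact n al be (gone n) z) j = ze z j" if "1 \<le> j" "j < n" for j
    using that by (simp add: ze_gact[OF one_in_G z] one_params)
qed auto

lemma gact_inv: "g \<in> G \<Longrightarrow> z \<in> ball_CH n \<Longrightarrow> gact n al be (ginv n g) (gact n al be g z) = z"
  using gact_mul[OF inv_in_G, of g g z] by (simp add: inv_mul gact_one)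

lemma mul_inv: "g \<in> G \<Longrightarrow> mul g (ginv n g) = gone n"
  using group.r_inv[OF group_G, of g] inv_G[of g] by (simp add: Ggrp_def)

lemma gact_inv': "g \<in> G \<Longrightarrow> z \<in> ball_CH n \<Longrightarrow> gact n al be g (gact n al be (ginv n g) z) = z"
  using gact_mul[of g "ginv n g" z] by (simp add: inv_in_G mul_inv gact_one)

lemma bij_gact: "g \<in> G \<Longrightarrow> bij_betw (restrict (gact n al be g) (ball_CH n)) (ball_CH n) (ball_CH n)"
  by (rule bij_betwI[where g = "gact n al be (ginv n g)"])
    (auto simp: gact_in_ball inv_in_G gact_inv gact_inv')

lemma group_action_G: "group_action (Ggrp n al be) (ball_CH n) (act Act)"
proof -
  let ?a = "\<lambda>g. restrict (gact n al be g) (ball_CH n)"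
  have B: "?a g \<in> Bij (ball_CH n)" if "g \<in> G" for g
    using bij_gact[OF that] by (simp add: Bij_def)
  have "?a \<in> hom (Ggrp n al be) (BijGroup (ball_CH n))"
  proof (rule homI)
    fix g h assume "g \<in> carrier (Ggrp n al be)" "h \<in> carrier (Ggrp n al be)"
    then have gh: "g \<in> G" "h \<in> G" by (simp_all add: Ggrp_def)
    show "?a (g \<otimes>\<^bsub>Ggrp n al be\<^esub> h) = ?a g \<otimes>\<^bsub>BijGroup (ball_CH n)\<^esub> ?a h"
      using gh by (auto simp: BijGroup_def B Ggrp_def compose_def gact_mul gact_in_ball intro!: restrict_ext)
  qed (simp add: BijGroup_def Ggrp_def B)
  then show ?thesis
    by (simp add: group_action_def group_hom_def group_hom_axioms_def group_G group_BijGroup Gact_def)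
qed

lemma smooth_coord_gact: "smooth_coord (D + 2 * n) (join_dom D (2 * n) G (ball_CH n)) (2 * n)
    (\<lambda>z. gact n al be (fstR D z) (sndR D z))"
proof -
  let ?U = "join_dom D (2 * n) G (ball_CH n)"
  have U: "openin (Euclidean_space (D + 2 * n)) ?U" by (rule openin_join_dom[OF openin_G openin_ball_CH])
  note F = csmooth_on_cplx_fstR[OF U, of D] and S = csmooth_on_cplx_sndR[OF U, of D]
  have fs: "fstR D x \<in> G" "sndR D x \<in> ball_CH n" if "x \<in> ?U" for x using that by (simp_all add: join_dom_def)
  note nz = fs(1)[THEN G_nz]
  show ?thesis
    unfolding gact_def smap_def
  proof (rule smooth_coord_of_siegel[OF U])
    show "csmooth_on (D + 2 * n) ?U (\<lambda>x. siegel_om n 1 (grot (fstR D x)) (tau (fstR D x)) (gu (fstR D x)) (sndR D x))"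
      unfolding siegel_om_def
      by (intro csmooth_on_of_real smooth_gu csmooth_on_mult csmooth_on_add csmooth_on_const U csmooth_on_dot
          csmooth_tau F S csmooth_grot csmooth_om_comp csmooth_ze_comp nz fs)
    show "csmooth_on (D + 2 * n) ?U (\<lambda>x. siegel_ze 1 (grot (fstR D x)) (tau (fstR D x)) (sndR D x) j)" for j
      unfolding siegel_ze_def
      by (intro csmooth_on_mult csmooth_on_add csmooth_on_const U csmooth_tau F S csmooth_grot csmooth_ze_comp nz fs)
    show "siegel_om n 1 (grot (fstR D x)) (tau (fstR D x)) (gu (fstR D x)) (sndR D x) + 1 \<noteq> 0" if "x \<in> ?U" for x
      by (rule siegel_nz[OF siegel_map.siegel_in[OF gact_map[OF fs(1)[OF that]] fs(2)[OF that]]])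
  qed
qed

lemma smooth_map_act: "smooth_map (prod_manifold (lie Act) (riem_manifold (CH n))) (riem_manifold (CH n)) (\<lambda>(g, p). act Act g p)"
proof -
  have U: "openin (Euclidean_space (D + 2 * n)) (join_dom D (2 * n) G (ball_CH n))"
    by (rule openin_join_dom[OF openin_G openin_ball_CH])
  show ?thesis
    unfolding riem_manifold_dom Gact_def lie_action.simps rdim_CH
  proof (rule smooth_map_prod_dom[OF openin_G openin_ball_CH openin_ball_CH])
    show "smooth_coord (D + 2 * n) (join_dom D (2 * n) G (ball_CH n)) (2 * n)
        (\<lambda>z. case (fstR D z, sndR D z) of (g, p) \<Rightarrow> restrict (gact n al be g) (ball_CH n) p)"
      using smooth_coord_gact
      by (subst smooth_coord_cong[OF U, of _ "\<lambda>z. gact n al be (fstR D z) (sndR D z)"])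
        (auto simp: join_dom_def)
  qed (simp add: gact_in_ball)
qed

lemma isometry_act:
  assumes g: "g \<in> G"
  shows "isometry (CH n) (CH n) (act Act g)"
proof -
  let ?a = "\<lambda>g. restrict (gact n al be g) (ball_CH n)"
  have sm: "smooth_coord (2 * n) (ball_CH n) (2 * n) (?a g)" if "g \<in> G" for g
    by (subst smooth_coord_cong[OF openin_ball_CH, where G = "gact n al be g"])
      (simp_all add: gact_def siegel_map.smooth_coord_smap[OF gact_map[OF that]])
  have inv: "inv_into (ball_CH n) (?a g) z = ?a (ginv n g) z" if "z \<in> ball_CH n" for z
    by (rule inv_into_f_eq[OF bij_betw_imp_inj_on[OF bij_gact[OF g]]])
      (use that g in \<open>simp_all add: gact_in_ball inv_in_G gact_inv'\<close>)
  have smi: "smooth_coord (2 * n) (ball_CH n) (2 * n) (inv_into (ball_CH n) (?a g))"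
    by (subst smooth_coord_cong[OF openin_ball_CH inv]) (simp_all add: sm[OF inv_in_G[OF g]])
  have "rmetric (CH n) (?a g p) (jacobian (2 * n) (2 * n) (?a g) p v) (jacobian (2 * n) (2 * n) (?a g) p w)
          = rmetric (CH n) p v w" if p: "p \<in> ball_CH n" and vw: "v \<in> Rn (2 * n)" "w \<in> Rn (2 * n)" for p v w
  proof -
    have J: "jacobian (2 * n) (2 * n) (?a g) p x = jacobian (2 * n) (2 * n) (gact n al be g) p x" for x
      by (rule jacobian_cong[OF openin_ball_CH p]) simp
    show ?thesis unfolding J using p siegel_map.rmetric_smap[OF gact_map[OF g] p vw]
      by (simp add: gact_def)
  qed
  then show ?thesis
    unfolding isometry_CH_iff using bij_gact[OF g] sm[OF g] smi by (simp add: Gact_def)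
qed

end

section \<open>Connectedness of the group and properness of the action\<close>

lemma connected_space_top_of_set: "connected_space (top_of_set S) \<longleftrightarrow> connected S"
  by (metis connectedin_def connectedin_iff_connected subset_UNIV topspace_euclidean)

lemma continuous_on_cplx: "continuous_on S (\<lambda>x. cplx x j)"
  unfolding cplx_def
  by (intro continuous_on_Complex continuous_on_subset[OF continuous_on_product_coordinates subset_UNIV])

lemma continuous_on_vec:
  assumes "\<And>j. j < n \<Longrightarrow> continuous_on S (\<lambda>x. c x j)"
  shows "continuous_on S (\<lambda>x. cvec n (c x))"
proof (rule continuous_on_coordinatewise_then_product)
  fix i show "continuous_on S (\<lambda>x. cvec n (c x) i)"
  proof (cases "i < 2 * n")
    case True
    then have "continuous_on S (\<lambda>x. c x (i div 2))" by (intro assms) auto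
    then show ?thesis using True
      by (cases "even i") (auto simp: cvec_def intro: continuous_on_Re continuous_on_Im)
  qed (simp add: cvec_def)
qed

lemma compact_box:
  fixes S :: "nat \<Rightarrow> real set"
  assumes "\<And>i. compact (S i)"
  shows "compact {x. \<forall>i. x i \<in> S i}"
proof -
  have "compactin (product_topology (\<lambda>i. euclideanreal) UNIV) (PiE UNIV S)"
    by (simp add: compactin_PiE assms)
  moreover have "PiE UNIV S = {x. \<forall>i. x i \<in> S i}" by (auto simp: PiE_UNIV_domain)
  ultimately show ?thesis by (simp add: euclidean_product_topology)
qed

lemma dot_bound:
  assumes "\<And>j. 1 \<le> j \<Longrightarrow> j < n \<Longrightarrow> cmod (v j) \<le> a" "\<And>j. 1 \<le> j \<Longrightarrow> j < n \<Longrightarrow> cmod (w j) \<le> b" "0 \<le> a" "0 \<le> b"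
  shows "cmod (dot n v w) \<le> real n * (a * b)"
proof -
  have "cmod (dot n v w) \<le> (\<Sum>j=1..<n. a * b)"
    unfolding dot_def
    by (rule sum_norm_le) (simp add: norm_mult mult_mono assms)
  also have "\<dots> \<le> real n * (a * b)"
    using assms by (simp add: mult_right_mono)
  finally show ?thesis .
qed

context polar_family
begin

text \<open>\<open>exp\<close> maps the plane onto the punctured plane, so \<open>G\<close> is a
  continuous image of \<open>Rn D\<close>.\<close>

lemma connected_G: "connected G"
proof -
  define E where "E x = cvec (n - 1) (\<lambda>k. if k = 0 then exp (cplx x 0) else cplx x k)" for x
  have "connected {x :: nat \<Rightarrow> real. \<forall>i\<ge>D. x i = 0}"
    using connected_Euclidean_space[of D]
    unfolding Euclidean_space_eq connected_space_top_of_set .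
  then have "connected (Rn D)" by (simp only: Rn_eq)
  moreover have "continuous_on (Rn D) E"
    unfolding E_def
  proof (rule continuous_on_vec)
    fix j show "continuous_on (Rn D) (\<lambda>x. if j = 0 then exp (cplx x 0) else cplx x j)"
      by (cases "j = 0") (auto intro: continuous_on_exp continuous_on_cplx)
  qed
  ultimately have "connected (E ` Rn D)" by (rule connected_continuous_image[rotated])
  moreover have "E ` Rn D = G"
  proof
    show "E ` Rn D \<subseteq> G" unfolding E_def using vec_in_G by auto
    show "G \<subseteq> E ` Rn D"
    proof
      fix g assume g: "g \<in> G"
      define x where "x = cvec (n - 1) (\<lambda>k. if k = 0 then Ln (cplx g 0) else cplx g k)"
      have "E x = g"
      proof (rule cplx_eqI)
        fix j assume "j < n - 1"
        then show "cplx (E x) j = cplx g j"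
          using n1 G_nz[OF g] by (simp add: E_def x_def cplx_vec)
      qed (use G_Rn[OF g] in \<open>simp_all add: E_def vec_in_Rn\<close>)
      moreover have "x \<in> Rn D" unfolding x_def by (rule vec_in_Rn)
      ultimately show "g \<in> E ` Rn D" by (metis imageI)
    qed
  qed
  ultimately show ?thesis by simp
qed

lemma continuous_gact:
  "continuous_on (G \<times> ball_CH n) (\<lambda>(g, p). restrict (gact n al be g) (ball_CH n) p)"
proof -
  have "continuous_map (prod_topology (subtopology (Euclidean_space D) G) (subtopology (Euclidean_space (2 * n)) (ball_CH n)))
     (subtopology (Euclidean_space (2 * n)) (ball_CH n)) (\<lambda>(g, p). restrict (gact n al be g) (ball_CH n) p)"
    using smooth_map_act
    by (simp add: smooth_map_def prod_manifold_def riem_manifold_dom Gact_def)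
  then show ?thesis
    by (simp only: subtopology_Rn[OF openin_Rn_subset[OF openin_G]] subtopology_Rn[OF ball_CH_subset]
        prod_topology_subtopology_eu continuous_map_in_subtopology continuous_map_iff_continuous)
qed

text \<open>The core of properness: the translation is recovered from the \<zeta>-parts of
  \<open>p\<close> and its image because the rotation has modulus 1, and the central part is then
  recovered from \<omega>.\<close>

lemma group_element_bounds:
  assumes g: "g \<in> G" and p: "p \<in> ball_CH n" and B: "0 \<le> B"
    and bp: "cmod (om p) \<le> B" "\<And>j. j < n \<Longrightarrow> cmod (ze p j) \<le> B"
    and bq: "cmod (om (gact n al be g p)) \<le> B" "\<And>j. j < n \<Longrightarrow> cmod (ze (gact n al be g p) j) \<le> B"
  shows "\<And>k. 1 \<le> k \<Longrightarrow> k < n - 1 \<Longrightarrow> cmod (cplx g k) \<le> 4 * B"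
    and "\<bar>gu g\<bar> \<le> 2 * B + 8 * real n * B\<^sup>2"
proof -
  have t: "cmod (tau g j) \<le> 2 * B" if j: "1 \<le> j" "j < n" for j
  proof -
    have "tau g j = ze (gact n al be g p) j - grot g j * ze p j"
      by (simp add: ze_gact[OF g p j])
    then have "cmod (tau g j) \<le> cmod (ze (gact n al be g p) j) + cmod (grot g j * ze p j)"
      using norm_triangle_ineq4 by metis
    also have "cmod (grot g j * ze p j) = cmod (ze p j)"
      by (simp add: norm_mult grot_norm[OF G_nz[OF g]])
    finally show ?thesis using bp(2)[OF j(2)] bq(2)[OF j(2)] by linarith
  qed
  have ab: "\<bar>al\<bar> \<le> 1" "\<bar>be\<bar> \<le> 1"
    using albe by (metis abs_square_le_1 le_add_same_cancel1 zero_le_power2, metis abs_square_le_1 le_add_same_cancel2 zero_le_power2)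
  show "cmod (cplx g k) \<le> 4 * B" if k: "1 \<le> k" "k < n - 1" for k
  proof (cases "k = 1")
    case True
    \<comment> \<open>Entries 1 and 2 of \<open>tau g\<close> are real multiples of
      \<open>cplx g 1\<close> and of its conjugate; combining them with the weights
      \<open>be\<close> and \<open>al\<close> avoids dividing by either.\<close>
    have "cplx g 1 = (calbe al * calbe al + calbe be * calbe be) * cplx g 1" by (simp add: albe_c)
    also have "\<dots> = calbe be * tau g 1 - calbe al * cnj (tau g 2)"
      by (simp add: gtau_def algebra_simps)
    finally have "cmod (cplx g 1) \<le> cmod (calbe be * tau g 1) + cmod (calbe al * cnj (tau g 2))"
      using norm_triangle_ineq4 by metis
    also have "\<dots> \<le> 1 * (2 * B) + 1 * (2 * B)"
      unfolding norm_mult using ab t[of 1] t[of 2] n3 B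
      by (intro add_mono mult_mono) auto
    finally show ?thesis using True by simp
  next
    case False
    then have "tau g (k + 1) = cplx g k" using k by (simp add: gtau_def)
    moreover have "1 \<le> k + 1" "k + 1 < n" using k by auto
    ultimately have "cmod (cplx g k) \<le> 2 * B" using t[of "k + 1"] by metis
    then show ?thesis using B by linarith
  qed
  have "\<i> * complex_of_real (gu g) = om (gact n al be g p) - om p
      - 2 * dot n (\<lambda>j. grot g j * ze p j) (tau g) - dot n (tau g) (tau g)"
    by (simp add: om_gact[OF g p])
  then have "\<bar>gu g\<bar> = cmod (om (gact n al be g p) - om p
      - 2 * dot n (\<lambda>j. grot g j * ze p j) (tau g) - dot n (tau g) (tau g))"
    by (metis norm_ii norm_mult norm_of_real mult_1)
  also have "\<dots> \<le> cmod (om (gact n al be g p)) + cmod (om p)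
      + cmod (2 * dot n (\<lambda>j. grot g j * ze p j) (tau g)) + cmod (dot n (tau g) (tau g))"
    by (intro order_trans[OF norm_triangle_ineq4] add_mono order_refl)
  also have "\<dots> \<le> B + B + 2 * (real n * (B * (2 * B))) + real n * ((2 * B) * (2 * B))"
  proof (intro add_mono bq(1) bp(1))
    have "cmod (dot n (\<lambda>j. grot g j * ze p j) (tau g)) \<le> real n * (B * (2 * B))"
      by (rule dot_bound) (use bp t B in \<open>simp_all add: norm_mult grot_norm[OF G_nz[OF g]]\<close>)
    moreover have "cmod (2 * dot n (\<lambda>j. grot g j * ze p j) (tau g)) = 2 * cmod (dot n (\<lambda>j. grot g j * ze p j) (tau g))"
      by (simp add: norm_mult)
    ultimately show "cmod (2 * dot n (\<lambda>j. grot g j * ze p j) (tau g)) \<le> 2 * (real n * (B * (2 * B)))"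
      by linarith
    show "cmod (dot n (tau g) (tau g)) \<le> real n * ((2 * B) * (2 * B))"
      by (rule dot_bound) (use t B in simp_all)
  qed
  also have "\<dots> = 2 * B + 8 * real n * B\<^sup>2" by (simp add: power2_eq_square)
  finally show "\<bar>gu g\<bar> \<le> 2 * B + 8 * real n * B\<^sup>2" .
qed

text \<open>The lower bound on \<open>cmod (cplx g 0)\<close> keeps the box away from the puncture,
  so that it is a compact subset of \<open>G\<close>.\<close>

lemma compact_group_box: "compact {g \<in> Rn D. exp (- C) \<le> cmod (cplx g 0) \<and> cmod (cplx g 0) \<le> exp C \<and>
    (\<forall>k\<in>{1..<n - 1}. cmod (cplx g k) \<le> M)}" (is "compact ?K")
proof -
  define m where "m = max (exp C) M"
  define Q where "Q = {g :: nat \<Rightarrow> real. \<forall>i. g i \<in> (if i < D then {-m..m} else {0})}"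
  have "compact Q" unfolding Q_def by (rule compact_box) simp
  moreover have "closed {g. \<forall>k\<in>{1..<n - 1}. cmod (cplx g k) \<le> M}"
  proof -
    have "closed (\<Inter>k\<in>{1..<n - 1}. {g. cmod (cplx g k) \<le> M})"
      by (intro closed_INT ballI closed_Collect_le continuous_on_norm continuous_on_cplx continuous_on_const)
    then show ?thesis by (rule back_subst[of closed]) auto
  qed
  then have "closed {g. exp (- C) \<le> cmod (cplx g 0) \<and> cmod (cplx g 0) \<le> exp C \<and>
    (\<forall>k\<in>{1..<n - 1}. cmod (cplx g k) \<le> M)}"
    by (intro closed_Collect_conj closed_Collect_le continuous_on_norm continuous_on_cplx continuous_on_const)
  ultimately have "compact (Q \<inter> {g. exp (- C) \<le> cmod (cplx g 0) \<and> cmod (cplx g 0) \<le> exp C \<and>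
    (\<forall>k\<in>{1..<n - 1}. cmod (cplx g k) \<le> M)})" by (rule compact_Int_closed)
  moreover have "g \<in> Q" if g: "g \<in> ?K" for g
    unfolding Q_def
  proof (intro CollectI allI)
    fix i show "g i \<in> (if i < D then {-m..m} else {0})"
    proof (cases "i < D")
      case True
      have "cmod (cplx g (i div 2)) \<le> m"
      proof (cases "i div 2 = 0")
        case False
        then have "i div 2 \<in> {1..<n - 1}" using True by auto
        then have "cmod (cplx g (i div 2)) \<le> M" using g by blast
        then show ?thesis by (simp add: m_def)
      qed (use g in \<open>auto simp: m_def\<close>)
      moreover have "\<bar>g i\<bar> \<le> cmod (cplx g (i div 2))"
      proof (cases "even i")
        case True
        then have "g i = Re (cplx g (i div 2))" by (simp add: cplx_def)
        then show ?thesis using abs_Re_le_cmod by metis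
      next
        case False
        then have "g i = Im (cplx g (i div 2))" by (simp add: cplx_def)
        then show ?thesis using abs_Im_le_cmod by metis
      qed
      ultimately show ?thesis using True by (auto simp: abs_le_iff)
    qed (use g in \<open>auto simp: Rn_iff\<close>)
  qed
  moreover have "Q \<subseteq> Rn D" by (auto simp: Q_def Rn_iff split: if_splits)
  ultimately show ?thesis
    by (elim back_subst[of compact]) blast
qed

text \<open>All points and images that occur in \<open>K\<close> lie in one compact set
  \<open>K'\<close>, on which the Siegel coordinates are bounded. This confines the group elements
  to a compact box, and the preimage is closed in a compact product.\<close>

lemma compact_preimage:
  assumes K: "compact K" "K \<subseteq> ball_CH n \<times> ball_CH n"
  shows "compact {x \<in> G \<times> ball_CH n. (restrict (gact n al be (fst x)) (ball_CH n) (snd x), snd x) \<in> K}"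
    (is "compact ?S")
proof -
  define K' where "K' = fst ` K \<union> snd ` K"
  have cK': "compact K'" and K'b: "K' \<subseteq> ball_CH n"
    using K by (auto simp: K'_def intro!: compact_Un compact_continuous_image continuous_on_fst continuous_on_snd continuous_on_id)
  define f where "f z = (\<Sum>j<n. cmod (ze z j)) + cmod (om z)" for z
  have "continuous_on (ball_CH n) f"
    unfolding f_def
    by (intro continuous_on_add continuous_on_sum continuous_on_norm csmooth_on_continuous[OF csmooth_on_om[OF n0]]
        csmooth_on_continuous[OF csmooth_on_ze[OF n0]])
  then have "compact (f ` K')"
    using cK' K'b continuous_on_subset compact_continuous_image by blast
  then obtain B0 where B0: "\<And>z. z \<in> K' \<Longrightarrow> f z \<le> B0"
    using compact_imp_bounded bounded_iff by (metis abs_le_D1 imageI real_norm_def)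
  define B where "B = max 0 B0"
  have B: "0 \<le> B" by (simp add: B_def)
  have f0: "cmod (om z) \<le> f z" "j < n \<Longrightarrow> cmod (ze z j) \<le> f z" for z j
  proof -
    show "cmod (om z) \<le> f z" by (simp add: f_def sum_nonneg)
    assume "j < n"
    then have "cmod (ze z j) \<le> (\<Sum>j<n. cmod (ze z j))" by (intro member_le_sum) auto
    then show "cmod (ze z j) \<le> f z" using norm_ge_zero[of "om z"] unfolding f_def by linarith
  qed
  have bd: "cmod (om z) \<le> B" "j < n \<Longrightarrow> cmod (ze z j) \<le> B" if "z \<in> K'" for z j
    using f0(1)[of z] f0(2)[where j = j and z = z] B0[OF that] unfolding B_def by linarith+
  define C where "C = 2 * B + 8 * real n * B\<^sup>2"
  define Kg where "Kg = {g \<in> Rn D. exp (- C) \<le> cmod (cplx g 0) \<and> cmod (cplx g 0) \<le> exp C \<and>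
    (\<forall>k\<in>{1..<n - 1}. cmod (cplx g k) \<le> 4 * B)}"
  have cKg: "compact Kg" unfolding Kg_def by (rule compact_group_box)
  have KgG: "Kg \<subseteq> G"
  proof
    fix g assume g: "g \<in> Kg"
    then have "exp (- C) \<le> cmod (cplx g 0)" by (simp add: Kg_def)
    then have "cplx g 0 \<noteq> 0" using exp_gt_zero[of "- C"] by auto
    then show "g \<in> G" using g by (simp add: Kg_def Gset_def)
  qed
  define F where "F x = (restrict (gact n al be (fst x)) (ball_CH n) (snd x), snd x)" for x
  have "continuous_on (Kg \<times> K') F"
    unfolding F_def
    by (intro continuous_on_Pair continuous_on_snd continuous_on_id
        continuous_on_subset[OF continuous_gact[unfolded case_prod_beta]])
      (use KgG K'b in auto)
  moreover have "closed (Kg \<times> K')" "closed K"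
    using cKg cK' K(1) compact_Times compact_imp_closed by blast+
  ultimately have "closed (Kg \<times> K' \<inter> F -` K)"
    by (intro continuous_closed_preimage)
  then have "compact ((Kg \<times> K') \<inter> (Kg \<times> K' \<inter> F -` K))"
    using compact_Int_closed[OF compact_Times[OF cKg cK']] by blast
  moreover have "(Kg \<times> K') \<inter> (Kg \<times> K' \<inter> F -` K) = ?S"
  proof
    show "(Kg \<times> K') \<inter> (Kg \<times> K' \<inter> F -` K) \<subseteq> ?S"
      using KgG K'b by (auto simp: F_def)
    show "?S \<subseteq> (Kg \<times> K') \<inter> (Kg \<times> K' \<inter> F -` K)"
    proof
      fix x assume x: "x \<in> ?S"
      obtain g p where gp: "x = (g, p)" by (cases x)
      have g: "g \<in> G" and p: "p \<in> ball_CH n" and q: "(gact n al be g p, p) \<in> K"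
        using x by (auto simp: gp)
      have pK: "p \<in> K'" and qK: "gact n al be g p \<in> K'"
        using q by (force simp: K'_def)+
      note bds = group_element_bounds[OF g p B bd(1)[OF pK] bd(2)[OF pK] bd(1)[OF qK] bd(2)[OF qK]]
      have pos: "0 < cmod (cplx g 0)" using G_nz[OF g] by simp
      have "\<bar>ln (cmod (cplx g 0))\<bar> \<le> C" using bds(2) by (simp add: C_def gu_def)
      then have "exp (- C) \<le> exp (ln (cmod (cplx g 0)))" "exp (ln (cmod (cplx g 0))) \<le> exp C"
        unfolding exp_le_cancel_iff by linarith+
      then have "exp (- C) \<le> cmod (cplx g 0)" "cmod (cplx g 0) \<le> exp C"
        unfolding exp_ln[OF pos] .
      then have "g \<in> Kg" using bds(1) G_Rn[OF g] by (simp add: Kg_def)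
      then show "x \<in> (Kg \<times> K') \<inter> (Kg \<times> K' \<inter> F -` K)"
        using pK p q by (simp add: gp F_def)
    qed
  qed
  ultimately show ?thesis by simp
qed

lemma proper_isometric_G: "proper_isometric_action (CH n) Act"
proof -
  have m1: "mtop (lie Act) = top_of_set G"
    unfolding Gact_def
    by (simp only: lie_action.simps dom_manifold_simps subtopology_Rn[OF openin_Rn_subset[OF openin_G]])
  have m2: "mtop (riem_manifold (CH n)) = top_of_set (ball_CH n)"
    by (simp add: riem_manifold_dom subtopology_Rn[OF ball_CH_subset])
  let ?Y = "top_of_set (ball_CH n \<times> ball_CH n)"
  have F: "(\<lambda>(g, p). (act Act g p, p)) = (\<lambda>x. (restrict (gact n al be (fst x)) (ball_CH n) (snd x), snd x))"
    by (auto simp: Gact_def fun_eq_iff)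
  have "proper_map (top_of_set (G \<times> ball_CH n)) ?Y (\<lambda>x. (restrict (gact n al be (fst x)) (ball_CH n) (snd x), snd x))"
  \<comment> \<open>The target is metrizable, so for this continuous map it suffices that preimages
    of compact sets are compact.\<close>
  proof (rule compact_imp_proper_map)
    have met: "metrizable_space ?Y"
      using metrizable_space_euclidean metrizable_space_subtopology by blast
    show "k_space ?Y" using met metrizable_imp_k_space by blast
    show "kc_space ?Y" using met metrizable_imp_Hausdorff_space Hausdorff_imp_kc_space by blast
    show "(\<lambda>x. (restrict (gact n al be (fst x)) (ball_CH n) (snd x), snd x))
        \<in> topspace (top_of_set (G \<times> ball_CH n)) \<rightarrow> topspace ?Y"
      by (auto simp: gact_in_ball)
    show "continuous_map (top_of_set (G \<times> ball_CH n)) ?Y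
       (\<lambda>x. (restrict (gact n al be (fst x)) (ball_CH n) (snd x), snd x)) \<or> kc_space (top_of_set (G \<times> ball_CH n))"
      using metrizable_space_euclidean metrizable_space_subtopology metrizable_imp_Hausdorff_space Hausdorff_imp_kc_space by blast
    fix K assume "compactin ?Y K"
    then have K: "compact K" "K \<subseteq> ball_CH n \<times> ball_CH n"
      by (simp_all add: compactin_subtopology)
    show "compactin (top_of_set (G \<times> ball_CH n))
       {x \<in> topspace (top_of_set (G \<times> ball_CH n)). (restrict (gact n al be (fst x)) (ball_CH n) (snd x), snd x) \<in> K}"
      unfolding topspace_euclidean_subtopology compactin_subtopology compactin_euclidean_iff
      using compact_preimage[OF K] by (intro conjI) (assumption, rule Collect_restrict)
  qed
  then have "proper_map (prod_topology (mtop (lie Act)) (mtop (riem_manifold (CH n))))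
      (prod_topology (mtop (riem_manifold (CH n))) (mtop (riem_manifold (CH n)))) (\<lambda>(g, p). (act Act g p, p))"
    unfolding m1 m2 F prod_topology_subtopology_eu .
  moreover have "connected_space (mtop (lie Act))"
    unfolding m1 connected_space_top_of_set by (rule connected_G)
  moreover have "lie_group (grp Act) (lie Act)" "group_action (grp Act) (ball_CH n) (act Act)"
    using lie_group_G group_action_G by (simp_all add: Gact_def)
  moreover have "carrier (grp Act) = G" by (simp add: Gact_def Ggrp_def)
  ultimately show ?thesis
    unfolding proper_isometric_action_def
    by (intro conjI ballI smooth_map_act isometry_act) simp_all
qed

subsection \<open>Orbits\<close>

lemma orbit_eq: "p \<in> ball_CH n \<Longrightarrow> orbit_of Act p = (\<lambda>g. gact n al be g p) ` G"
  by (auto simp: orbit_def Gact_def Ggrp_def)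

lemma zp_gact:
  assumes g: "g \<in> G" and z: "z \<in> ball_CH n"
  shows "zp al be (ze (gact n al be g z)) = glam g * zp al be (ze z)"
proof -
  have 1: "ze (gact n al be g z) 1 = glam g * ze z 1 + calbe be * cplx g 1"
    using ze_gact[OF g z, of 1] n3 by (simp add: grot_def gtau_def)
  have 2: "ze (gact n al be g z) 2 = cnj (glam g) * ze z 2 - calbe al * cnj (cplx g 1)"
    using ze_gact[OF g z, of 2] n3 by (simp add: grot_def gtau_def)
  show ?thesis unfolding zp_def 1 2 by (simp add: algebra_simps)
qed

text \<open>For the converse three choices carry \<open>p\<close> to \<open>q\<close>: a rotation
  \<open>l\<close> for the plane component, a translation for everything orthogonal to the plane,
  and the centre for the imaginary part of \<omega>. The real part of \<omega> then agrees because
  the heights do.\<close>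

lemma orbit_iff:
  assumes p: "p \<in> ball_CH n"
  shows "q \<in> orbit_of Act p \<longleftrightarrow>
    q \<in> ball_CH n \<and> ht n q = ht n p \<and> cmod (zp al be (ze q)) = cmod (zp al be (ze p))"
proof
  assume "q \<in> orbit_of Act p"
  then obtain g where g: "g \<in> G" "q = gact n al be g p" by (auto simp: orbit_eq[OF p])
  then show "q \<in> ball_CH n \<and> ht n q = ht n p \<and> cmod (zp al be (ze q)) = cmod (zp al be (ze p))"
    using p by (simp add: gact_in_ball ht_gact zp_gact norm_mult glam_norm[OF G_nz])
next
  assume q: "q \<in> ball_CH n \<and> ht n q = ht n p \<and> cmod (zp al be (ze q)) = cmod (zp al be (ze p))"
  then have qb: "q \<in> ball_CH n" by simp
  have "\<exists>l. cmod l = 1 \<and> l * zp al be (ze p) = zp al be (ze q)"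
  proof (cases "zp al be (ze p) = 0")
    case True
    then show ?thesis using q by (intro exI[of _ 1]) simp
  next
    case False
    then show ?thesis
      using q by (intro exI[of _ "zp al be (ze q) / zp al be (ze p)"]) (simp add: norm_divide)
  qed
  then obtain l where l: "cmod l = 1" "l * zp al be (ze p) = zp al be (ze q)" by blast
  define Z where "Z k = (if k = 1 then wp al be (ze q) - l * wp al be (ze p) else ze q (k + 1) - ze p (k + 1))" for k :: nat
  define g0 where "g0 = cvec (n - 1) (\<lambda>k. if k = 0 then l else Z k)"
  \<comment> \<open>\<open>grot\<close> and \<open>gtau\<close> ignore the modulus of entry 0, so
    the missing shift of the imaginary part can be computed from \<open>g0\<close>; \<open>g\<close>
    differs from it by the modulus \<open>exp u\<close>.\<close>
  define u where "u = Im (om q - om p - 2 * dot n (\<lambda>j. grot g0 j * ze p j) (tau g0))"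
  define g where "g = cvec (n - 1) (\<lambda>k. if k = 0 then calbe (exp u) * l else Z k)"
  have lnz: "l \<noteq> 0" using l(1) by auto
  have g0G: "g0 \<in> G" and gG: "g \<in> G" unfolding g0_def g_def by (rule vec_in_G; simp add: lnz)+
  have lam: "glam g0 = l" "glam g = l" and ug: "gu g = u"
    using n1 l(1) by (simp_all add: g0_def g_def glam_def gu_def cplx_vec norm_mult)
  have ck: "cplx g k = Z k" "cplx g0 k = Z k" if "1 \<le> k" "k < n - 1" for k
    using that by (simp_all add: g_def g0_def cplx_vec)
  have tg: "tau g j = tau g0 j" if j: "1 \<le> j" "j < n" for j
  proof -
    consider "j = 1" | "j = 2" | "3 \<le> j" using j by linarith
    then show ?thesis
    proof cases
      case 3 then show ?thesis using j ck[of "j - 1"] by (simp add: gtau_def)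
    qed (use n1 ck[of 1] in \<open>simp_all add: gtau_def\<close>)
  qed
  have zeq: "ze (gact n al be g p) j = ze q j" if j: "1 \<le> j" "j < n" for j
  proof -
    consider "j = 1" | "j = 2" | "3 \<le> j" using j by linarith
    then show ?thesis
    proof cases
      case 1
      have "ze (gact n al be g p) 1 = l * ze p 1 + calbe be * (wp al be (ze q) - l * wp al be (ze p))"
        using ze_gact[OF gG p, of 1] n3 n1 ck(1)[of 1] by (simp add: grot_def gtau_def lam Z_def)
      also have "\<dots> = calbe al * (l * zp al be (ze p)) + calbe be * wp al be (ze q)"
        using zp_wp(1)[of "ze p"] by (simp add: algebra_simps)
      also have "\<dots> = ze q 1" unfolding l(2) by (rule zp_wp(1)[symmetric])
      finally show ?thesis using 1 by simp
    next
      case 2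
      have "ze (gact n al be g p) 2 = cnj l * ze p 2 - calbe al * cnj (wp al be (ze q) - l * wp al be (ze p))"
        using ze_gact[OF gG p, of 2] n3 n1 ck(1)[of 1] by (simp add: grot_def gtau_def lam Z_def)
      also have "\<dots> = calbe be * cnj (l * zp al be (ze p)) - calbe al * cnj (wp al be (ze q))"
        by (subst zp_wp(2)[of "ze p"]) (simp add: algebra_simps)
      also have "\<dots> = ze q 2" unfolding l(2) by (rule zp_wp(2)[symmetric])
      finally show ?thesis using 2 by simp
    next
      case 3
      then have j': "1 \<le> j - 1" "j - 1 < n - 1" "j - 1 + 1 = j" "j - 1 \<noteq> 1" "j \<noteq> 1" "j \<noteq> 2"
        using j by auto
      have "tau g j = ze q j - ze p j"
        using j' ck(1)[OF j'(1,2)] by (simp only: gtau_def Z_def if_False)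
      then show ?thesis
        using ze_gact[OF gG p j] j' by (simp add: grot_def)
    qed
  qed
  have gb: "gact n al be g p \<in> ball_CH n" by (rule gact_in_ball[OF gG p])
  have "q = gact n al be g p"
  proof (rule siegel_eqI[OF qb gb n0])
    show "om q = om (gact n al be g p)"
    proof (rule complex_eqI)
      have "dot n (ze (gact n al be g p)) (ze (gact n al be g p)) = dot n (ze q) (ze q)"
        by (rule dot_cong) (simp_all add: zeq)
      then show "Re (om q) = Re (om (gact n al be g p))"
        using q ht_gact[OF gG p] by (simp add: ht_def)
      have "dot n (\<lambda>j. grot g j * ze p j) (tau g) = dot n (\<lambda>j. grot g0 j * ze p j) (tau g0)"
        by (rule dot_cong) (simp_all add: tg grot_def lam)
      then show "Im (om q) = Im (om (gact n al be g p))"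
        by (simp add: om_gact[OF gG p] ug u_def)
    qed
  qed (simp add: zeq)
  then show "q \<in> orbit_of Act p" unfolding orbit_eq[OF p] using gG by blast
qed

lemma orbit_self: "p \<in> ball_CH n \<Longrightarrow> p \<in> orbit_of Act p"
  by (simp add: orbit_iff)

lemma orbit_connected: assumes p: "p \<in> ball_CH n" shows "connected (orbit_of Act p)"
proof -
  have "continuous_on G (\<lambda>g. (g, p))" by (intro continuous_on_Pair continuous_on_id continuous_on_const)
  then have "continuous_on G (\<lambda>g. (\<lambda>(g, p). restrict (gact n al be g) (ball_CH n) p) (g, p))"
    by (rule continuous_on_compose2[OF continuous_gact]) (use p in auto)
  then have "continuous_on G (\<lambda>g. gact n al be g p)" using p by simp
  then show ?thesis unfolding orbit_eq[OF p] by (rule connected_continuous_image[OF _ connected_G])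
qed

lemma orbit_components_eq: "orbit_components (CH n) Act = (\<lambda>p. orbit_of Act p) ` ball_CH n"
proof -
  have "connected_components_of (subtopology (mtop (riem_manifold (CH n))) (orbit_of Act p)) = {orbit_of Act p}"
    if p: "p \<in> ball_CH n" for p
  proof -
    have sub: "orbit_of Act p \<subseteq> ball_CH n" using orbit_iff[OF p] by auto
    then have top: "subtopology (mtop (riem_manifold (CH n))) (orbit_of Act p) = top_of_set (orbit_of Act p)"
      by (simp add: riem_manifold_dom subtopology_Rn[OF ball_CH_subset] subtopology_subtopology Int_absorb1)
    have ne: "orbit_of Act p \<noteq> {}" using orbit_self[OF p] by blast
    show ?thesis unfolding top
      unfolding connected_components_of_eq_singleton connected_space_top_of_set null_topspace_iff_trivial[symmetric]
        topspace_euclidean_subtopology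
      by (intro conjI orbit_connected[OF p] ne refl)
  qed
  then show ?thesis unfolding orbit_components_def by (simp add: UNION_singleton_eq_range)
qed

end

section \<open>Orbit equivalence determines the Kaehler angle\<close>

lemma abs_le_of_square: "x\<^sup>2 \<le> y\<^sup>2 \<Longrightarrow> 0 \<le> y \<Longrightarrow> \<bar>x\<bar> \<le> y" for x y :: real
  using abs_le_square_iff[of x y] by simp

lemma cmod_diff_square: "(cmod (b - b'))\<^sup>2 = (cmod b)\<^sup>2 + (cmod b')\<^sup>2 - 2 * Re (b * cnj b')"
  unfolding cmod_power2 by (simp add: power2_eq_square algebra_simps)

lemma same_norm_facts:
  assumes b: "(cmod b)\<^sup>2 = R" "(cmod b')\<^sup>2 = R"
  shows "(cmod (b - b'))\<^sup>2 = 2 * R - 2 * Re (b * cnj b')"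
    "(Im (b * cnj b'))\<^sup>2 = R\<^sup>2 - (Re (b * cnj b'))\<^sup>2" "- R \<le> Re (b * cnj b')" "Re (b * cnj b') \<le> R"
proof -
  show "(cmod (b - b'))\<^sup>2 = 2 * R - 2 * Re (b * cnj b')"
    using cmod_diff_square[of b b'] b by linarith
  have "(cmod (b * cnj b'))\<^sup>2 = R\<^sup>2"
    unfolding norm_mult power_mult_distrib complex_mod_cnj b by (rule power2_eq_square[symmetric])
  then show I: "(Im (b * cnj b'))\<^sup>2 = R\<^sup>2 - (Re (b * cnj b'))\<^sup>2"
    unfolding cmod_power2 by linarith
  have "(Re (b * cnj b'))\<^sup>2 \<le> R\<^sup>2" using I zero_le_power2[of "Im (b * cnj b')"] by linarith
  moreover have "0 \<le> R" using b(1) by (metis zero_le_power2)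
  ultimately have "\<bar>Re (b * cnj b')\<bar> \<le> R" by (rule abs_le_of_square)
  then show "- R \<le> Re (b * cnj b')" "Re (b * cnj b') \<le> R" by linarith+
qed

text \<open>The left-hand sides are \<open>4 * h\<^sup>2 * rho\<close> for pairs of nearest points
  on a circle of squared radius \<open>R\<close>, with squared cosine \<open>K\<close>. The
  right-hand sides come from a circle with \<open>h = R = 1\<close> and squared cosine
  \<open>k\<close>: \<open>rho\<close> is 9 for antipodes and \<open>4 + k\<close> at a right angle.
  As \<open>max\<close> limits the antipodes here to the same value 9, \<open>b1\<close> and
  \<open>b2\<close> are antipodal and \<open>R = h\<close>; symmetry puts \<open>b3\<close> at a
  right angle, where \<open>K\<close> can be read off.\<close>

lemma circle_rigidity:
  fixes b1 b2 b3 :: complex and h R k K :: real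
  assumes h: "h > 0" and b: "(cmod b1)\<^sup>2 = R" "(cmod b2)\<^sup>2 = R" "(cmod b3)\<^sup>2 = R"
    and K: "0 \<le> K" "K \<le> 1"
    and max: "(2 * h + 4 * R)\<^sup>2 \<le> 36 * h\<^sup>2"
    and H12: "(2 * h + (cmod (b1 - b2))\<^sup>2)\<^sup>2 + 4 * K * (Im (b1 * cnj b2))\<^sup>2 = 36 * h\<^sup>2"
    and H13: "(2 * h + (cmod (b1 - b3))\<^sup>2)\<^sup>2 + 4 * K * (Im (b1 * cnj b3))\<^sup>2 = 4 * h\<^sup>2 * (4 + k)"
    and H23: "(2 * h + (cmod (b2 - b3))\<^sup>2)\<^sup>2 + 4 * K * (Im (b2 * cnj b3))\<^sup>2 = 4 * h\<^sup>2 * (4 + k)"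
  shows "K = k"
proof -
  have R0: "0 \<le> R" unfolding b(1)[symmetric] by simp
  note nrm = same_norm_facts
  define t where "t = Re (b1 * cnj b2)"
  have Rh: "R \<le> h"
  proof -
    have "(2 * h + 4 * R)\<^sup>2 \<le> (6 * h)\<^sup>2" using max by (simp add: power_mult_distrib)
    then have "2 * h + 4 * R \<le> 6 * h" by (rule power2_le_imp_le) (use h in simp)
    then show ?thesis by simp
  qed
  have E12: "(2 * h + (2 * R - 2 * t))\<^sup>2 + 4 * K * (R\<^sup>2 - t\<^sup>2) = 36 * h\<^sup>2"
    using H12 unfolding nrm(1,2)[OF b(1,2)] t_def .
  have tb: "- R \<le> t" "t \<le> R" using nrm(3,4)[OF b(1,2)] by (simp_all add: t_def)
  \<comment> \<open>With \<open>K\<close> replaced by its bound 1, \<open>E12\<close> becomes the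
    product inequality below, and \<open>R \<le> h\<close> leaves only
    \<open>t = - R\<close>.\<close>
  have "K * (R\<^sup>2 - t\<^sup>2) \<le> 1 * (R\<^sup>2 - t\<^sup>2)"
    using K tb R0 by (intro mult_right_mono) (auto intro: abs_le_square_iff[THEN iffD1])
  then have "9 * h\<^sup>2 \<le> h\<^sup>2 + 2 * ((R - t) * (h + R))"
    using E12 by (simp add: power2_eq_square algebra_simps)
  moreover have "(R + t) * (h + R) \<ge> 0" using tb h R0 by simp
  moreover have "R * (h + R) \<le> h * (h + h)" using Rh R0 h by (intro mult_mono) auto
  ultimately have "(R + t) * (h + R) \<le> 0"
    by (simp add: power2_eq_square algebra_simps)
  then have tR: "t = - R" using tb h R0 by (simp add: mult_le_0_iff)
  have hR: "R = h"
  proof -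
    have "9 * h\<^sup>2 \<le> h\<^sup>2 + 2 * ((R - t) * (h + R))" by fact
    then have "9 * h\<^sup>2 \<le> (h + 2 * R)\<^sup>2" unfolding tR by (simp add: power2_eq_square algebra_simps)
    then have "(3 * h)\<^sup>2 \<le> (h + 2 * R)\<^sup>2" by (simp add: power_mult_distrib)
    then have "3 * h \<le> h + 2 * R" by (rule power2_le_imp_le) (use h R0 in simp)
    then show ?thesis using Rh by simp
  qed
  have "(cmod (b1 - - b2))\<^sup>2 = 0"
    using cmod_diff_square[of b1 "- b2"] b tR by (simp add: t_def)
  then have "b1 + b2 = 0" by simp
  then have b21: "b2 = - b1" by (metis add.commute eq_neg_iff_add_eq_0)
  define s where "s = Re (b1 * cnj b3)"
  have A: "(2 * h + (2 * R - 2 * s))\<^sup>2 + 4 * K * (R\<^sup>2 - s\<^sup>2) = 4 * h\<^sup>2 * (4 + k)"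
    using H13 unfolding nrm(1,2)[OF b(1,3)] s_def .
  have B: "(2 * h + (2 * R + 2 * s))\<^sup>2 + 4 * K * (R\<^sup>2 - s\<^sup>2) = 4 * h\<^sup>2 * (4 + k)"
  proof -
    have e: "Re (b2 * cnj b3) = - s" unfolding b21 s_def by simp
    show ?thesis using H23 unfolding nrm(1,2)[OF b(2,3)] e by simp
  qed
  from A B have "s * (h + R) = 0" by (simp add: power2_eq_square algebra_simps)
  then have "s = 0" using h R0 by simp
  then have "4 * h\<^sup>2 * K = 4 * h\<^sup>2 * k" using A unfolding hR by (simp add: power2_eq_square algebra_simps)
  then show ?thesis using h by simp
qed

text \<open>The point of the distinguished plane with parameter \<open>b\<close>; for
  \<open>al\<^sup>2 + be\<^sup>2 = 1\<close> the parametrisation is isometric.\<close>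

definition pv :: "real \<Rightarrow> real \<Rightarrow> complex \<Rightarrow> nat \<Rightarrow> complex" where
  "pv al be b j = (if j = 1 then complex_of_real al * b else if j = 2 then complex_of_real be * cnj b else 0)"

definition perp :: "real \<Rightarrow> real \<Rightarrow> (nat \<Rightarrow> complex) \<Rightarrow> nat \<Rightarrow> complex" where
  "perp al be \<zeta> j = \<zeta> j - pv al be (zp al be \<zeta>) j"

text \<open>The polarised height inside \<open>rho\<close>, kept separate because its real part
  carries the Euclidean distance of the \<zeta>-parts and its imaginary part the Kaehler
  form.\<close>

definition xi :: "nat \<Rightarrow> (nat \<Rightarrow> real) \<Rightarrow> (nat \<Rightarrow> real) \<Rightarrow> complex" where
  "xi n p q = om p + cnj (om q) - 2 * dot n (ze p) (ze q)"

definition nearest :: "nat \<Rightarrow> (nat \<Rightarrow> real) set \<Rightarrow> (nat \<Rightarrow> real) \<Rightarrow> (nat \<Rightarrow> real) \<Rightarrow> bool" where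
  "nearest n C p x \<longleftrightarrow> x \<in> C \<and> (\<forall>y\<in>C. rho n p x \<le> rho n p y)"

lemma rho_xi: "rho n p q = ((Re (xi n p q))\<^sup>2 + (Im (xi n p q))\<^sup>2) / (4 * ht n p * ht n q)"
  by (simp add: rho_def xi_def[symmetric] cmod_power2)

lemma dot_diff_left: "dot n (\<lambda>j. v j - w j) x = dot n v x - dot n w x"
  by (simp add: dot_def sum_subtractf algebra_simps)

lemma dot_diff_right: "dot n x (\<lambda>j. v j - w j) = dot n x v - dot n x w"
  by (simp add: dot_def sum_subtractf algebra_simps)

lemma Re_dot_commute: "Re (dot n v w) = Re (dot n w v)" and Im_dot_commute: "Im (dot n v w) = - Im (dot n w v)"
  by (metis complex_cnj cnj.sel dot_cnj)+

text \<open>Completing the square: besides the heights only the squared Euclidean distance of the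
  \<zeta>-parts remains.\<close>

lemma Re_xi: "Re (xi n p q) = ht n p + ht n q + Re (dot n (\<lambda>j. ze p j - ze q j) (\<lambda>j. ze p j - ze q j))"
  unfolding dot_diff_left dot_diff_right
  using Re_dot_commute[of n "ze q" "ze p"] by (simp add: xi_def ht_def)

section \<open>Nearest points on an orbit\<close>

context polar_family
begin

lemma dot_pv: "dot n (pv al be b) v = calbe al * b * cnj (v 1) + calbe be * cnj b * cnj (v 2)"
proof -
  have "dot n (pv al be b) v = (\<Sum>j\<in>{1, 2}. pv al be b j * cnj (v j))"
    unfolding dot_def by (rule sum.mono_neutral_right) (use n3 in \<open>auto simp: pv_def\<close>)
  then show ?thesis by (simp add: pv_def)
qed

lemma Re_dot_pv: "Re (dot n (pv al be b) v) = Re (b * cnj (zp al be v))"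
  by (simp add: dot_pv zp_def algebra_simps)

lemma zp_pv: "zp al be (pv al be b) = b"
proof -
  have "zp al be (pv al be b) = (calbe al * calbe al + calbe be * calbe be) * b"
    by (simp add: zp_def pv_def algebra_simps)
  then show ?thesis by (simp add: albe_c)
qed

lemma zp_add: "zp al be (\<lambda>j. v j + w j) = zp al be v + zp al be w"
  and zp_diff: "zp al be (\<lambda>j. v j - w j) = zp al be v - zp al be w"
  by (simp_all add: zp_def algebra_simps)

lemma zp_perp: "zp al be (perp al be v) = 0"
  unfolding perp_def[abs_def] zp_diff zp_pv by simp

text \<open>This is where the angle enters: the imaginary part of the Hermitian product is the
  Kaehler form, which on the plane is a multiple of the area form.\<close>

lemma Im_dot_pv_pv: "Im (dot n (pv al be b) (pv al be b')) = (al\<^sup>2 - be\<^sup>2) * Im (b * cnj b')"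
  by (simp add: dot_pv pv_def power2_eq_square algebra_simps)

lemma dot_plane_split:
  assumes v: "\<And>j. 1 \<le> j \<Longrightarrow> j < n \<Longrightarrow> v j = pv al be b j + w j" and w: "zp al be w = 0"
  shows "Re (dot n v v) = (cmod b)\<^sup>2 + Re (dot n w w)"
proof -
  have "dot n v v = dot n (\<lambda>j. pv al be b j + w j) (\<lambda>j. pv al be b j + w j)"
    by (rule dot_cong) (simp_all add: v)
  also have "Re \<dots> = Re (dot n (pv al be b) (pv al be b)) + 2 * Re (dot n (pv al be b) w) + Re (dot n w w)"
    unfolding dot_add_left dot_add_right using Re_dot_commute[of n w "pv al be b"] by simp
  finally show ?thesis
    unfolding Re_dot_pv zp_pv w cmod_power2 by (simp add: power2_eq_square)
qed

text \<open>The squared distance between the parts of \<zeta> orthogonal to the plane, which are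
  free to vary along an orbit.\<close>

definition pgap :: "(nat \<Rightarrow> real) \<Rightarrow> (nat \<Rightarrow> real) \<Rightarrow> real" where
  "pgap p q = Re (dot n (\<lambda>j. perp al be (ze p) j - perp al be (ze q) j)
     (\<lambda>j. perp al be (ze p) j - perp al be (ze q) j))"

lemma Re_xi_split: "Re (xi n p q) = ht n p + ht n q + (cmod (zp al be (ze p) - zp al be (ze q)))\<^sup>2 + pgap p q"
proof -
  have "Re (dot n (\<lambda>j. ze p j - ze q j) (\<lambda>j. ze p j - ze q j)) =
     (cmod (zp al be (ze p) - zp al be (ze q)))\<^sup>2 + pgap p q"
    unfolding pgap_def
  proof (rule dot_plane_split)
    show "ze p j - ze q j = pv al be (zp al be (ze p) - zp al be (ze q)) j
       + (perp al be (ze p) j - perp al be (ze q) j)" for j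
      by (simp add: perp_def pv_def algebra_simps)
    show "zp al be (\<lambda>j. perp al be (ze p) j - perp al be (ze q) j) = 0"
      unfolding zp_diff zp_perp by simp
  qed
  then show ?thesis unfolding Re_xi by simp
qed

lemma pgap_ge_0: "0 \<le> pgap p q"
  unfolding pgap_def by (rule dot_self_ge_0)

lemma ex_siegel_point:
  assumes "0 < h"
  shows "\<exists>y\<in>ball_CH n. ht n y = h \<and> Im (om y) = s \<and> (\<forall>j. 1 \<le> j \<and> j < n \<longrightarrow> ze y j = \<zeta> j)"
proof
  define w where "w = Complex (h + Re (dot n \<zeta> \<zeta>)) s"
  have w: "Re (dot n \<zeta> \<zeta>) < Re w" using assms by (simp add: w_def)
  show y: "of_siegel n w \<zeta> \<in> ball_CH n" by (rule of_siegel_in_ball[OF w n0])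
  have o: "om (of_siegel n w \<zeta>) = w" by (rule om_of_siegel[OF siegel_nz[OF w] n0])
  have z: "ze (of_siegel n w \<zeta>) j = \<zeta> j" if "1 \<le> j" "j < n" for j
    by (rule ze_of_siegel[OF siegel_nz[OF w] n0 that(2,1)])
  have "dot n (ze (of_siegel n w \<zeta>)) (ze (of_siegel n w \<zeta>)) = dot n \<zeta> \<zeta>"
    by (rule dot_cong) (simp_all add: z)
  then show "ht n (of_siegel n w \<zeta>) = h \<and> Im (om (of_siegel n w \<zeta>)) = s \<and>
      (\<forall>j. 1 \<le> j \<and> j < n \<longrightarrow> ze (of_siegel n w \<zeta>) j = \<zeta> j)"
    by (simp add: ht_def o z) (simp add: w_def)
qed

lemma zp_cong: "\<zeta> 1 = \<zeta>' 1 \<Longrightarrow> \<zeta> 2 = \<zeta>' 2 \<Longrightarrow> zp al be \<zeta> = zp al be \<zeta>'"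
  by (simp add: zp_def)

text \<open>An orbit fixes only the height and the norm of the plane component, so the orthogonal
  part of \<zeta> can be copied from \<open>p\<close>, and the imaginary part of \<omega> chosen to
  make \<open>xi n p y\<close> real.\<close>

lemma ex_orbit_candidate:
  assumes p: "p \<in> ball_CH n" and q: "q \<in> ball_CH n" and b: "cmod b = cmod (zp al be (ze q))"
  shows "\<exists>y\<in>orbit_of Act q. zp al be (ze y) = b \<and> pgap p y = 0 \<and> Im (xi n p y) = 0"
proof -
  define \<zeta> where "\<zeta> j = pv al be b j + perp al be (ze p) j" for j
  define s where "s = Im (om p) - 2 * Im (dot n (ze p) \<zeta>)"
  obtain y where y: "y \<in> ball_CH n" "ht n y = ht n q" "Im (om y) = s"
    and zy: "\<And>j. 1 \<le> j \<Longrightarrow> j < n \<Longrightarrow> ze y j = \<zeta> j"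
    using ex_siegel_point[OF ht_pos[OF q n0], of s \<zeta>] by blast
  have "zp al be (ze y) = zp al be \<zeta>"
    by (rule zp_cong) (use zy n3 in auto)
  also have "\<dots> = b" unfolding \<zeta>_def[abs_def] zp_add zp_pv zp_perp by simp
  finally have zpy: "zp al be (ze y) = b" .
  have pe: "perp al be (ze y) j = perp al be (ze p) j" if "1 \<le> j" "j < n" for j
    unfolding perp_def[of al be "ze y"] zpy using zy[OF that] by (simp add: \<zeta>_def)
  have "pgap p y = Re (dot n (\<lambda>_. 0) (\<lambda>_. 0))"
    unfolding pgap_def by (rule arg_cong[of _ _ Re], rule dot_cong) (simp_all add: pe)
  then have "pgap p y = 0" by (simp add: dot_def)
  moreover have "dot n (ze p) (ze y) = dot n (ze p) \<zeta>" by (rule dot_cong) (simp_all add: zy)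
  then have "Im (xi n p y) = 0" by (simp add: xi_def y(3) s_def)
  moreover have "y \<in> orbit_of Act q" using y zpy b by (simp add: orbit_iff[OF q])
  ultimately show ?thesis using zpy by blast
qed

lemma rho_candidate:
  assumes "pgap p y = 0" "Im (xi n p y) = 0"
  shows "rho n p y = (ht n p + ht n y + (cmod (zp al be (ze p) - zp al be (ze y)))\<^sup>2)\<^sup>2 / (4 * ht n p * ht n y)"
  unfolding rho_xi Re_xi_split assms by simp

text \<open>Comparison with the candidate that shares the plane component of \<open>x\<close> forces
  the gap and the imaginary part to vanish. Comparison with the other candidates shows that this
  component is nearest on its circle.\<close>

lemma nearest_props:
  assumes p: "p \<in> ball_CH n" and q: "q \<in> ball_CH n" and x: "nearest n (orbit_of Act q) p x"
  shows "x \<in> ball_CH n" "ht n x = ht n q" "cmod (zp al be (ze x)) = cmod (zp al be (ze q))"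
    and "pgap p x = 0" and "Im (xi n p x) = 0"
    and "cmod b = cmod (zp al be (ze q)) \<Longrightarrow> cmod (zp al be (ze p) - zp al be (ze x)) \<le> cmod (zp al be (ze p) - b)"
proof -
  have xo: "x \<in> orbit_of Act q" and le: "\<And>y. y \<in> orbit_of Act q \<Longrightarrow> rho n p x \<le> rho n p y"
    using x by (auto simp: nearest_def)
  show xb: "x \<in> ball_CH n" and hx: "ht n x = ht n q" and zx: "cmod (zp al be (ze x)) = cmod (zp al be (ze q))"
    using xo orbit_iff[OF q] by auto
  have hp: "0 < ht n p" "0 < ht n q" using ht_pos n0 p q by auto
  define S where "S b = ht n p + ht n q + (cmod (zp al be (ze p) - b))\<^sup>2" for b
  have S: "0 < S b" for b using hp by (simp add: S_def add_pos_nonneg)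
  have main: "(S (zp al be (ze x)) + pgap p x)\<^sup>2 + (Im (xi n p x))\<^sup>2 \<le> (S b)\<^sup>2"
    if b: "cmod b = cmod (zp al be (ze q))" for b
  proof -
    obtain y where y: "y \<in> orbit_of Act q" "zp al be (ze y) = b" "pgap p y = 0" "Im (xi n p y) = 0"
      using ex_orbit_candidate[OF p q b] by blast
    have hy: "ht n y = ht n q" using y(1) orbit_iff[OF q] by blast
    have "rho n p y = (S b)\<^sup>2 / (4 * ht n p * ht n q)"
      unfolding rho_candidate[OF y(3,4)] hy y(2) S_def ..
    moreover have "rho n p x = ((S (zp al be (ze x)) + pgap p x)\<^sup>2 + (Im (xi n p x))\<^sup>2) / (4 * ht n p * ht n q)"
      unfolding rho_xi Re_xi_split hx S_def ..
    ultimately show ?thesis using le[OF y(1)] hp by (simp add: divide_le_cancel)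
  qed
  have g: "0 \<le> pgap p x" by (rule pgap_ge_0)
  have m: "(S (zp al be (ze x)) + pgap p x)\<^sup>2 + (Im (xi n p x))\<^sup>2 \<le> (S (zp al be (ze x)))\<^sup>2"
    by (rule main[OF zx])
  have "(S (zp al be (ze x)))\<^sup>2 \<le> (S (zp al be (ze x)) + pgap p x)\<^sup>2"
    using S[of "zp al be (ze x)"] g by (intro power_mono) auto
  then have "(Im (xi n p x))\<^sup>2 \<le> 0" "(S (zp al be (ze x)) + pgap p x)\<^sup>2 \<le> (S (zp al be (ze x)))\<^sup>2"
    using m zero_le_power2[of "Im (xi n p x)"] by linarith+
  then show i: "Im (xi n p x) = 0" and "pgap p x = 0"
    using g S[of "zp al be (ze x)"] power2_le_imp_le[of "S (zp al be (ze x)) + pgap p x" "S (zp al be (ze x))"]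
    by (simp, linarith)
  then have s: "(S (zp al be (ze x)))\<^sup>2 \<le> (S b)\<^sup>2" if "cmod b = cmod (zp al be (ze q))" for b
    using main[OF that] by simp
  show "cmod (zp al be (ze p) - zp al be (ze x)) \<le> cmod (zp al be (ze p) - b)"
    if "cmod b = cmod (zp al be (ze q))"
  proof -
    have "S (zp al be (ze x)) \<le> S b" using power2_le_imp_le[OF s[OF that]] S[of b] by simp
    then have "(cmod (zp al be (ze p) - zp al be (ze x)))\<^sup>2 \<le> (cmod (zp al be (ze p) - b))\<^sup>2" by (simp add: S_def)
    then show ?thesis by (rule power2_le_imp_le) simp
  qed
qed

text \<open>From the centre of the circle all its points are equally far, so every candidate is a
  nearest point.\<close>

lemma nearest_exists:
  assumes p: "p \<in> ball_CH n" and q: "q \<in> ball_CH n" and a: "zp al be (ze p) = 0"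
    and b: "cmod b = cmod (zp al be (ze q))"
  shows "\<exists>x. nearest n (orbit_of Act q) p x \<and> zp al be (ze x) = b"
proof -
  obtain y where y: "y \<in> orbit_of Act q" "zp al be (ze y) = b" "pgap p y = 0" "Im (xi n p y) = 0"
    using ex_orbit_candidate[OF p q b] by blast
  have hp: "0 < ht n p" "0 < ht n q" using ht_pos n0 p q by auto
  have "rho n p y \<le> rho n p x" if x: "x \<in> orbit_of Act q" for x
  proof -
    have hx: "ht n x = ht n q" "cmod (zp al be (ze x)) = cmod b" and hy: "ht n y = ht n q"
      using x y(1) orbit_iff[OF q] b by auto
    have "(ht n p + ht n q + (cmod b)\<^sup>2)\<^sup>2 \<le> (ht n p + ht n q + (cmod b)\<^sup>2 + pgap p x)\<^sup>2"
      using hp pgap_ge_0[of p x] by (intro power_mono) auto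
    then have "(ht n p + ht n q + (cmod b)\<^sup>2)\<^sup>2 \<le> (ht n p + ht n q + (cmod b)\<^sup>2 + pgap p x)\<^sup>2 + (Im (xi n p x))\<^sup>2"
      by (simp add: add_increasing2)
    then show ?thesis
      unfolding rho_candidate[OF y(3,4)] rho_xi[of n p x] Re_xi_split[of p x] a hx(1) hy y(2)
      using hp hx(2) by (simp add: divide_right_mono)
  qed
  then show ?thesis using y by (auto simp: nearest_def)
qed

lemma perp_eq:
  assumes "pgap p x = 0" "1 \<le> j" "j < n"
  shows "ze x j = pv al be (zp al be (ze x)) j + perp al be (ze p) j"
proof -
  have "perp al be (ze p) j - perp al be (ze x) j = 0"
    using dot_self_eq_0[OF assms(1)[unfolded pgap_def] assms(2,3)] .
  then show ?thesis by (simp add: perp_def algebra_simps)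
qed

text \<open>From a point other than the centre, a circle has one nearest point, and this determines
  the remaining coordinates. The contrapositive detects the singular orbits.\<close>

lemma nearest_unique:
  assumes p: "p \<in> ball_CH n" and q: "q \<in> ball_CH n" and a: "zp al be (ze p) \<noteq> 0"
    and x: "nearest n (orbit_of Act q) p x" "nearest n (orbit_of Act q) p x'"
  shows "x = x'"
proof -
  define a0 where "a0 = zp al be (ze p)"
  define r where "r = cmod (zp al be (ze q))"
  \<comment> \<open>The radial projection of \<open>a0\<close> to the circle of radius
    \<open>r\<close>.\<close>
  define b0 where "b0 = calbe r * (a0 / calbe (cmod a0))"
  have a0: "cmod a0 \<noteq> 0" using a by (simp add: a0_def)
  have b0: "cmod b0 = r" using a0 by (simp add: b0_def r_def norm_mult norm_divide)
  have key: "zp al be (ze x) = b0" if x: "nearest n (orbit_of Act q) p x" for x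
  proof -
    note N = nearest_props[OF p q x]
    define b where "b = zp al be (ze x)"
    have "cmod (a0 - b) \<le> cmod (a0 - b0)" using N(6)[of b0] b0 by (simp add: a0_def b_def r_def)
    then have "(cmod (a0 - b))\<^sup>2 \<le> (cmod (a0 - b0))\<^sup>2" by (simp add: power_mono)
    moreover have e: "(cmod (a0 - c))\<^sup>2 = (cmod a0)\<^sup>2 + r\<^sup>2 - 2 * Re (a0 * cnj c)" if "cmod c = r" for c
    proof -
      have "(cmod (a0 - c))\<^sup>2 = (cmod a0)\<^sup>2 + (cmod c)\<^sup>2 - 2 * Re (a0 * cnj c)"
        unfolding cmod_power2 by (simp add: power2_eq_square algebra_simps)
      then show ?thesis using that by simp
    qed
    moreover have br: "cmod b = r" using N(3) by (simp add: b_def r_def)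
    ultimately have "Re (a0 * cnj b0) \<le> Re (a0 * cnj b)" using b0 by simp
    moreover have "a0 * cnj b0 = calbe (r * cmod a0)"
    proof -
      have "a0 * cnj b0 = calbe r * (a0 * cnj a0) / calbe (cmod a0)" by (simp add: b0_def)
      also have "a0 * cnj a0 = calbe ((cmod a0)\<^sup>2)" using complex_norm_square by simp
      finally show ?thesis using a0 by (simp add: power2_eq_square)
    qed
    ultimately have "r * cmod a0 \<le> Re (a0 * cnj b)" by simp
    moreover have "b0 * cnj b = calbe (r / cmod a0) * (a0 * cnj b)" by (simp add: b0_def)
    then have "Re (b0 * cnj b) = r / cmod a0 * Re (a0 * cnj b)" by simp
    moreover have "0 \<le> r / cmod a0" by (simp add: r_def)
    ultimately have "r / cmod a0 * (r * cmod a0) \<le> Re (b0 * cnj b)"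
      by (metis mult_left_mono)
    then have "r\<^sup>2 \<le> Re (b0 * cnj b)" using a0 by (simp add: power2_eq_square)
    moreover have "(cmod (b0 - b))\<^sup>2 = (cmod b0)\<^sup>2 + (cmod b)\<^sup>2 - 2 * Re (b0 * cnj b)"
      unfolding cmod_power2 by (simp add: power2_eq_square algebra_simps)
    ultimately have "(cmod (b0 - b))\<^sup>2 \<le> 0" using b0 br by simp
    then show ?thesis by (simp add: b_def)
  qed
  note N = nearest_props[OF p q x(1)] and N' = nearest_props[OF p q x(2)]
  have z: "ze x j = ze x' j" if "1 \<le> j" "j < n" for j
    unfolding perp_eq[OF N(4) that] perp_eq[OF N'(4) that] key[OF x(1)] key[OF x(2)] ..
  have d: "dot n (ze p) (ze x) = dot n (ze p) (ze x')" "dot n (ze x) (ze x) = dot n (ze x') (ze x')"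
    by (rule dot_cong; simp add: z)+
  show ?thesis
  proof (rule siegel_eqI[OF N(1) N'(1) n0 _ z])
    show "om x = om x'"
    proof (rule complex_eqI)
      show "Re (om x) = Re (om x')" using N(2) N'(2) d(2) by (simp add: ht_def)
      show "Im (om x) = Im (om x')" using N(5) N'(5) d(1) by (simp add: xi_def)
    qed
  qed
qed

text \<open>The nearest points form a circle in the distinguished plane; distances between its
  points see the Kaehler angle of the plane, whose cosine is \<open>al\<^sup>2 - be\<^sup>2\<close>.\<close>

lemma rho_nearest_pair:
  assumes p: "p \<in> ball_CH n" and q: "q \<in> ball_CH n" and a: "zp al be (ze p) = 0"
    and x: "nearest n (orbit_of Act q) p x" and x': "nearest n (orbit_of Act q) p x'"
  defines "b \<equiv> zp al be (ze x)" and "b' \<equiv> zp al be (ze x')"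
  shows "4 * (ht n q)\<^sup>2 * rho n x x' = (2 * ht n q + (cmod (b - b'))\<^sup>2)\<^sup>2
     + 4 * (al\<^sup>2 - be\<^sup>2)\<^sup>2 * (Im (b * cnj b'))\<^sup>2"
proof -
  note N = nearest_props[OF p q x] and N' = nearest_props[OF p q x']
  define P where "P = perp al be (ze p)"
  have zx: "ze x j = pv al be b j + P j" "ze x' j = pv al be b' j + P j" if "1 \<le> j" "j < n" for j
    using perp_eq[OF N(4) that] perp_eq[OF N'(4) that] by (simp_all add: P_def b_def b'_def)
  have zpp: "ze p j = P j" for j by (simp add: P_def perp_def a pv_def)
  have "Re (dot n (\<lambda>j. ze x j - ze x' j) (\<lambda>j. ze x j - ze x' j)) = (cmod (b - b'))\<^sup>2 + Re (dot n (\<lambda>_. 0) (\<lambda>_. 0))"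
    by (rule dot_plane_split) (simp_all add: zx pv_def zp_def algebra_simps)
  then have re: "Re (xi n x x') = 2 * ht n q + (cmod (b - b'))\<^sup>2"
    unfolding Re_xi N(2) N'(2) by (simp add: dot_def)
  have d1: "dot n (ze p) (ze x) = dot n P (\<lambda>j. pv al be b j + P j)"
    "dot n (ze p) (ze x') = dot n P (\<lambda>j. pv al be b' j + P j)"
    by (rule dot_cong; simp add: zx zpp)+
  have d2: "dot n (ze x) (ze x') = dot n (\<lambda>j. pv al be b j + P j) (\<lambda>j. pv al be b' j + P j)"
    by (rule dot_cong) (simp_all add: zx)
  have "Im (om x) = Im (om p) - 2 * Im (dot n P (pv al be b))" "Im (om x') = Im (om p) - 2 * Im (dot n P (pv al be b'))"
    using N(5) N'(5) unfolding xi_def d1 dot_add_right by simp_all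
  note io = this
  define w where "w = (al\<^sup>2 - be\<^sup>2) * Im (b * cnj b')"
  have "Im (dot n (pv al be b) (pv al be b')) = w" unfolding w_def by (rule Im_dot_pv_pv)
  \<comment> \<open>The mixed terms with \<open>P\<close> cancel against those in the imaginary
    parts of \<omega>, which leaves the Kaehler form of the plane.\<close>
  then have "Im (xi n x x') = - 2 * w"
    unfolding xi_def d2 dot_add_left dot_add_right
    using io Im_dot_commute[of n "pv al be b" P] by simp
  then have im: "Im (xi n x x') = - 2 * ((al\<^sup>2 - be\<^sup>2) * Im (b * cnj b'))" by (simp only: w_def)
  have h: "0 < ht n q" by (rule ht_pos[OF q n0])
  show ?thesis
    unfolding rho_xi re im N(2) N'(2) using h by (simp add: power2_eq_square field_simps)
qed

end

text \<open>Only \<open>rho\<close>, orbits and nearest points are used, all of which the isometry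
  transports. The image configuration satisfies \<open>circle_rigidity\<close> with the squared
  cosines as \<open>K\<close> and \<open>k\<close>; positivity of the cosines removes the
  squares.\<close>

lemma orbit_equivalent_imp_angle_eq:
  assumes A: "polar_family n al be" and B: "polar_family n al' be'"
    and k: "0 < al\<^sup>2 - be\<^sup>2" "al\<^sup>2 - be\<^sup>2 \<le> 1" "0 < al'\<^sup>2 - be'\<^sup>2" "al'\<^sup>2 - be'\<^sup>2 \<le> 1"
    and eq: "orbit_equivalent (CH n) (Gact n al be) (CH n) (Gact n al' be')"
  shows "al\<^sup>2 - be\<^sup>2 = al'\<^sup>2 - be'\<^sup>2"
proof -
  interpret A: polar_family n al be by (rule A)
  interpret B: polar_family n al' be' by (rule B)
  obtain f where f: "isometry (CH n) (CH n) f"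
    and oc: "(\<lambda>C. f ` C) ` orbit_components (CH n) (Gact n al be) = orbit_components (CH n) (Gact n al' be')"
    using eq unfolding orbit_equivalent_def by blast
  have bij: "bij_betw f (ball_CH n) (ball_CH n)" using f unfolding isometry_def by blast
  have fb: "f z \<in> ball_CH n" if "z \<in> ball_CH n" for z using bij that bij_betwE by blast
  have inj: "inj_on f (ball_CH n)" using bij by (rule bij_betw_imp_inj_on)
  note rho = isometry_rho[OF A.n0 f]
  have orb: "f ` orbit_of A.Act q = orbit_of B.Act (f q)" if q: "q \<in> ball_CH n" for q
  proof -
    have "f ` orbit_of A.Act q \<in> (\<lambda>p. orbit_of B.Act p) ` ball_CH n"
      using oc q unfolding A.orbit_components_eq B.orbit_components_eq by blast
    then obtain p where p: "p \<in> ball_CH n" "f ` orbit_of A.Act q = orbit_of B.Act p" by blast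
    have "f q \<in> orbit_of B.Act p" using p(2) A.orbit_self[OF q] by blast
    then have "orbit_of B.Act (f q) = orbit_of B.Act p"
      using B.orbit_iff[OF p(1)] B.orbit_iff[OF fb[OF q]] by auto
    then show ?thesis using p(2) by simp
  qed
  define p where "p = (\<lambda>_::nat. 0::real)"
  have p: "p \<in> ball_CH n" unfolding p_def by (rule zero_in_ball)
  have ap: "zp al be (ze p) = 0" by (simp add: p_def siegel_origin zp_def)
  \<comment> \<open>Height 1 and plane component 1 give \<open>h = R = 1\<close> on this
    side.\<close>
  obtain q where q: "q \<in> ball_CH n" "ht n q = 1" and zq: "\<And>j. 1 \<le> j \<Longrightarrow> j < n \<Longrightarrow> ze q j = pv al be 1 j"
    using A.ex_siegel_point[of 1 0 "pv al be 1"] by auto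
  have "zp al be (ze q) = zp al be (pv al be 1)"
    by (rule A.zp_cong) (use zq A.n3 in auto)
  then have bq: "zp al be (ze q) = 1" by (simp add: A.zp_pv)
  have nimg: "nearest n (orbit_of B.Act (f q)) (f p) (f x)" if x: "nearest n (orbit_of A.Act q) p x" for x
  proof -
    have sub: "orbit_of A.Act q \<subseteq> ball_CH n" using A.orbit_iff[OF q(1)] by blast
    have xo: "x \<in> orbit_of A.Act q" using x by (simp add: nearest_def)
    have "rho n (f p) (f x) \<le> rho n (f p) (f z)" if z: "z \<in> orbit_of A.Act q" for z
      using x z unfolding rho[OF p subsetD[OF sub xo]] rho[OF p subsetD[OF sub z]] nearest_def by blast
    then show ?thesis
      unfolding nearest_def orb[OF q(1), symmetric] using xo by blast
  qed
  have npre: "\<exists>x. nearest n (orbit_of A.Act q) p x \<and> f x = y" if y: "nearest n (orbit_of B.Act (f q)) (f p) y" for y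
  proof -
    have sub: "orbit_of A.Act q \<subseteq> ball_CH n" using A.orbit_iff[OF q(1)] by blast
    obtain x where x: "x \<in> orbit_of A.Act q" "y = f x"
      using y unfolding nearest_def orb[OF q(1), symmetric] by blast
    have "rho n p x \<le> rho n p z" if z: "z \<in> orbit_of A.Act q" for z
    proof -
      have "rho n (f p) (f x) \<le> rho n (f p) (f z)"
        using y z unfolding x(2) nearest_def orb[OF q(1), symmetric] by blast
      then show ?thesis unfolding rho[OF p subsetD[OF sub x(1)]] rho[OF p subsetD[OF sub z]] .
    qed
    then show ?thesis using x unfolding nearest_def by blast
  qed
  define k where "k = al\<^sup>2 - be\<^sup>2"
  have k01: "0 < k" "k \<le> 1" using k(1,2) by (simp_all add: k_def)
  then have k2: "k\<^sup>2 \<le> 1" by (intro power_le_one) auto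
  have pairA: "4 * rho n x x' = (2 + (cmod (zp al be (ze x) - zp al be (ze x')))\<^sup>2)\<^sup>2
      + 4 * k\<^sup>2 * (Im (zp al be (ze x) * cnj (zp al be (ze x'))))\<^sup>2"
    if "nearest n (orbit_of A.Act q) p x" "nearest n (orbit_of A.Act q) p x'" for x x'
    using A.rho_nearest_pair[OF p q(1) ap that] unfolding k_def by (simp add: q(2))
  \<comment> \<open>No pair of nearest points exceeds the value of an antipodal pair;
    \<open>k\<^sup>2 \<le> 1\<close> reduces this to \<open>20 - 16 * c \<le> 36\<close>.\<close>
  have maxA: "rho n x x' \<le> 9"
    if x: "nearest n (orbit_of A.Act q) p x" "nearest n (orbit_of A.Act q) p x'" for x x'
  proof -
    define b b' where "b = zp al be (ze x)" and "b' = zp al be (ze x')"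
    have n1: "cmod b = 1" "cmod b' = 1"
      using A.nearest_props(3)[OF p q(1) x(1)] A.nearest_props(3)[OF p q(1) x(2)] by (simp_all add: b_def b'_def bq)
    define c where "c = Re (b * cnj b')"
    have "(cmod (b - b'))\<^sup>2 = (cmod b)\<^sup>2 + (cmod b')\<^sup>2 - 2 * c"
      unfolding cmod_power2 c_def by (simp add: power2_eq_square algebra_simps)
    then have 1: "(cmod (b - b'))\<^sup>2 = 2 - 2 * c" using n1 by simp
    have "(cmod (b * cnj b'))\<^sup>2 = 1" using n1 by (simp add: norm_mult)
    then have 2: "(Im (b * cnj b'))\<^sup>2 = 1 - c\<^sup>2" unfolding cmod_power2 c_def by linarith
    have "c\<^sup>2 \<le> 1" using 2 by (metis diff_ge_0_iff_ge zero_le_power2)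
    then have c: "-1 \<le> c" by (simp add: abs_square_le_1 abs_le_iff)
    have "k\<^sup>2 * (1 - c\<^sup>2) \<le> 1 * (1 - c\<^sup>2)" using k2 \<open>c\<^sup>2 \<le> 1\<close> by (intro mult_right_mono) auto
    moreover have "4 * rho n x x' = (2 + (2 - 2 * c))\<^sup>2 + 4 * (k\<^sup>2 * (1 - c\<^sup>2))"
      using pairA[OF x] unfolding b_def[symmetric] b'_def[symmetric] 1 2 by simp
    ultimately have "4 * rho n x x' \<le> (4 - 2 * c)\<^sup>2 + 4 * (1 - c\<^sup>2)" by simp
    also have "\<dots> = 20 - 16 * c" by (simp add: power2_eq_square algebra_simps)
    finally show ?thesis using c by simp
  qed
  obtain x1 where x1: "nearest n (orbit_of A.Act q) p x1" "zp al be (ze x1) = 1"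
    using A.nearest_exists[OF p q(1) ap, of 1] bq by auto
  obtain x2 where x2: "nearest n (orbit_of A.Act q) p x2" "zp al be (ze x2) = - 1"
    using A.nearest_exists[OF p q(1) ap, of "- 1"] bq by auto
  obtain x3 where x3: "nearest n (orbit_of A.Act q) p x3" "zp al be (ze x3) = \<i>"
    using A.nearest_exists[OF p q(1) ap, of "\<i>"] bq by auto
  have r12: "rho n x1 x2 = 9" using pairA[OF x1(1) x2(1)] unfolding x1(2) x2(2) by simp
  have r13: "rho n x1 x3 = 4 + k\<^sup>2" using pairA[OF x1(1) x3(1)] unfolding x1(2) x3(2) by (simp add: cmod_power2)
  have r23: "rho n x2 x3 = 4 + k\<^sup>2" using pairA[OF x2(1) x3(1)] unfolding x2(2) x3(2) by (simp add: cmod_power2)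
  have xb: "x1 \<in> ball_CH n" "x2 \<in> ball_CH n" "x3 \<in> ball_CH n"
    using A.nearest_props(1)[OF p q(1)] x1(1) x2(1) x3(1) by blast+
  \<comment> \<open>Two distinct nearest points force \<open>f p\<close> onto a singular
    orbit.\<close>
  have "x1 \<noteq> x2" using x1(2) x2(2) by auto
  then have "f x1 \<noteq> f x2" using inj xb by (auto dest: inj_onD)
  then have a': "zp al' be' (ze (f p)) = 0"
    using B.nearest_unique[OF fb[OF p] fb[OF q(1)] _ nimg[OF x1(1)] nimg[OF x2(1)]] by blast
  define h where "h = ht n (f q)"
  define K where "K = (al'\<^sup>2 - be'\<^sup>2)\<^sup>2"
  define R where "R = (cmod (zp al' be' (ze (f q))))\<^sup>2"
  have h: "0 < h" unfolding h_def by (rule ht_pos[OF fb[OF q(1)] B.n0])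
  note pairB = B.rho_nearest_pair[OF fb[OF p] fb[OF q(1)] a', folded h_def K_def]
  have nB: "(cmod (zp al' be' (ze y)))\<^sup>2 = R" if "nearest n (orbit_of B.Act (f q)) (f p) y" for y
    using B.nearest_props(3)[OF fb[OF p] fb[OF q(1)] that] by (simp add: R_def)
  define b1 where "b1 = zp al' be' (ze (f x1))"
  have nb1: "cmod (- b1) = cmod (zp al' be' (ze (f q)))"
    using B.nearest_props(3)[OF fb[OF p] fb[OF q(1)] nimg[OF x1(1)]] by (simp add: b1_def)
  obtain y where y: "nearest n (orbit_of B.Act (f q)) (f p) y" "zp al' be' (ze y) = - b1"
    using B.nearest_exists[OF fb[OF p] fb[OF q(1)] a' nb1] by blast
  \<comment> \<open>The antipode \<open>y\<close> of \<open>f x1\<close> on the second circle is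
    pulled back along \<open>f\<close>, so that \<open>maxA\<close> limits the diameter of that
    circle as well.\<close>
  obtain x where x: "nearest n (orbit_of A.Act q) p x" "f x = y" using npre[OF y(1)] by blast
  have "rho n (f x1) y \<le> 9"
    using maxA[OF x1(1) x(1)] rho[OF xb(1) A.nearest_props(1)[OF p q(1) x(1)]] x(2) by simp
  then have le9: "4 * h\<^sup>2 * rho n (f x1) y \<le> 4 * h\<^sup>2 * 9" by (intro mult_left_mono) auto
  have mx: "(2 * h + 4 * R)\<^sup>2 \<le> 36 * h\<^sup>2"
  proof -
    have e: "b1 - - b1 = 2 * b1" "Im (b1 * cnj (- b1)) = 0" by simp_all
    have "(cmod (2 * b1))\<^sup>2 = 4 * R"
      using nB[OF nimg[OF x1(1)]] by (simp add: norm_mult power_mult_distrib b1_def)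
    then have "4 * h\<^sup>2 * rho n (f x1) y = (2 * h + 4 * R)\<^sup>2"
      using pairB[OF nimg[OF x1(1)] y(1)] unfolding y(2) b1_def[symmetric] e by simp
    then show ?thesis using le9 by simp
  qed
  have "K = k\<^sup>2"
  proof (rule circle_rigidity[OF h nB[OF nimg[OF x1(1)]] nB[OF nimg[OF x2(1)]] nB[OF nimg[OF x3(1)]] _ _ mx])
    show "0 \<le> K" by (simp add: K_def)
    show "K \<le> 1" using k(3,4) unfolding K_def by (intro power_le_one) auto
    show "(2 * h + (cmod (zp al' be' (ze (f x1)) - zp al' be' (ze (f x2))))\<^sup>2)\<^sup>2
        + 4 * K * (Im (zp al' be' (ze (f x1)) * cnj (zp al' be' (ze (f x2)))))\<^sup>2 = 36 * h\<^sup>2"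
      unfolding pairB[OF nimg[OF x1(1)] nimg[OF x2(1)], symmetric] rho[OF xb(1,2)] r12 by simp
    show "(2 * h + (cmod (zp al' be' (ze (f x1)) - zp al' be' (ze (f x3))))\<^sup>2)\<^sup>2
        + 4 * K * (Im (zp al' be' (ze (f x1)) * cnj (zp al' be' (ze (f x3)))))\<^sup>2 = 4 * h\<^sup>2 * (4 + k\<^sup>2)"
      unfolding pairB[OF nimg[OF x1(1)] nimg[OF x3(1)], symmetric] rho[OF xb(1,3)] r13 ..
    show "(2 * h + (cmod (zp al' be' (ze (f x2)) - zp al' be' (ze (f x3))))\<^sup>2)\<^sup>2
        + 4 * K * (Im (zp al' be' (ze (f x2)) * cnj (zp al' be' (ze (f x3)))))\<^sup>2 = 4 * h\<^sup>2 * (4 + k\<^sup>2)"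
      unfolding pairB[OF nimg[OF x2(1)] nimg[OF x3(1)], symmetric] rho[OF xb(2,3)] r23 ..
  qed
  then have "(al'\<^sup>2 - be'\<^sup>2)\<^sup>2 = (al\<^sup>2 - be\<^sup>2)\<^sup>2" by (simp only: K_def k_def)
  then show ?thesis using k by (metis less_imp_le power2_eq_iff_nonneg)
qed

section \<open>The section\<close>

definition disc2 :: "(nat \<Rightarrow> real) set" where
  "disc2 = {x \<in> Rn 2. (x 0)\<^sup>2 + (x 1)\<^sup>2 < 1}"

text \<open>Both parameters are real and the map is linear, so it is its own differential; the image
  of \<open>disc2\<close> is the section.\<close>

definition emb :: "nat \<Rightarrow> real \<Rightarrow> real \<Rightarrow> (nat \<Rightarrow> real) \<Rightarrow> nat \<Rightarrow> real" where
  "emb n al be x = cvec n (\<lambda>j. if j = 0 then complex_of_real (x 0) else pv al be (complex_of_real (x 1)) j)"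

text \<open>Entries 2 and 4 are the real parts of ball coordinates 1 and 2, which on the section are
  \<open>al\<close> and \<open>be\<close> times the second parameter.\<close>

definition sec_chart :: "real \<Rightarrow> real \<Rightarrow> (nat \<Rightarrow> real) \<Rightarrow> nat \<Rightarrow> real" where
  "sec_chart al be z = (\<lambda>i. if i = 0 then z 0 else if i = 1 then al * z 2 + be * z 4 else 0)"

definition sec :: "nat \<Rightarrow> real \<Rightarrow> real \<Rightarrow> (nat \<Rightarrow> real) manifold" where
  "sec n al be = \<lparr> mtop = top_of_set (emb n al be ` disc2), mdim = 2,
     atlas = {(emb n al be ` disc2, sec_chart al be)} \<rparr>"

lemma openin_disc2: "openin (Euclidean_space 2) disc2"
proof -
  have "open {x :: nat \<Rightarrow> real. (x 0)\<^sup>2 + (x 1)\<^sup>2 < 1}"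
    by (intro open_Collect_less continuous_on_add continuous_on_power continuous_on_product_coordinates continuous_on_const)
  moreover have "disc2 = Rn 2 \<inter> {x. (x 0)\<^sup>2 + (x 1)\<^sup>2 < 1}" by (auto simp: disc2_def)
  ultimately show ?thesis unfolding openin_Rn by blast
qed

context polar_family
begin

abbreviation "Emb \<equiv> emb n al be"
abbreviation "Sec \<equiv> sec n al be"

lemma cplx_emb: "cplx (Emb x) 0 = calbe (x 0)" "1 \<le> j \<Longrightarrow> j < n \<Longrightarrow> cplx (Emb x) j = pv al be (calbe (x 1)) j"
  using n0 by (simp_all add: emb_def cplx_vec)

lemma emb_coords: "Emb x 0 = x 0" "Emb x 2 = al * x 1" "Emb x 4 = be * x 1"
  using n3 by (simp_all add: emb_def cvec_def pv_def)

lemma chart_emb: "x \<in> Rn 2 \<Longrightarrow> sec_chart al be (Emb x) = x"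
proof
  fix i assume x: "x \<in> Rn 2"
  have "al * (al * x 1) + be * (be * x 1) = (al\<^sup>2 + be\<^sup>2) * x 1" by (simp add: power2_eq_square algebra_simps)
  then show "sec_chart al be (Emb x) i = x i"
    using x albe by (auto simp: sec_chart_def emb_coords Rn_iff)
qed

lemma disc2_Rn: "x \<in> disc2 \<Longrightarrow> x \<in> Rn 2" by (simp add: disc2_def)

lemma inv_chart: "x \<in> disc2 \<Longrightarrow> inv_into (Emb ` disc2) (sec_chart al be) x = Emb x"
proof (rule inv_into_f_eq)
  show "inj_on (sec_chart al be) (Emb ` disc2)"
    by (rule inj_on_inverseI[of _ Emb]) (auto simp: chart_emb disc2_Rn)
qed (auto simp: chart_emb disc2_Rn)

lemma chart_img: "sec_chart al be ` Emb ` disc2 = disc2"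
  using chart_emb disc2_Rn by (force simp: image_image)

lemma emb_in_Rn: "Emb x \<in> Rn (2 * n)"
  by (simp add: emb_def vec_in_Rn)

lemma emb_in_ball: "Emb x \<in> ball_CH n \<longleftrightarrow> (x 0)\<^sup>2 + (x 1)\<^sup>2 < 1"
proof -
  have "dot n (cplx (Emb x)) (cplx (Emb x)) = dot n (pv al be (calbe (x 1))) (pv al be (calbe (x 1)))"
    by (rule dot_cong) (simp_all add: cplx_emb)
  then have "Re (herm n (Emb x) (Emb x)) = (x 0)\<^sup>2 + (x 1)\<^sup>2"
    unfolding herm_dot[OF n0] by (simp add: cplx_emb Re_dot_pv zp_pv power2_eq_square)
  then show ?thesis by (simp add: ball_CH_iff emb_in_Rn)
qed

lemma smooth_coord_emb: "smooth_coord 2 disc2 (2 * n) Emb"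
  unfolding emb_def[abs_def]
proof (rule smooth_coord_vec[OF openin_disc2])
  fix j :: nat
  have x: "csmooth_on 2 disc2 (\<lambda>x. calbe (x i))" for i
    by (intro csmooth_on_of_real smooth_on_coord openin_disc2)
  consider "j = 0" | "j = 1" | "j = 2" | "j \<noteq> 0" "j \<noteq> 1" "j \<noteq> 2" by blast
  then show "csmooth_on 2 disc2 (\<lambda>x. if j = 0 then calbe (x 0) else pv al be (calbe (x 1)) j)"
    by cases (simp_all add: pv_def x csmooth_on_mult csmooth_on_const openin_disc2)
qed

lemma jacobian_emb:
  assumes x: "x \<in> disc2" and v: "v \<in> Rn 2"
  shows "jacobian 2 (2 * n) (inv_into (Emb ` disc2) (sec_chart al be)) x v = Emb v"
proof -
  have "jacobian 2 (2 * n) (inv_into (Emb ` disc2) (sec_chart al be)) x v = jacobian 2 (2 * n) Emb x v"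
    by (rule jacobian_cong[OF openin_disc2 x inv_chart])
  also have "\<dots> = Emb v"
  proof (rule jacobian_eqI[OF openin_disc2 smooth_coord_emb emb_in_Rn x v])
    have "Emb (\<lambda>i. x i + s * v i) = (\<lambda>i. Emb x i + s * Emb v i)" for s
      by (rule ext) (simp add: emb_def cvec_def pv_def algebra_simps)
    then show "has_velocity (\<lambda>s. Emb (\<lambda>i. x i + s * v i)) (Emb v) 0"
      by (simp only: has_velocity_line)
  qed
  finally show ?thesis .
qed

lemma continuous_on_emb: "continuous_on disc2 Emb"
  by (rule smooth_coord_continuous[OF openin_disc2 smooth_coord_emb emb_in_Rn])

lemma continuous_on_chart: "continuous_on S (sec_chart al be)"
proof (rule continuous_on_coordinatewise_then_product)
  fix i
  have c: "continuous_on S (\<lambda>z. z k :: real)" for k :: nat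
    by (rule continuous_on_subset[OF continuous_on_product_coordinates subset_UNIV])
  show "continuous_on S (\<lambda>z. sec_chart al be z i)"
    unfolding sec_chart_def
    by (cases "i = 0"; cases "i = 1") (simp_all add: c continuous_on_add continuous_on_mult continuous_on_const)
qed

lemma smooth_manifold_sec: "smooth_manifold Sec"
proof -
  let ?S = "Emb ` disc2"
  have T: "subtopology (Euclidean_space 2) disc2 = top_of_set disc2"
    by (rule subtopology_Rn[OF openin_Rn_subset[OF openin_disc2]])
  have "homeomorphic_map (top_of_set ?S) (top_of_set disc2) (sec_chart al be)"
    unfolding homeomorphic_map_maps homeomorphic_maps_def
    using continuous_on_emb continuous_on_chart[of ?S] chart_img
    by (intro exI[of _ Emb]) (auto simp: chart_emb disc2_Rn)
  then have "chart (top_of_set ?S) 2 (?S, sec_chart al be)"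
    unfolding chart_def by (simp add: chart_img openin_disc2 T subtopology_subtopology)
  moreover have "smooth_coord 2 disc2 2 (sec_chart al be \<circ> inv_into ?S (sec_chart al be))"
  proof -
    have "smooth_coord 2 disc2 2 (\<lambda>x. x)"
      by (simp add: smooth_coord_iff[OF openin_disc2] smooth_on_coord openin_disc2)
    then show ?thesis
      by (subst smooth_coord_cong[OF openin_disc2, of _ "\<lambda>x. x"]) (simp_all add: inv_chart chart_emb disc2_Rn)
  qed
  moreover have "Hausdorff_space (top_of_set ?S)"
    by (simp add: Hausdorff_space_subtopology)
  ultimately show ?thesis
    unfolding smooth_manifold_def transition_smooth_def
    by (simp add: sec_def second_countable_top_of_set chart_img)
qed

lemma emb_sub_ball: "Emb ` disc2 \<subseteq> ball_CH n"
  by (auto simp: emb_in_ball disc2_def)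

lemma immersed_sec: "immersed_submanifold (CH n) Sec"
proof -
  let ?S = "Emb ` disc2"
  have int: "?S \<inter> ball_CH n = ?S" and fs: "(\<lambda>x. x) \<in> ?S \<rightarrow> ball_CH n" using emb_sub_ball by auto
  have "smooth_coord 2 disc2 (2 * n) ((\<lambda>x. x) \<circ> (\<lambda>x. x) \<circ> inv_into ?S (sec_chart al be))"
    by (subst smooth_coord_cong[OF openin_disc2, of _ Emb]) (simp_all add: inv_chart smooth_coord_emb)
  then have "smooth_map Sec (riem_manifold (CH n)) (\<lambda>x. x)"
    unfolding smooth_map_def riem_manifold_dom rdim_CH using emb_sub_ball
    by (simp add: sec_def int fs chart_img subtopology_Rn[OF ball_CH_subset] continuous_map_in_subtopology)
  moreover have "inj_on (jacobian 2 (2 * n) (inv_into ?S (sec_chart al be)) (sec_chart al be s)) (Rn 2)" if s: "s \<in> ?S" for s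
  proof -
    have x: "sec_chart al be s \<in> disc2" using s chart_img by blast
    have "inj_on Emb (Rn 2)" by (rule inj_on_inverseI[of _ "sec_chart al be"]) (rule chart_emb)
    then show ?thesis
      using jacobian_emb[OF x] by (simp cong: inj_on_cong)
  qed
  moreover have "points Sec = ?S" by (simp add: sec_def)
  ultimately show ?thesis
    unfolding immersed_submanifold_def using smooth_manifold_sec emb_sub_ball
    by (simp add: sec_def)
qed

lemma connected_sec: "connected_space (mtop Sec)"
proof -
  define E where "E c = (\<lambda>i::nat. if i = 0 then Re c else if i = 1 then Im c else 0)" for c
  have "continuous_on (ball (0::complex) 1) E"
  proof (rule continuous_on_coordinatewise_then_product)
    fix i show "continuous_on (ball (0::complex) 1) (\<lambda>c. E c i)"
      unfolding E_def
      by (cases "i = 0"; cases "i = 1")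
        (simp_all add: continuous_on_Re continuous_on_Im continuous_on_id continuous_on_const)
  qed
  then have "connected (E ` ball 0 1)" by (rule connected_continuous_image) (rule connected_ball)
  moreover have "E ` ball 0 1 = disc2"
  proof
    have "(Re c)\<^sup>2 + (Im c)\<^sup>2 < 1" if "cmod c < 1" for c
      using that unfolding cmod_power2[symmetric] by (simp add: abs_square_less_1)
    then show "E ` ball 0 1 \<subseteq> disc2" by (auto simp: E_def disc2_def Rn_iff)
    show "disc2 \<subseteq> E ` ball 0 1"
    proof
      fix x assume x: "x \<in> disc2"
      have "(cmod (Complex (x 0) (x 1)))\<^sup>2 < 1" unfolding cmod_power2 using x by (simp add: disc2_def)
      then have "Complex (x 0) (x 1) \<in> ball 0 1" by (simp add: abs_square_less_1)
      moreover have "E (Complex (x 0) (x 1)) = x"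
        using x by (auto simp: E_def disc2_def Rn_iff fun_eq_iff)
      ultimately show "x \<in> E ` ball 0 1" by (metis imageI)
    qed
  qed
  ultimately have "connected disc2" by simp
  then have "connected (Emb ` disc2)" by (rule connected_continuous_image[OF continuous_on_emb])
  then show ?thesis by (simp add: sec_def connected_space_top_of_set)
qed

text \<open>The orbit of \<open>p\<close> contains a point with real parameters: the norm
  \<open>r\<close> of the plane component is kept, and \<open>w = ht n p + r\<^sup>2\<close> is what
  the height demands.\<close>

lemma sec_meets_orbits:
  assumes p: "p \<in> ball_CH n"
  shows "points Sec \<inter> orbit_of Act p \<noteq> {}"
proof -
  define r where "r = cmod (zp al be (ze p))"
  define w where "w = ht n p + r\<^sup>2"
  define z where "z = of_siegel n (calbe w) (pv al be (calbe r))"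
  \<comment> \<open>The inverse Cayley transform of this point, written in the parameters of the
    section.\<close>
  define x where "x = (\<lambda>i::nat. if i = 0 then (w - 1) / (w + 1) else if i = 1 then 2 * r / (w + 1) else 0)"
  have h: "0 < ht n p" by (rule ht_pos[OF p n0])
  have R: "Re (dot n (pv al be (calbe r)) (pv al be (calbe r))) = r\<^sup>2"
    by (simp add: Re_dot_pv zp_pv power2_eq_square)
  have lt: "Re (dot n (pv al be (calbe r)) (pv al be (calbe r))) < Re (calbe w)"
    unfolding R using h by (simp add: w_def)
  have zb: "z \<in> ball_CH n" unfolding z_def by (rule of_siegel_in_ball[OF lt n0])
  note nz = siegel_nz[OF lt]
  have o: "om z = calbe w" unfolding z_def by (rule om_of_siegel[OF nz n0])
  have zz: "ze z j = pv al be (calbe r) j" if "1 \<le> j" "j < n" for j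
    unfolding z_def by (rule ze_of_siegel[OF nz n0 that(2,1)])
  have "dot n (ze z) (ze z) = dot n (pv al be (calbe r)) (pv al be (calbe r))"
    by (rule dot_cong) (simp_all add: zz)
  then have "ht n z = ht n p" by (simp add: ht_def[of n z] o R) (simp add: w_def)
  moreover have "zp al be (ze z) = zp al be (pv al be (calbe r))"
    by (rule zp_cong) (use zz n3 in auto)
  then have "cmod (zp al be (ze z)) = cmod (zp al be (ze p))" by (simp add: zp_pv r_def)
  ultimately have zo: "z \<in> orbit_of Act p" using zb by (simp add: orbit_iff[OF p])
  have zx: "z = Emb x"
  proof (rule cplx_eqI)
    fix j assume "j < n"
    then show "cplx z j = cplx (Emb x) j"
      by (simp add: z_def of_siegel_def emb_def cplx_vec x_def pv_def)
  qed (simp_all add: emb_in_Rn z_def of_siegel_def vec_in_Rn)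
  then have "x \<in> disc2" using zb emb_in_ball[of x] by (simp add: disc2_def) (simp add: x_def Rn_iff)
  then have "z \<in> points Sec" using zx by (simp add: sec_def)
  then show ?thesis using zo by blast
qed

subsection \<open>Tangent spaces of orbits\<close>

lemma zp_tau: "zp al be (tau u) = 0"
  by (simp add: zp_def gtau_def)

text \<open>Entry 0 is 1 at the identity, so its logarithm has derivative \<open>cplx u 0\<close>:
  the real part moves the centre, the imaginary part turns the circle.\<close>

lemma orbit_velocity:
  assumes p: "p \<in> ball_CH n" and u: "u \<in> Rn D"
  defines "V \<equiv> jacobian D (2 * n) (\<lambda>g. gact n al be g p) (gone n) u"
  shows "dom p V = 2 * dot n (ze p) (tau u) + \<i> * calbe (Re (cplx u 0))"
    and "1 \<le> j \<Longrightarrow> j < n \<Longrightarrow> dze p V j =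
      (if j = 1 then \<i> * calbe (Im (cplx u 0)) * ze p 1
       else if j = 2 then - \<i> * calbe (Im (cplx u 0)) * ze p 2 else 0) + tau u j"
proof -
  let ?c = "\<lambda>s i. gone n i + s * u i"
  have c0: "?c 0 = gone n" by simp
  have sm: "smooth_coord D G (2 * n) (\<lambda>g. gact n al be g p)"
  proof -
    note C = csmooth_on_cplx[OF openin_G]
    show ?thesis
      unfolding gact_def smap_def
    proof (rule smooth_coord_of_siegel[OF openin_G])
      show "csmooth_on D G (\<lambda>g. siegel_om n 1 (grot g) (tau g) (gu g) p)"
        unfolding siegel_om_def
        by (intro csmooth_on_of_real smooth_gu csmooth_on_mult csmooth_on_add csmooth_on_const openin_G csmooth_on_dot
            csmooth_tau C csmooth_grot G_nz)
      show "csmooth_on D G (\<lambda>g. siegel_ze 1 (grot g) (tau g) p j)" for j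
        unfolding siegel_ze_def
        by (intro csmooth_on_mult csmooth_on_add csmooth_on_const openin_G csmooth_tau C csmooth_grot G_nz)
      show "siegel_om n 1 (grot g) (tau g) (gu g) p + 1 \<noteq> 0" if "g \<in> G" for g
        by (rule siegel_nz[OF siegel_map.siegel_in[OF gact_map[OF that] p]])
    qed
  qed
  have R: "gact n al be g p \<in> Rn (2 * n)" for g by (simp add: gact_def smap_def of_siegel_def vec_in_Rn)
  have cR: "eventually (\<lambda>s. ?c s \<in> Rn D) (nhds 0)"
    using line_in_Rn[OF G_Rn[OF one_in_G] u] by (intro always_eventually) blast
  have cv: "has_velocity ?c u 0" by (rule has_velocity_line)
  have cG: "?c 0 \<in> G" unfolding c0 by (rule one_in_G)
  have ev: "eventually (\<lambda>s. ?c s \<in> G) (nhds 0)"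
    by (rule eventually_in_open[OF openin_G cG has_velocity_tendsto[OF cv] cR])
  have V: "has_velocity (\<lambda>s. gact n al be (?c s) p) V 0"
    using has_velocity_map[OF openin_G sm R cv cG cR] unfolding c0 V_def .
  have p0: "gact n al be (?c 0) p = p" unfolding c0 by (rule gact_one[OF p])
  have pb: "gact n al be (?c 0) p \<in> ball_CH n" unfolding p0 by (rule p)
  have d1: "((\<lambda>s. om (gact n al be (?c s) p)) has_vector_derivative dom p V) (at 0)"
    using om_velocity[OF V pb n0] unfolding p0 .
  have d2: "((\<lambda>s. ze (gact n al be (?c s) p) j) has_vector_derivative dze p V j) (at 0)" for j
    using ze_velocity[OF V pb n0] unfolding p0 .
  define a b where "a = Re (cplx u 0)" and "b = Im (cplx u 0)"
  define m where "m s = cmod (cplx (?c s) 0)" for s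
  have cp: "cplx (?c s) k = cplx (gone n) k + calbe s * cplx u k" for s k
    by (simp add: cplx_def complex_eq_iff)
  have m0: "m 0 = 1" unfolding m_def cp cplx_one(1) by simp
  have dm: "(m has_real_derivative a) (at 0)"
  proof -
    have "m s = sqrt ((1 + s * a)\<^sup>2 + (s * b)\<^sup>2)" for s
      unfolding m_def cp cplx_one(1) by (simp add: cmod_def a_def b_def)
    then have "m = (\<lambda>s. sqrt ((1 + s * a)\<^sup>2 + (s * b)\<^sup>2))" by (rule ext)
    moreover have "((\<lambda>s. sqrt ((1 + s * a)\<^sup>2 + (s * b)\<^sup>2)) has_real_derivative a) (at 0)"
      by (auto intro!: derivative_eq_intros)
    ultimately show ?thesis by simp
  qed
  have dc: "((\<lambda>s. cplx (?c s) 0) has_vector_derivative cplx u 0) (at 0)"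
    by (rule has_velocity_cplx[OF cv])
  have dl: "((\<lambda>s. glam (?c s)) has_vector_derivative \<i> * calbe b) (at 0)"
  proof -
    have "((\<lambda>s. inverse (m s)) has_real_derivative - a) (at 0)"
      using DERIV_inverse'[OF dm] m0 by simp
    then have "((\<lambda>s. calbe (inverse (m s))) has_vector_derivative calbe (- a)) (at 0)"
      by (rule has_vector_derivative_of_real)
    from has_vector_derivative_mult[OF dc this]
    have "((\<lambda>s. cplx (?c s) 0 * calbe (inverse (m s))) has_vector_derivative calbe (- a) + cplx u 0) (at 0)"
      unfolding c0 cplx_one(1) m0 by simp
    moreover have "calbe (- a) + cplx u 0 = \<i> * calbe b" by (simp add: a_def b_def complex_eq_iff)
    ultimately show ?thesis by (simp add: glam_def m_def divide_inverse)
  qed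
  have dlc: "((\<lambda>s. cnj (glam (?c s))) has_vector_derivative - \<i> * calbe b) (at 0)"
    using bounded_linear.has_vector_derivative[OF bounded_linear_cnj dl] by simp
  have dln: "((\<lambda>s. ln (m s)) has_real_derivative inverse (m 0) * a) (at 0)"
    by (rule DERIV_chain2[OF DERIV_ln dm]) (simp add: m0)
  have "(\<lambda>s. gu (?c s)) = (\<lambda>s. ln (m s))" by (rule ext) (simp only: gu_def m_def)
  then have du: "((\<lambda>s. gu (?c s)) has_real_derivative a) (at 0)"
    using dln m0 by (metis inverse_1 mult_1)

  define rd where "rd j = (if j = 1 then \<i> * calbe b else if j = 2 then - \<i> * calbe b else 0)" for j :: nat
  have dr: "((\<lambda>s. grot (?c s) j) has_vector_derivative rd j) (at 0)" for j
    unfolding grot_def rd_def using dl dlc by (cases "j = 1"; cases "j = 2") simp_all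
  have tt: "tau (?c s) j = calbe s * tau u j" if j: "1 \<le> j" "j < n" for s j
  proof -
    have k: "cplx (?c s) k = calbe s * cplx u k" if "1 \<le> k" "k < n - 1" for k
      unfolding cp cplx_one(2)[OF that] by simp
    consider "j = 1" | "j = 2" | "3 \<le> j" using j by linarith
    then show ?thesis
    proof cases
      case 3
      then have "1 \<le> j - 1" "j - 1 < n - 1" using j by auto
      from k[OF this] 3 show ?thesis by (simp add: gtau_def)
    qed (use k[of 1] n1 in \<open>simp_all add: gtau_def\<close>)
  qed
  have rot0: "grot (?c 0) j = 1" for j unfolding c0 by (rule one_params(3))
  define A where "A s = dot n (\<lambda>j. grot (?c s) j * ze p j) (tau u)" for s
  have dA: "(A has_vector_derivative dot n (\<lambda>j. rd j * ze p j) (tau u)) (at 0)"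
    unfolding A_def[abs_def] dot_def by (auto intro!: derivative_eq_intros dr)
  have ds: "((\<lambda>s. calbe s) has_vector_derivative 1) (at 0)"
    using has_vector_derivative_of_real[OF DERIV_ident[of "at 0"]] by simp
  have A0: "A 0 = dot n (ze p) (tau u)" unfolding A_def rot0 by simp
  have "((\<lambda>s. om p + 2 * (calbe s * A s) + (calbe s * calbe s) * dot n (tau u) (tau u) + \<i> * calbe (gu (?c s)))
      has_vector_derivative 2 * A 0 + \<i> * calbe a) (at 0)"
    by (auto intro!: derivative_eq_intros ds dA du)
  then have "((\<lambda>s. om (gact n al be (?c s) p)) has_vector_derivative 2 * A 0 + \<i> * calbe a) (at 0)"
  proof (rule has_vector_derivative_eventually_cong)
    show "eventually (\<lambda>s. om p + 2 * (calbe s * A s) + (calbe s * calbe s) * dot n (tau u) (tau u) + \<i> * calbe (gu (?c s))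
      = om (gact n al be (?c s) p)) (nhds 0)"
      using ev
    proof eventually_elim
      case (elim s)
      have "dot n (\<lambda>j. grot (?c s) j * ze p j) (tau (?c s)) = dot n (\<lambda>j. grot (?c s) j * ze p j) (\<lambda>j. calbe s * tau u j)"
        "dot n (tau (?c s)) (tau (?c s)) = dot n (\<lambda>j. calbe s * tau u j) (\<lambda>j. calbe s * tau u j)"
        by (rule dot_cong; simp add: tt)+
      then show ?case
        unfolding om_gact[OF elim p] dot_scale_left dot_scale_right by (simp add: A_def dot_scale_right)
    qed
  qed
  from vector_derivative_unique_at[OF d1 this]
  show "dom p V = 2 * dot n (ze p) (tau u) + \<i> * calbe (Re (cplx u 0))"
    by (simp add: A0 a_def)
  assume j: "1 \<le> j" "j < n"
  have "((\<lambda>s. grot (?c s) j * ze p j + calbe s * tau u j) has_vector_derivative rd j * ze p j + tau u j) (at 0)"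
    by (auto intro!: derivative_eq_intros ds dr)
  then have "((\<lambda>s. ze (gact n al be (?c s) p) j) has_vector_derivative rd j * ze p j + tau u j) (at 0)"
  proof (rule has_vector_derivative_eventually_cong)
    show "eventually (\<lambda>s. grot (?c s) j * ze p j + calbe s * tau u j = ze (gact n al be (?c s) p) j) (nhds 0)"
      using ev
    proof eventually_elim
      case (elim s)
      show ?case unfolding ze_gact[OF elim p j] tt[OF j] ..
    qed
  qed
  from vector_derivative_unique_at[OF d2 this]
  show "dze p V j = (if j = 1 then \<i> * calbe (Im (cplx u 0)) * ze p 1
       else if j = 2 then - \<i> * calbe (Im (cplx u 0)) * ze p 2 else 0) + tau u j"
    by (simp add: rd_def b_def)
qed

lemma orbit_tangent:
  assumes p: "p \<in> ball_CH n"
  shows "orbit_tangent_space (CH n) Act p = (\<lambda>u. jacobian D (2 * n) (\<lambda>g. gact n al be g p) (gone n) u) ` Rn D"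
proof -
  have J: "jacobian D (2 * n) ((\<lambda>g. act Act g p) \<circ> inv_into G (\<lambda>x. x)) (gone n) u
      = jacobian D (2 * n) (\<lambda>g. gact n al be g p) (gone n) u" for u
    by (rule jacobian_cong[OF openin_G one_in_G]) (simp add: inv_into_ident Gact_def p)
  have E: "atlas (lie Act) = {(G, \<lambda>x. x)}" "mdim (lie Act) = D" "\<one>\<^bsub>grp Act\<^esub> = gone n"
    by (simp_all add: Gact_def Ggrp_def)
  show ?thesis
    unfolding orbit_tangent_space_def tangent_image_def rdim_CH E
    using one_in_G by (auto simp: J simp del: One_nat_def)
qed

text \<open>In the identification of the tangent space with \<open>\<complex> \<times> \<complex>\<^bsup>n-1\<^esup>\<close> by \<open>bet\<close> and \<open>dze\<close>,
  orbit directions have imaginary first component, and their distinguished-plane part is tangent to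
  the circles about the origin.\<close>

lemma orbit_velocity_normal:
  assumes p: "p \<in> ball_CH n" and u: "u \<in> Rn D"
  defines "V \<equiv> jacobian D (2 * n) (\<lambda>g. gact n al be g p) (gone n) u"
  shows "Re (bet n p V) = 0" and "zp al be (dze p V) = \<i> * calbe (Im (cplx u 0)) * zp al be (ze p)"
proof -
  define b where "b = Im (cplx u 0)"
  define rd where "rd j = (if j = 1 then \<i> * calbe b else if j = 2 then - \<i> * calbe b else 0)" for j :: nat
  have dz: "dze p V j = rd j * ze p j + tau u j" if "1 \<le> j" "j < n" for j
    using orbit_velocity(2)[OF p u that] by (simp add: V_def rd_def b_def)
  have "dot n (dze p V) (ze p) = dot n (\<lambda>j. rd j * ze p j + tau u j) (ze p)"
    by (rule dot_cong) (simp_all add: dz)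
  then have 1: "Re (dot n (dze p V) (ze p)) = Re (dot n (\<lambda>j. rd j * ze p j) (ze p)) + Re (dot n (tau u) (ze p))"
    by (simp add: dot_add_left)
  have "dot n (\<lambda>j. rd j * ze p j) (ze p) = (\<Sum>j=1..<n. rd j * calbe ((cmod (ze p j))\<^sup>2))"
    unfolding dot_def
  proof (intro sum.cong refl)
    fix j
    have "ze p j * cnj (ze p j) = calbe ((cmod (ze p j))\<^sup>2)" using complex_norm_square by simp
    then show "rd j * ze p j * cnj (ze p j) = rd j * calbe ((cmod (ze p j))\<^sup>2)" by (simp add: mult.assoc)
  qed
  moreover have "Re (rd j) = 0" for j by (simp add: rd_def)
  ultimately have "Re (dot n (\<lambda>j. rd j * ze p j) (ze p)) = 0" by simp
  then show "Re (bet n p V) = 0"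
    using 1 Re_dot_commute[of n "tau u" "ze p"] orbit_velocity(1)[OF p u] by (simp add: bet_def V_def)
  have "dze p V 1 = rd 1 * ze p 1 + tau u 1" "dze p V 2 = rd 2 * ze p 2 + tau u 2"
    using dz[of 1] dz[of 2] n3 by auto
  then have "zp al be (dze p V) =
      (calbe al * rd 1 * ze p 1 + calbe be * cnj (rd 2) * cnj (ze p 2)) + zp al be (tau u)"
    unfolding zp_def by (simp add: algebra_simps)
  then show "zp al be (dze p V) = \<i> * calbe (Im (cplx u 0)) * zp al be (ze p)"
    unfolding zp_tau by (simp add: zp_def rd_def b_def algebra_simps)
qed

lemma tangent_sec:
  assumes "s \<in> points Sec"
  shows "tangent_space (CH n) Sec s = Emb ` Rn 2"
proof -
  have s: "s \<in> Emb ` disc2" using assms by (simp add: sec_def)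
  then have x: "sec_chart al be s \<in> disc2" using chart_img by blast
  have id: "(\<lambda>x. x) \<circ> f = f" for f :: "(nat \<Rightarrow> real) \<Rightarrow> (nat \<Rightarrow> real)" by auto
  have "tangent_space (CH n) Sec s =
      (\<lambda>v. jacobian 2 (2 * n) (inv_into (Emb ` disc2) (sec_chart al be)) (sec_chart al be s) v) ` Rn 2"
    unfolding tangent_space_def tangent_image_def using s by (auto simp: sec_def id)
  also have "\<dots> = Emb ` Rn 2" by (rule image_cong[OF refl]) (rule jacobian_emb[OF x])
  finally show ?thesis .
qed

text \<open>Section directions have real \<open>bet\<close> and real plane component, at points
  whose plane component is real; orbit directions have imaginary \<open>bet\<close> and imaginary
  plane component there. Both terms of the metric thus have real part 0.\<close>

lemma sec_orthogonal:
  assumes s: "s \<in> points Sec" and v: "v \<in> tangent_space (CH n) Sec s"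
    and w: "w \<in> orbit_tangent_space (CH n) Act s"
  shows "rmetric (CH n) s v w = 0"
proof -
  obtain x where x: "x \<in> disc2" "s = Emb x" using s by (auto simp: sec_def)
  obtain y where y: "v = Emb y" using v tangent_sec[OF s] by blast
  have sb: "s \<in> ball_CH n" using x by (simp add: emb_in_ball disc2_def)
  obtain u where u: "u \<in> Rn D" "w = jacobian D (2 * n) (\<lambda>g. gact n al be g s) (gone n) u"
    using w orbit_tangent[OF sb] by auto
  have bw: "Re (bet n s w) = 0" and zw: "zp al be (dze s w) = \<i> * calbe (Im (cplx u 0)) * zp al be (ze s)"
    using orbit_velocity_normal[OF sb u(1)] u(2) by auto
  define r where "r = x 1 / (1 - x 0)"
  define r' where "r' = y 1 / (1 - x 0) + x 1 * y 0 / (1 - x 0)\<^sup>2"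
  have zs: "ze s j = pv al be (calbe r) j" if "1 \<le> j" "j < n" for j
    using that by (simp add: ze_def x(2) cplx_emb r_def pv_def)
  have dv: "dze s v j = pv al be (calbe r') j" if "1 \<le> j" "j < n" for j
    using that by (simp add: dze_def x(2) y cplx_emb r'_def pv_def add_divide_distrib algebra_simps)
  have "zp al be (ze s) = zp al be (pv al be (calbe r))" by (rule zp_cong) (use zs n3 in auto)
  then have zps: "zp al be (ze s) = calbe r" by (simp add: zp_pv)
  have "dot n (dze s v) (ze s) = dot n (pv al be (calbe r')) (pv al be (calbe r))"
    by (rule dot_cong) (simp_all add: zs dv)
  then have "Im (dot n (dze s v) (ze s)) = 0" by (simp add: Im_dot_pv_pv)
  moreover have "Im (dom s v) = 0"
  proof -
    have "dom s v = calbe (2 * y 0 / (1 - x 0)\<^sup>2)" by (simp add: dom_def x(2) y cplx_emb)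
    then show ?thesis by simp
  qed
  ultimately have bv: "Im (bet n s v) = 0" by (simp add: bet_def)
  have "dot n (dze s v) (dze s w) = dot n (pv al be (calbe r')) (dze s w)"
    by (rule dot_cong) (simp_all add: dv)
  then have "Re (dot n (dze s v) (dze s w)) = 0" by (simp add: Re_dot_pv zw zps)
  moreover have "Re (bet n s v * cnj (bet n s w)) = 0" using bw bv by simp
  moreover have "Re (A / calbe h + B / calbe k) = Re A / h + Re B / k" for A B :: complex and h k
    by simp
  ultimately show ?thesis
    unfolding rmetric_siegel[OF sb n0] by (simp flip: of_real_power)
qed

lemma polar_G: "polar (CH n) Act"
  unfolding polar_def is_section_def
  using proper_isometric_G immersed_sec connected_sec sec_meets_orbits sec_orthogonal by metis

end

section \<open>Nonflatness\<close>

lemma identity_derivative: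
  assumes "openin (Euclidean_space d) W" "x \<in> W" "i < d" "\<And>y. y \<in> W \<Longrightarrow> F y = 0"
    and "((\<lambda>t. F (x(i := t))) has_real_derivative D) (at (x i))"
  shows "D = 0"
proof -
  have "((\<lambda>t. 0) has_real_derivative D) (at (x i))"
    using assms(5) DERIV_upd_cong[OF assms(1-3), of F "\<lambda>_. 0" D, OF assms(4)] by simp
  then show ?thesis using DERIV_unique[OF _ DERIV_const] by blast
qed

text \<open>Subscripts denote partials, and \<open>A\<close>, \<open>B\<close>, \<open>C\<close> are
  the derivatives of the three equations \<open>E\<close>. \<open>N1\<close>, \<open>N2\<close>,
  \<open>N3\<close> are the Hessian of \<open>y\<close> on the frame formed by the gradient of
  \<open>y\<close> and its rotation by a right angle: \<open>A\<close> gives the first two, the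
  equations for \<open>p\<close> the third.\<close>

lemma hessian_algebra:
  fixes p y p1 p2 y1 y2 p11 p12 p22 y11 y12 y22 :: real
  assumes pos: "p > 0" "y > 0"
    and E: "y1 * y1 + y2 * y2 = y * y" "p1 * p1 + p2 * p2 = p * y" "p1 * y1 + p2 * y2 = 0"
    and A: "y1 * y11 + y2 * y12 = y * y1" "y1 * y12 + y2 * y22 = y * y2"
    and B: "2 * (p1 * p11 + p2 * p12) = p1 * y + p * y1" "2 * (p1 * p12 + p2 * p22) = p2 * y + p * y2"
    and C: "p11 * y1 + p1 * y11 + p12 * y2 + p2 * y12 = 0" "p12 * y1 + p1 * y12 + p22 * y2 + p2 * y22 = 0"
  shows "2 * y * y11 = 2 * y1 * y1 - y2 * y2" "2 * y * y12 = 3 * y1 * y2" "2 * y * y22 = 2 * y2 * y2 - y1 * y1"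
proof -
  define N1 N2 N3 where "N1 = y1 * y1 * y11 + 2 * y1 * y2 * y12 + y2 * y2 * y22"
    and "N2 = y1 * y1 * y12 + y1 * y2 * y22 - y1 * y2 * y11 - y2 * y2 * y12"
    and "N3 = y2 * y2 * y11 - 2 * y1 * y2 * y12 + y1 * y1 * y22"
  have "N1 = y1 * (y1 * y11 + y2 * y12) + y2 * (y1 * y12 + y2 * y22)" by (simp add: N1_def algebra_simps)
  also have "\<dots> = y * (y1 * y1 + y2 * y2)" unfolding A by (simp add: algebra_simps)
  finally have N1: "N1 = y * (y * y)" unfolding E(1) .
  have "N2 = y1 * (y1 * y12 + y2 * y22) - y2 * (y1 * y11 + y2 * y12)" by (simp add: N2_def algebra_simps)
  then have N2: "N2 = 0" unfolding A by (simp add: algebra_simps)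
  \<comment> \<open>The gradient of \<open>p\<close> is orthogonal to that of \<open>y\<close>,
    hence a multiple of the rotated gradient, with squared factor \<open>p / y\<close>.\<close>
  have e1: "p1 * p1 * y = y2 * y2 * p" and e2: "p2 * p2 * y = y1 * y1 * p" and e3: "p1 * p2 * y = - (y1 * y2 * p)"
  proof -
    have "p1 * y1 = - (p2 * y2)" using E(3) by simp
    then have s: "(p1 * y1) * (p1 * y1) = (p2 * y2) * (p2 * y2)" by simp
    have "y * (p1 * p1 * y) = p1 * p1 * (y1 * y1 + y2 * y2)" unfolding E(1) by (simp add: algebra_simps)
    also have "\<dots> = y2 * y2 * (p1 * p1 + p2 * p2)" using s by (simp add: algebra_simps)
    finally show "p1 * p1 * y = y2 * y2 * p" unfolding E(2) using pos(2) by simp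
    have "y * (p2 * p2 * y) = p2 * p2 * (y1 * y1 + y2 * y2)" unfolding E(1) by (simp add: algebra_simps)
    also have "\<dots> = y1 * y1 * (p1 * p1 + p2 * p2)" using s by (simp add: algebra_simps)
    finally show "p2 * p2 * y = y1 * y1 * p" unfolding E(2) using pos(2) by simp
    have "y * (p1 * p2 * y) = p1 * p2 * (y1 * y1 + y2 * y2)" unfolding E(1) by (simp add: algebra_simps)
    also have "\<dots> = (p1 * y1) * (p2 * y1) + (p2 * y2) * (p1 * y2)" by (simp add: algebra_simps)
    also have "\<dots> = - (p2 * y2) * (p2 * y1) + - (p1 * y1) * (p1 * y2)"
      using E(3) by (metis add.inverse_inverse add_eq_0_iff)
    also have "\<dots> = - (y1 * y2 * (p1 * p1 + p2 * p2))" by (simp add: algebra_simps)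
    finally have "y * (p1 * p2 * y) = y * - (y1 * y2 * p)" unfolding E(2) by (simp add: algebra_simps)
    then show "p1 * p2 * y = - (y1 * y2 * p)" using pos(2) by (metis less_irrefl mult_left_cancel)
  qed
  \<comment> \<open>\<open>C\<close> contracted with the gradient of \<open>p\<close> and
    \<open>B\<close> contracted with that of \<open>y\<close> contain the same expression in the
    Hessian of \<open>p\<close>, which is thus eliminated.\<close>
  have 1: "p1 * (p11 * y1 + p1 * y11 + p12 * y2 + p2 * y12) + p2 * (p12 * y1 + p1 * y12 + p22 * y2 + p2 * y22) = 0"
    unfolding C by simp
  have 2: "y1 * (2 * (p1 * p11 + p2 * p12)) + y2 * (2 * (p1 * p12 + p2 * p22)) = p * (y * y)"
  proof -
    have "y1 * (p1 * y + p * y1) + y2 * (p2 * y + p * y2) = y * (p1 * y1 + p2 * y2) + p * (y1 * y1 + y2 * y2)"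
      by (simp add: algebra_simps)
    then show ?thesis unfolding B E by simp
  qed
  have "2 * (p1 * p1 * y11 + 2 * (p1 * p2 * y12) + p2 * p2 * y22) = - (p * (y * y))"
    using 1 2 by (simp add: algebra_simps)
  then have "y * (2 * (p1 * p1 * y11 + 2 * (p1 * p2 * y12) + p2 * p2 * y22)) = y * - (p * (y * y))" by simp
  moreover have "y * (2 * (p1 * p1 * y11 + 2 * (p1 * p2 * y12) + p2 * p2 * y22))
     = 2 * ((p1 * p1 * y) * y11 + 2 * ((p1 * p2 * y) * y12) + (p2 * p2 * y) * y22)" by (simp add: algebra_simps)
  ultimately have "p * (2 * N3) = p * - (y * (y * y))"
    unfolding e1 e2 e3 N3_def by (simp add: algebra_simps)
  then have N3: "2 * N3 = - (y * (y * y))" using pos(1) by (metis less_irrefl mult_left_cancel)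
  \<comment> \<open>\<open>y\<^sup>4\<close> is the fourth power of the length of the gradient, so
    each entry of the Hessian is recovered from the three values on the frame.\<close>
  have q: "y * y * (y * y) = (y1 * y1 + y2 * y2) * (y1 * y1 + y2 * y2)" unfolding E(1) ..
  have c: "X = Y" if "y * (y * y) * X = y * (y * y) * Y" for X Y
    using that pos(2) by simp
  have "y * (y * y) * (2 * y * y11) = 2 * ((y1 * y1 + y2 * y2) * (y1 * y1 + y2 * y2)) * y11"
    unfolding q[symmetric] by (simp add: algebra_simps)
  also have "\<dots> = 2 * (y1 * y1) * N1 - 4 * (y1 * y2) * N2 + y2 * y2 * (2 * N3)"
    by (simp add: N1_def N2_def N3_def algebra_simps)
  also have "\<dots> = y * (y * y) * (2 * y1 * y1 - y2 * y2)" unfolding N1 N2 N3 by (simp add: algebra_simps)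
  finally show "2 * y * y11 = 2 * y1 * y1 - y2 * y2" by (rule c)
  have "y * (y * y) * (2 * y * y12) = 2 * ((y1 * y1 + y2 * y2) * (y1 * y1 + y2 * y2)) * y12"
    unfolding q[symmetric] by (simp add: algebra_simps)
  also have "\<dots> = 2 * (y1 * y2) * N1 + 2 * (y1 * y1 - y2 * y2) * N2 - y1 * y2 * (2 * N3)"
    by (simp add: N1_def N2_def N3_def algebra_simps)
  also have "\<dots> = y * (y * y) * (3 * y1 * y2)" unfolding N1 N2 N3 by (simp add: algebra_simps)
  finally show "2 * y * y12 = 3 * y1 * y2" by (rule c)
  have "y * (y * y) * (2 * y * y22) = 2 * ((y1 * y1 + y2 * y2) * (y1 * y1 + y2 * y2)) * y22"
    unfolding q[symmetric] by (simp add: algebra_simps)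
  also have "\<dots> = 2 * (y2 * y2) * N1 + 4 * (y1 * y2) * N2 + y1 * y1 * (2 * N3)"
    by (simp add: N1_def N2_def N3_def algebra_simps)
  also have "\<dots> = y * (y * y) * (2 * y2 * y2 - y1 * y1)" unfolding N1 N2 N3 by (simp add: algebra_simps)
  finally show "2 * y * y22 = 2 * y2 * y2 - y1 * y1" by (rule c)
qed

text \<open>The equations say that \<open>(p, y)\<close> is a local isometry from the flat plane to a plane of
  constant negative curvature. They determine the Hessian of \<open>y\<close>, and the symmetry of the third
  derivatives of \<open>y\<close> then forces its gradient to vanish.\<close>

lemma no_flat_hyperbolic_coordinates:
  assumes p: "smooth_on 2 W p" and y: "smooth_on 2 W y" and x0: "x0 \<in> W"
    and pos: "\<And>x. x \<in> W \<Longrightarrow> p x > 0" "\<And>x. x \<in> W \<Longrightarrow> y x > 0"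
    and E1: "\<And>x. x \<in> W \<Longrightarrow> partial 0 y x * partial 0 y x + partial 1 y x * partial 1 y x = y x * y x"
    and E2: "\<And>x. x \<in> W \<Longrightarrow> partial 0 p x * partial 0 p x + partial 1 p x * partial 1 p x = p x * y x"
    and E3: "\<And>x. x \<in> W \<Longrightarrow> partial 0 p x * partial 0 y x + partial 1 p x * partial 1 y x = 0"
  shows False
proof -
  have W: "openin (Euclidean_space 2) W" using p by (rule smooth_on_openin)
  have Cp: "Ck_on k 2 W p" and Cy: "Ck_on k 2 W y" for k using p y by (simp_all add: smooth_on_def)
  have C1p: "Ck_on k 2 W (partial i p)" and C1y: "Ck_on k 2 W (partial i y)" if "i < 2" for i k
    using Ck_partial[OF Cp that] Ck_partial[OF Cy that] by auto
  have C2y: "Ck_on k 2 W (partial j (partial i y))" if "i < 2" "j < 2" for i j k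
    using Ck_partial[OF C1y[OF that(1)] that(2)] .
  have D: "((\<lambda>t. f (x(i := t))) has_real_derivative partial i f x) (at (x i))"
    if "\<And>k. Ck_on k 2 W f" "x \<in> W" "i < 2" for f x i
    by (rule has_partial[OF that(1) that(2,3)])
  note Dp = D[OF Cp] and Dy = D[OF Cy] and D1p = D[OF C1p] and D1y = D[OF C1y] and D2y = D[OF C2y]
  have sym: "partial 0 (partial 1 f) x = partial 1 (partial 0 f) x" if "\<And>k. Ck_on k 2 W f" "x \<in> W" for f x
    by (rule partial_commute[OF W that(1) that(2)]) auto
  have up: "(x(i := x i)) = x" for x :: "nat \<Rightarrow> real" and i by simp
  have hess: "2 * y x * partial 0 (partial 0 y) x = 2 * partial 0 y x * partial 0 y x - partial 1 y x * partial 1 y x"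
    "2 * y x * partial 1 (partial 0 y) x = 3 * partial 0 y x * partial 1 y x"
    "2 * y x * partial 1 (partial 1 y) x = 2 * partial 1 y x * partial 1 y x - partial 0 y x * partial 0 y x"
    if x: "x \<in> W" for x
  proof -
    have A: "partial 0 y x * partial i (partial 0 y) x + partial 1 y x * partial i (partial 1 y) x = y x * partial i y x"
      if i: "i < 2" for i
    proof -
      have "((\<lambda>t. partial 0 y (x(i := t)) * partial 0 y (x(i := t)) + partial 1 y (x(i := t)) * partial 1 y (x(i := t)) - y (x(i := t)) * y (x(i := t)))
        has_real_derivative 2 * partial 0 y x * partial i (partial 0 y) x + 2 * partial 1 y x * partial i (partial 1 y) x
          - 2 * y x * partial i y x) (at (x i))"
        by (rule derivative_eq_intros D1y[OF _ x i] Dy[OF x i] refl | simp)+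
      from identity_derivative[OF W x i _ this] E1 show ?thesis by simp
    qed
    have B: "2 * (partial 0 p x * partial i (partial 0 p) x + partial 1 p x * partial i (partial 1 p) x) = partial i p x * y x + p x * partial i y x"
      if i: "i < 2" for i
    proof -
      have "((\<lambda>t. partial 0 p (x(i := t)) * partial 0 p (x(i := t)) + partial 1 p (x(i := t)) * partial 1 p (x(i := t)) - p (x(i := t)) * y (x(i := t)))
        has_real_derivative 2 * partial 0 p x * partial i (partial 0 p) x + 2 * partial 1 p x * partial i (partial 1 p) x
          - (partial i p x * y x + p x * partial i y x)) (at (x i))"
        by (rule derivative_eq_intros D1p[OF _ x i] Dp[OF x i] Dy[OF x i] refl | simp)+
      from identity_derivative[OF W x i _ this] E2 show ?thesis by simp
    qed
    have C: "partial i (partial 0 p) x * partial 0 y x + partial 0 p x * partial i (partial 0 y) x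
        + partial i (partial 1 p) x * partial 1 y x + partial 1 p x * partial i (partial 1 y) x = 0"
      if i: "i < 2" for i
    proof -
      have "((\<lambda>t. partial 0 p (x(i := t)) * partial 0 y (x(i := t)) + partial 1 p (x(i := t)) * partial 1 y (x(i := t)))
        has_real_derivative partial i (partial 0 p) x * partial 0 y x + partial 0 p x * partial i (partial 0 y) x
        + partial i (partial 1 p) x * partial 1 y x + partial 1 p x * partial i (partial 1 y) x) (at (x i))"
        by (rule derivative_eq_intros D1p[OF _ x i] D1y[OF _ x i] refl | simp)+
      from identity_derivative[OF W x i _ this] E3 show ?thesis by simp
    qed
    note S = sym[OF Cp x] sym[OF Cy x]
    have i: "(0::nat) < 2" "(1::nat) < 2" by auto
    show "2 * y x * partial 0 (partial 0 y) x = 2 * partial 0 y x * partial 0 y x - partial 1 y x * partial 1 y x"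
      "2 * y x * partial 1 (partial 0 y) x = 3 * partial 0 y x * partial 1 y x"
      "2 * y x * partial 1 (partial 1 y) x = 2 * partial 1 y x * partial 1 y x - partial 0 y x * partial 0 y x"
      using hessian_algebra[OF pos(1)[OF x] pos(2)[OF x] E1[OF x] E2[OF x] E3[OF x]
        A[OF i(1), unfolded S] A[OF i(2)] B[OF i(1), unfolded S] B[OF i(2)] C[OF i(1), unfolded S] C[OF i(2)]]
      by blast+
  qed
  have y2: "partial 1 y x = 0" if x: "x \<in> W" for x
  proof -
    define a b c where "a = partial 0 (partial 0 y) x" and "b = partial 1 (partial 0 y) x"
      and "c = partial 1 (partial 1 y) x"
    define y1 y2 where "y1 = partial 0 y x" and "y2 = partial 1 y x"
    have i: "(0::nat) < 2" "(1::nat) < 2" by auto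
    have "((\<lambda>t. 2 * y (x(1 := t)) * partial 0 (partial 0 y) (x(1 := t))
        - (2 * partial 0 y (x(1 := t)) * partial 0 y (x(1 := t)) - partial 1 y (x(1 := t)) * partial 1 y (x(1 := t))))
      has_real_derivative (2 * y2 * a + 2 * y x * partial 1 (partial 0 (partial 0 y)) x) - (4 * y1 * b - 2 * y2 * c)) (at (x 1))"
      unfolding a_def b_def c_def y1_def y2_def
      by (rule derivative_eq_intros D2y[OF i(1) i(1) x i(2)] D1y[OF i(1) x i(2)] D1y[OF i(2) x i(2)] Dy[OF x i(2)] refl | simp)+
    from identity_derivative[OF W x i(2) _ this] hess(1)
    have 1: "(2 * y2 * a + 2 * y x * partial 1 (partial 0 (partial 0 y)) x) - (4 * y1 * b - 2 * y2 * c) = 0" by simp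
    have "((\<lambda>t. 2 * y (x(0 := t)) * partial 1 (partial 0 y) (x(0 := t)) - 3 * partial 0 y (x(0 := t)) * partial 1 y (x(0 := t)))
      has_real_derivative (2 * y1 * b + 2 * y x * partial 0 (partial 1 (partial 0 y)) x) - (3 * a * y2 + 3 * y1 * partial 0 (partial 1 y) x)) (at (x 0))"
      unfolding a_def b_def y1_def y2_def
      by (rule derivative_eq_intros D2y[OF i x i(1)] D1y[OF i(1) x i(1)] D1y[OF i(2) x i(1)] Dy[OF x i(1)] refl | simp)+
    from identity_derivative[OF W x i(1) _ this] hess(2)
    have 2: "(2 * y1 * b + 2 * y x * partial 1 (partial 0 (partial 0 y)) x) - (3 * a * y2 + 3 * y1 * b) = 0"
      unfolding sym[OF C1y[OF i(1)] x] sym[OF Cy x] by (simp add: b_def)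
    \<comment> \<open>Two of the Hessian formulas yield the same third derivative. Eliminating it
      and inserting the Hessian leaves \<open>y2 * (y1\<^sup>2 + y2\<^sup>2) = 0\<close>.\<close>
    have "2 * y2 * a - 4 * y1 * b + 2 * y2 * c = 2 * y1 * b - (3 * a * y2 + 3 * y1 * b)"
      using 1 2 by linarith
    then have 3: "5 * (a * y2) - 3 * (y1 * b) + 2 * (y2 * c) = 0" by (simp add: algebra_simps)
    have "5 * ((2 * y x * a) * y2) - 3 * (y1 * (2 * y x * b)) + 2 * (y2 * (2 * y x * c))
       = 2 * y x * (5 * (a * y2) - 3 * (y1 * b) + 2 * (y2 * c))" by (simp add: algebra_simps)
    also have "\<dots> = 0" unfolding 3 by simp
    finally have "5 * ((2 * y1 * y1 - y2 * y2) * y2) - 3 * (y1 * (3 * y1 * y2)) + 2 * (y2 * (2 * y2 * y2 - y1 * y1)) = 0"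
      using hess[OF x] by (simp only: a_def b_def c_def y1_def y2_def)
    then have "y2 * (y1 * y1 + y2 * y2) = 0" by (simp add: algebra_simps)
    then show ?thesis using E1[OF x] pos(2)[OF x] by (auto simp: y1_def y2_def)
  qed
  have i: "(1::nat) < 2" by simp
  \<comment> \<open>\<open>partial 1 y\<close> vanishes on all of \<open>W\<close>, hence so does
    its derivative, and the third Hessian formula makes the other component of the gradient vanish
    too.\<close>
  have "partial 1 (partial 1 y) x0 = 0"
    by (rule identity_derivative[OF W x0 i y2 D1y[OF i x0 i]])
  then have "partial 0 y x0 * partial 0 y x0 = 0" using hess(3)[OF x0] y2[OF x0] by simp
  then show False using E1[OF x0] y2[OF x0] pos(2)[OF x0] by simp
qed

section \<open>Charts of immersed submanifolds\<close>

lemma homeomorphic_chart: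
  assumes c: "chart T d (U, \<psi>)" and V: "openin T V"
  shows "openin (Euclidean_space d) (\<psi> ` (U \<inter> V))" and "inj_on \<psi> U" and "U \<subseteq> topspace T"
proof -
  have U: "openin T U" and E: "openin (Euclidean_space d) (\<psi> ` U)"
    and h: "homeomorphic_map (subtopology T U) (subtopology (Euclidean_space d) (\<psi> ` U)) \<psi>"
    using c by (simp_all add: chart_def)
  show sub: "U \<subseteq> topspace T" by (rule openin_subset[OF U])
  then have top: "topspace (subtopology T U) = U" by (simp add: Int_absorb1)
  show "inj_on \<psi> U" using homeomorphic_imp_injective_map[OF h] by (simp only: top)
  have "openin (subtopology T U) (U \<inter> V)" using V by (rule openin_subtopology_Int2)
  then have "openin (subtopology (Euclidean_space d) (\<psi> ` U)) (\<psi> ` (U \<inter> V))"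
    using homeomorphic_imp_open_map[OF h] unfolding open_map_def by blast
  then show "openin (Euclidean_space d) (\<psi> ` (U \<inter> V))"
    using E by (rule openin_trans_full)
qed

lemma immersed_atlas_chart:
  assumes imm: "immersed_submanifold (CH n) S" and c: "(U, \<phi>) \<in> atlas S"
  shows "openin (Euclidean_space (mdim S)) (\<phi> ` U)" "inj_on \<phi> U" "U \<subseteq> ball_CH n"
    "smooth_coord (mdim S) (\<phi> ` U) (2 * n) (inv_into U \<phi>)" "openin (mtop S) U"
proof -
  have sm: "smooth_manifold S" and pts: "points S \<subseteq> ball_CH n"
    and map: "smooth_map S (riem_manifold (CH n)) (\<lambda>x. x)"
    using imm by (simp_all add: immersed_submanifold_def)
  have ch: "chart (mtop S) (mdim S) (U, \<phi>)" using sm c unfolding smooth_manifold_def by blast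
  show o: "openin (Euclidean_space (mdim S)) (\<phi> ` U)" and "openin (mtop S) U"
    using ch by (simp_all add: chart_def)
  have U: "U \<subseteq> points S" by (rule homeomorphic_chart(3)[OF ch openin_topspace])
  show "inj_on \<phi> U" by (rule homeomorphic_chart(2)[OF ch openin_topspace])
  show sub: "U \<subseteq> ball_CH n" using U pts by blast
  have "smooth_coord (mdim S) (\<phi> ` (U \<inter> (\<lambda>x. x) -` ball_CH n)) (2 * n) ((\<lambda>x. x) \<circ> (\<lambda>x. x) \<circ> inv_into U \<phi>)"
    using map c unfolding smooth_map_def riem_manifold_dom by fastforce
  moreover have "U \<inter> (\<lambda>x. x) -` ball_CH n = U" using sub by auto
  moreover have "(\<lambda>x. x) \<circ> (\<lambda>x. x) \<circ> inv_into U \<phi> = inv_into U \<phi>" by auto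
  ultimately show "smooth_coord (mdim S) (\<phi> ` U) (2 * n) (inv_into U \<phi>)" by simp
qed

text \<open>Flatness provides a chart of the maximal atlas, whereas immersion and tangent spaces
  refer to the given atlas. Near \<open>s\<close> the inverse chart factors through a chart of that
  atlas, and the chain rule transfers smoothness and tangency.\<close>

lemma immersed_compatible_chart:
  assumes imm: "immersed_submanifold (CH n) S" and c: "compatible_chart S (U, \<psi>)" and s: "s \<in> U"
  shows "\<exists>W. openin (Euclidean_space (mdim S)) W \<and> \<psi> s \<in> W \<and> W \<subseteq> \<psi> ` U \<and>
    smooth_coord (mdim S) W (2 * n) (inv_into U \<psi>) \<and>
    (\<forall>x\<in>W. \<forall>v\<in>Rn (mdim S). jacobian (mdim S) (2 * n) (inv_into U \<psi>) x v
        \<in> tangent_space (CH n) S (inv_into U \<psi> x))"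
proof -
  let ?k = "mdim S"
  have sm: "smooth_manifold S" using imm by (simp add: immersed_submanifold_def)
  have ch: "chart (mtop S) ?k (U, \<psi>)" using c by (simp add: compatible_chart_def)
  have "s \<in> points S" using homeomorphic_chart(3)[OF ch openin_topspace] s by blast
  then have "s \<in> (\<Union>(U, \<phi>)\<in>atlas S. U)" using sm unfolding smooth_manifold_def by blast
  then obtain U' \<phi> where c': "(U', \<phi>) \<in> atlas S" and s': "s \<in> U'" by auto
  note A = immersed_atlas_chart[OF imm c']
  define W where "W = \<psi> ` (U \<inter> U')"
  have W: "openin (Euclidean_space ?k) W" unfolding W_def by (rule homeomorphic_chart(1)[OF ch A(5)])
  have inj: "inj_on \<psi> U" by (rule homeomorphic_chart(2)[OF ch openin_topspace])
  have g: "inv_into U \<psi> x \<in> U \<inter> U'" if "x \<in> W" for x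
    using that inj unfolding W_def by auto
  have tr: "smooth_coord ?k W ?k (\<phi> \<circ> inv_into U \<psi>)"
    using c c' unfolding compatible_chart_def transition_smooth_def W_def by blast
  have F: "inv_into U' \<phi> ((\<phi> \<circ> inv_into U \<psi>) x) = inv_into U \<psi> x" if "x \<in> W" for x
    using g[OF that] A(2) by simp
  have GV: "(\<phi> \<circ> inv_into U \<psi>) x \<in> \<phi> ` U'" if "x \<in> W" for x using g[OF that] by simp
  have "smooth_coord ?k W (2 * n) (\<lambda>x. inv_into U' \<phi> ((\<phi> \<circ> inv_into U \<psi>) x))"
    by (rule smooth_coord_compose[OF W A(1) GV tr A(4)])
  moreover have "smooth_coord ?k W (2 * n) (\<lambda>x. inv_into U' \<phi> ((\<phi> \<circ> inv_into U \<psi>) x))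
      = smooth_coord ?k W (2 * n) (inv_into U \<psi>)"
    by (rule smooth_coord_cong[OF W]) (rule F)
  ultimately have sm: "smooth_coord ?k W (2 * n) (inv_into U \<psi>)" by blast
  have FR: "inv_into U' \<phi> y \<in> Rn (2 * n)" if "y \<in> \<phi> ` U'" for y
    using inv_into_into[OF that] A(3) ball_CH_subset by blast
  have "jacobian ?k (2 * n) (inv_into U \<psi>) x v \<in> tangent_space (CH n) S (inv_into U \<psi> x)"
    if x: "x \<in> W" and v: "v \<in> Rn ?k" for x v
  proof -
    have "jacobian ?k (2 * n) (inv_into U \<psi>) x v = jacobian ?k (2 * n) (\<lambda>x. inv_into U' \<phi> ((\<phi> \<circ> inv_into U \<psi>) x)) x v"
      by (rule jacobian_cong[OF W x]) (rule F[symmetric])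
    also have "\<dots> = jacobian ?k (2 * n) (inv_into U' \<phi>) ((\<phi> \<circ> inv_into U \<psi>) x) (jacobian ?k ?k (\<phi> \<circ> inv_into U \<psi>) x v)"
      by (rule jacobian_compose[OF W A(1) tr GV A(4) FR x v])
    finally have J: "jacobian ?k (2 * n) (inv_into U \<psi>) x v = jacobian ?k (2 * n) ((\<lambda>x. x) \<circ> inv_into U' \<phi>)
        (\<phi> (inv_into U \<psi> x)) (jacobian ?k ?k (\<phi> \<circ> inv_into U \<psi>) x v)" by (simp add: comp_def)
    show ?thesis
      unfolding tangent_space_def tangent_image_def rdim_CH
      using J c' g[OF x] jacobian_in_Rn by blast
  qed
  moreover have "\<psi> s \<in> W" "W \<subseteq> \<psi> ` U" using s s' by (auto simp: W_def)
  ultimately show ?thesis using W sm by blast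
qed

text \<open>\<open>d\<close> is the determinant, with square 1; the first column is the second one
  turned by a right angle, times \<open>d\<close>.\<close>

lemma orthonormal_columns_imp_rows:
  fixes a0 a1 b0 b1 :: real
  assumes "a0 * a0 + b0 * b0 = 1" "a1 * a1 + b1 * b1 = 1" "a0 * a1 + b0 * b1 = 0"
  shows "a0 * a0 + a1 * a1 = 1" "b0 * b0 + b1 * b1 = 1" "a0 * b0 + a1 * b1 = 0"
proof -
  define d where "d = a0 * b1 - b0 * a1"
  have "d * d = (a0 * a0 + b0 * b0) * (a1 * a1 + b1 * b1) - (a0 * a1 + b0 * b1) * (a0 * a1 + b0 * b1)"
    by (simp add: d_def algebra_simps)
  then have d: "d * d = 1" unfolding assms by simp
  have "b1 * d = a0 * (a1 * a1 + b1 * b1) - a1 * (a0 * a1 + b0 * b1)" by (simp add: d_def algebra_simps)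
  then have 0: "a0 = b1 * d" unfolding assms by simp
  have "- (a1 * d) = b0 * (a1 * a1 + b1 * b1) - b1 * (a0 * a1 + b0 * b1)" by (simp add: d_def algebra_simps)
  then have 1: "b0 = - (a1 * d)" unfolding assms by simp
  have "a0 * a0 + a1 * a1 = b1 * b1 * (d * d) + a1 * a1" unfolding 0 by (simp add: algebra_simps)
  then show "a0 * a0 + a1 * a1 = 1" unfolding d using assms(2) by simp
  have "b0 * b0 + b1 * b1 = a1 * a1 * (d * d) + b1 * b1" unfolding 1 by (simp add: algebra_simps)
  then show "b0 * b0 + b1 * b1 = 1" unfolding d using assms(2) by simp
  have "a0 * b0 + a1 * b1 = - (a1 * b1 * (d * d)) + a1 * b1" unfolding 0 1 by (simp add: algebra_simps)
  then show "a0 * b0 + a1 * b1 = 0" unfolding d by simp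
qed

section \<open>Arbitrary sections and their induced metric\<close>

context polar_family
begin

definition psq :: "(nat \<Rightarrow> real) \<Rightarrow> real" where
  "psq z = (cmod (zp al be (ze z)))\<^sup>2"

lemma smooth_on_psq: "smooth_on (2 * n) (ball_CH n) psq"
  unfolding psq_def[abs_def] zp_def
proof (rule smooth_on_norm_sq)
  note z = csmooth_on_ze[OF n0] and c = csmooth_on_const[OF openin_ball_CH]
  show "csmooth_on (2 * n) (ball_CH n) (\<lambda>x. calbe al * ze x 1 + calbe be * cnj (ze x 2))"
    by (rule csmooth_on_add[OF csmooth_on_mult[OF c z] csmooth_on_mult[OF c csmooth_on_cnj[OF z]]])
qed

text \<open>A section meets every orbit, and orbits are the joint level sets of the two invariants,
  so every admissible pair of values is attained on it.\<close>

lemma section_values: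
  assumes S: "is_section (CH n) Act S" and r: "0 \<le> r" and h: "0 < h"
  shows "\<exists>s\<in>points S. psq s = r \<and> ht n s = h"
proof -
  obtain y where y: "y \<in> ball_CH n" "ht n y = h" "\<And>j. 1 \<le> j \<Longrightarrow> j < n \<Longrightarrow> ze y j = pv al be (calbe (sqrt r)) j"
    using ex_siegel_point[OF h, of 0 "pv al be (calbe (sqrt r))"] by blast
  have "zp al be (ze y) = zp al be (pv al be (calbe (sqrt r)))"
    by (rule zp_cong) (use y(3) n3 in auto)
  then have zy: "(cmod (zp al be (ze y)))\<^sup>2 = r" using r by (simp add: zp_pv)
  obtain s where s: "s \<in> points S" "s \<in> orbit_of Act y"
    using S y(1) unfolding is_section_def by blast
  then show ?thesis using orbit_iff[OF y(1)] y(2) zy by (auto simp: psq_def)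
qed

text \<open>A section of dimension at most one would map, by the orbit invariants, onto a quarter plane;
  but images of curves are negligible.\<close>

lemma section_dim:
  assumes S: "is_section (CH n) Act S"
  shows "2 \<le> mdim S"
proof (rule ccontr)
  assume "\<not> 2 \<le> mdim S"
  then have d: "mdim S \<le> 1" by simp
  have imm: "immersed_submanifold (CH n) S" using S by (simp add: is_section_def)
  have sm: "smooth_manifold S" using imm by (simp add: immersed_submanifold_def)
  \<comment> \<open>Treats dimensions 0 and 1 alike: \<open>Rn (mdim S)\<close> is parametrised by
    one real number, constantly in dimension 0.\<close>
  define e where "e t = (\<lambda>i. if i < mdim S then t else 0 :: real)" for t
  have diff: "(\<lambda>t. f (e t)) differentiable (at t)"
    if f: "smooth_on (mdim S) V f" and t: "e t \<in> V" for f V t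
  proof (cases "mdim S = 0")
    case True
    then show ?thesis by (simp add: e_def)
  next
    case False
    then have 1: "mdim S = 1" using d by simp
    have "Ck_on (Suc 0) (mdim S) V f" using f by (simp add: smooth_on_def del: Ck_on.simps)
    from has_partial[OF this t, of 0] have "((\<lambda>x. f ((e t)(0 := x))) has_real_derivative partial 0 f (e t)) (at (e t 0))"
      using 1 by simp
    moreover have "(e t)(0 := x) = e x" for x using 1 by (auto simp: e_def fun_upd_apply)
    moreover have "e t 0 = t" using 1 by (simp add: e_def)
    ultimately have "((\<lambda>x. f (e x)) has_real_derivative partial 0 f (e t)) (at t)" by simp
    then show ?thesis unfolding real_differentiable_def by blast
  qed
  have neg: "negligible ((\<lambda>s. (psq s, ht n s)) ` U)" if c: "(U, \<phi>) \<in> atlas S" for U \<phi>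
  proof -
    note A = immersed_atlas_chart[OF imm c]
    define T where "T = {t. e t \<in> \<phi> ` U}"
    define h where "h t = (psq (inv_into U \<phi> (e t)), ht n (inv_into U \<phi> (e t)))" for t
    have inb: "inv_into U \<phi> x \<in> ball_CH n" if "x \<in> \<phi> ` U" for x
      using inv_into_into[OF that] A(3) by blast
    have sj: "\<And>j. j < 2 * n \<Longrightarrow> smooth_on (mdim S) (\<phi> ` U) (\<lambda>x. inv_into U \<phi> x j)"
      using A(4) by (simp add: smooth_coord_iff[OF A(1)])
    have "smooth_on (mdim S) (\<phi> ` U) (\<lambda>x. psq (inv_into U \<phi> x))"
      by (rule smooth_on_compose[OF A(1) inb sj smooth_on_psq])
    moreover have "smooth_on (mdim S) (\<phi> ` U) (\<lambda>x. ht n (inv_into U \<phi> x))"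
      by (rule smooth_on_compose[OF A(1) inb sj smooth_on_ht[OF n0]])
    ultimately have "h differentiable (at t)" if "t \<in> T" for t
      unfolding h_def using that diff by (intro differentiable_Pair) (auto simp: T_def)
    then have "h differentiable_on T"
      unfolding differentiable_on_def using differentiable_at_withinI by blast
    then have "negligible (h ` T)"
      by (rule negligible_differentiable_image_lowdim[rotated]) simp
    moreover have "(\<lambda>s. (psq s, ht n s)) ` U \<subseteq> h ` T"
    proof
      fix w assume "w \<in> (\<lambda>s. (psq s, ht n s)) ` U"
      then obtain s where s: "s \<in> U" "w = (psq s, ht n s)" by blast
      have "\<phi> s \<in> Rn (mdim S)" using openin_Rn_subset[OF A(1)] s(1) by blast
      then have "e (\<phi> s 0) = \<phi> s" using d by (auto simp: e_def Rn_iff fun_eq_iff le_Suc_eq)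
      then have "h (\<phi> s 0) = w" "\<phi> s 0 \<in> T" using s A(2) by (simp_all add: h_def T_def)
      then show "w \<in> h ` T" by blast
    qed
    ultimately show ?thesis using negligible_subset by blast
  qed
  \<comment> \<open>The atlas may be uncountable; second countability reduces it to countably many
    chart domains, so that their negligible images have a negligible union.\<close>
  have Lin: "Lindelof_space (mtop S)"
    using sm second_countable_imp_Lindelof_space unfolding smooth_manifold_def by blast
  have cov: "(\<Union>(fst ` atlas S)) = points S" "\<And>U. U \<in> fst ` atlas S \<Longrightarrow> openin (mtop S) U"
    using sm immersed_atlas_chart(5)[OF imm] unfolding smooth_manifold_def by (auto simp: case_prod_beta)
  obtain V where V: "countable V" "V \<subseteq> fst ` atlas S" "\<Union>V = points S"
    using Lin cov unfolding Lindelof_space_def by metis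
  have "negligible (\<Union>((\<lambda>U. (\<lambda>s. (psq s, ht n s)) ` U) ` V))"
    by (rule negligible_countable_Union) (use V neg in auto)
  \<comment> \<open>This ball lies inside the quarter plane of attained values.\<close>
  moreover have "ball (1, 1) 1 \<subseteq> \<Union>((\<lambda>U. (\<lambda>s. (psq s, ht n s)) ` U) ` V)"
  proof
    fix w :: "real \<times> real" assume w: "w \<in> ball (1, 1) 1"
    obtain r h where rh: "w = (r, h)" by (cases w)
    have "dist 1 r \<le> dist (1, 1) (r, h)" "dist 1 h \<le> dist (1, 1) (r, h)"
      using dist_fst_le[of "(1,1)" "(r,h)"] dist_snd_le[of "(1,1)" "(r,h)"] by simp_all
    then have "dist 1 r < 1" "dist 1 h < 1" using w unfolding rh mem_ball by linarith+
    then have "0 \<le> r" "0 < h" by (auto simp: dist_real_def abs_less_iff)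
    then obtain s where s: "s \<in> points S" "psq s = r" "ht n s = h" using section_values[OF S] by blast
    then obtain U where "U \<in> V" "s \<in> U" using V(3) by blast
    then show "w \<in> \<Union>((\<lambda>U. (\<lambda>s. (psq s, ht n s)) ` U) ` V)" using s rh by blast
  qed
  ultimately have "negligible (ball (1::real, 1::real) 1)" using negligible_subset by blast
  then show False using open_not_negligible[of "ball (1::real, 1::real) 1"] by simp
qed

text \<open>\<open>t\<close> is paired with three kinds of orbit directions: the centre makes
  \<open>bet\<close> real, the translations remove everything orthogonal to the plane, and the
  circle makes the plane component a real multiple of that of \<open>p\<close>. Two real parameters
  remain.\<close>

lemma normal_vector:
  assumes p: "p \<in> ball_CH n" and a: "zp al be (ze p) \<noteq> 0"
    and orth: "\<And>w. w \<in> orbit_tangent_space (CH n) Act p \<Longrightarrow> rmetric (CH n) p t w = 0"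
  shows "Im (bet n p t) = 0"
    and "\<exists>c. \<forall>j. 1 \<le> j \<and> j < n \<longrightarrow> dze p t j = pv al be (calbe c * zp al be (ze p)) j"
proof -
  define V where "V u = jacobian D (2 * n) (\<lambda>g. gact n al be g p) (gone n) u" for u
  have h: "0 < ht n p" by (rule ht_pos[OF p n0])
  have o: "Re (dot n (dze p t) (dze p (V u))) / ht n p + Re (bet n p t * cnj (bet n p (V u))) / (ht n p)\<^sup>2 = 0"
    if u: "u \<in> Rn D" for u
  proof -
    have "rmetric (CH n) p t (V u) = 0"
      by (rule orth) (use u in \<open>simp add: orbit_tangent[OF p] V_def\<close>)
    then have "Re (dot n (dze p t) (dze p (V u)) / ht n p + bet n p t * cnj (bet n p (V u)) / (ht n p)\<^sup>2) = 0"
      unfolding rmetric_siegel[OF p n0] by linarith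
    then show ?thesis unfolding of_real_power[symmetric] plus_complex.sel Re_divide_of_real .
  qed
  note nrm = orbit_velocity_normal[OF p, folded V_def] and vel = orbit_velocity[OF p, folded V_def]
  have cv: "cplx (cvec (n - 1) c) k = c k" if "k < n - 1" for c k using that by (rule cplx_vec)
  show im: "Im (bet n p t) = 0"
  proof -
    define u where "u = cvec (n - 1) (\<lambda>k. if k = 0 then 1 else 0)"
    have u: "u \<in> Rn D" by (simp add: u_def vec_in_Rn)
    have u0: "cplx u 0 = 1" and uk: "\<And>k. 1 \<le> k \<Longrightarrow> k < n - 1 \<Longrightarrow> cplx u k = 0"
      using n1 by (simp_all add: u_def cplx_vec)
    have tz: "tau u j = 0" if "1 \<le> j" "j < n" for j
    proof -
      consider "j = 1" | "j = 2" | "3 \<le> j" using \<open>1 \<le> j\<close> by linarith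
      then show ?thesis
      proof cases
        case 3
        then have "1 \<le> j - 1" "j - 1 < n - 1" using that by auto
        from uk[OF this] 3 show ?thesis by (simp add: gtau_def)
      qed (use uk[of 1] n1 in \<open>simp_all add: gtau_def\<close>)
    qed
    have dz: "dze p (V u) j = 0" if "1 \<le> j" "j < n" for j
      using vel(2)[OF u that] tz[OF that] u0 by simp
    have d0: "dot n v (dze p (V u)) = dot n v (\<lambda>_. 0)" "dot n (ze p) (tau u) = dot n (ze p) (\<lambda>_. 0)"
      "dot n (dze p (V u)) v = dot n (\<lambda>_. 0) v" for v
      by (rule dot_cong; simp add: dz tz)+
    have bv: "bet n p (V u) = \<i> / 2" unfolding bet_def vel(1)[OF u] d0 by (simp add: dot_def u0)
    show ?thesis using o[OF u] h unfolding d0 bv by (simp add: dot_def)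
  qed
  have o': "Re (dot n (dze p t) (dze p (V u))) = 0" if u: "u \<in> Rn D" for u
    using o[OF u] nrm(1)[OF u] im h by simp
  define b where "b = zp al be (dze p t)"
  have pb: "dze p t j = pv al be b j" if j: "1 \<le> j" "j < n" for j
  proof -
    \<comment> \<open>The translation along the part of \<open>dze p t\<close> orthogonal to the
      plane; its product with \<open>dze p t\<close> is the squared norm of that part.\<close>
    define u where "u = cvec (n - 1) (\<lambda>k. if k = 0 then 0 else if k = 1 then wp al be (dze p t) else dze p t (k + 1))"
    have u: "u \<in> Rn D" by (simp add: u_def vec_in_Rn)
    have u0: "cplx u 0 = 0" and u1: "cplx u 1 = wp al be (dze p t)"
      and uk: "\<And>k. 2 \<le> k \<Longrightarrow> k < n - 1 \<Longrightarrow> cplx u k = dze p t (k + 1)"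
      using n1 by (simp_all add: u_def cplx_vec)
    have tp: "tau u i = perp al be (dze p t) i" if i: "1 \<le> i" "i < n" for i
    proof -
      consider "i = 1" | "i = 2" | "3 \<le> i" using i by linarith
      then show ?thesis
      proof cases
        case 3
        then have "2 \<le> i - 1" "i - 1 < n - 1" "i - 1 + 1 = i" using i by auto
        moreover have "i \<noteq> 1" "i \<noteq> 2" using 3 by auto
        ultimately show ?thesis using uk[of "i - 1"] by (simp add: gtau_def perp_def pv_def)
      next
        case 1
        have "perp al be (dze p t) 1 = dze p t 1 - calbe al * zp al be (dze p t)" by (simp add: perp_def pv_def)
        also have "\<dots> = calbe be * wp al be (dze p t)"
          by (subst zp_wp(1)[of "dze p t"]) simp
        finally show ?thesis using 1 u1 by (simp add: gtau_def)
      next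
        case 2
        have "perp al be (dze p t) 2 = dze p t 2 - calbe be * cnj (zp al be (dze p t))" by (simp add: perp_def pv_def)
        also have "\<dots> = - calbe al * cnj (wp al be (dze p t))"
          by (subst zp_wp(2)[of "dze p t"]) simp
        finally show ?thesis using 2 u1 by (simp add: gtau_def)
      qed
    qed
    have "dze p (V u) i = perp al be (dze p t) i" if "1 \<le> i" "i < n" for i
      using vel(2)[OF u that] tp[OF that] u0 by simp
    then have "dot n (dze p t) (dze p (V u)) = dot n (\<lambda>j. pv al be b j + perp al be (dze p t) j) (perp al be (dze p t))"
      by (intro dot_cong) (simp_all add: perp_def b_def)
    then have "Re (dot n (dze p t) (dze p (V u))) = Re (dot n (perp al be (dze p t)) (perp al be (dze p t)))"
      unfolding dot_add_left by (simp add: Re_dot_pv zp_perp)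
    then have "Re (dot n (perp al be (dze p t)) (perp al be (dze p t))) = 0" using o'[OF u] by simp
    from dot_self_eq_0[OF this j] show ?thesis by (simp add: perp_def b_def)
  qed
  \<comment> \<open>The direction of the circle.\<close>
  define u where "u = cvec (n - 1) (\<lambda>k. if k = 0 then \<i> else 0)"
  have u: "u \<in> Rn D" by (simp add: u_def vec_in_Rn)
  have u0: "cplx u 0 = \<i>" using n1 by (simp add: u_def cplx_vec)
  have "dot n (dze p t) (dze p (V u)) = dot n (pv al be b) (dze p (V u))"
    by (rule dot_cong) (simp_all add: pb)
  then have "Re (b * cnj (zp al be (dze p (V u)))) = 0" using o'[OF u] by (simp add: Re_dot_pv)
  then have i0: "Im (b * cnj (zp al be (ze p))) = 0" using nrm(2)[OF u] u0 by simp
  define c where "c = Re (b * cnj (zp al be (ze p))) / (cmod (zp al be (ze p)))\<^sup>2"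
  have "b * cnj (zp al be (ze p)) = calbe (Re (b * cnj (zp al be (ze p))))"
    using i0 by (simp add: complex_eq_iff)
  moreover have "cnj (zp al be (ze p)) * zp al be (ze p) = calbe ((cmod (zp al be (ze p)))\<^sup>2)"
    using complex_norm_square[of "zp al be (ze p)"] by (simp add: mult.commute)
  ultimately have "b * calbe ((cmod (zp al be (ze p)))\<^sup>2) = calbe (Re (b * cnj (zp al be (ze p)))) * zp al be (ze p)"
    using mult.assoc[of b "cnj (zp al be (ze p))" "zp al be (ze p)"] by simp
  then have "b = calbe c * zp al be (ze p)" using a by (simp add: c_def eq_divide_eq)
  then show "\<exists>c. \<forall>j. 1 \<le> j \<and> j < n \<longrightarrow> dze p t j = pv al be (calbe c * zp al be (ze p)) j"
    using pb by blast
qed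

text \<open>Expresses the differentials of the invariants by the components \<open>bet\<close> and
  \<open>dze\<close> in which the metric is diagonal.\<close>

lemma invariant_derivatives:
  assumes c: "has_velocity c v s" and b: "c s \<in> ball_CH n"
  shows "((\<lambda>t. ht n (c t)) has_real_derivative 2 * Re (bet n (c s) v)) (at s)"
    and "((\<lambda>t. psq (c t)) has_real_derivative 2 * Re (cnj (zp al be (ze (c s))) * zp al be (dze (c s) v))) (at s)"
proof -
  note o = om_velocity[OF c b n0] and z = ze_velocity[OF c b n0]
  have re: "((\<lambda>t. Re (f t)) has_real_derivative Re f') (at s)" if "(f has_vector_derivative f') (at s)" for f f'
    using that by (simp add: has_vector_derivative_complex_iff)
  have "((\<lambda>t. dot n (ze (c t)) (ze (c t))) has_vector_derivative
      (\<Sum>j=1..<n. ze (c s) j * cnj (dze (c s) v j) + dze (c s) v j * cnj (ze (c s) j))) (at s)"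
    unfolding dot_def
    by (intro has_vector_derivative_sum has_vector_derivative_mult z
        bounded_linear.has_vector_derivative[OF bounded_linear_cnj])
  moreover have "(\<Sum>j=1..<n. ze (c s) j * cnj (dze (c s) v j) + dze (c s) v j * cnj (ze (c s) j))
     = dot n (ze (c s)) (dze (c s) v) + dot n (dze (c s) v) (ze (c s))"
    by (simp add: dot_def sum.distrib)
  ultimately have "((\<lambda>t. om (c t) - dot n (ze (c t)) (ze (c t))) has_vector_derivative
      dom (c s) v - (dot n (ze (c s)) (dze (c s) v) + dot n (dze (c s) v) (ze (c s)))) (at s)"
    using has_vector_derivative_diff[OF o] by simp
  from re[OF this] have "((\<lambda>t. ht n (c t)) has_real_derivative
      Re (dom (c s) v) - (Re (dot n (ze (c s)) (dze (c s) v)) + Re (dot n (dze (c s) v) (ze (c s))))) (at s)"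
    by (simp add: ht_def)
  moreover have "Re (dom (c s) v) - (Re (dot n (ze (c s)) (dze (c s) v)) + Re (dot n (dze (c s) v) (ze (c s))))
     = 2 * Re (bet n (c s) v)"
    using Re_dot_commute[of n "ze (c s)" "dze (c s) v"] by (simp add: bet_def)
  ultimately show "((\<lambda>t. ht n (c t)) has_real_derivative 2 * Re (bet n (c s) v)) (at s)" by simp
  have zpd: "((\<lambda>t. zp al be (ze (c t))) has_vector_derivative zp al be (dze (c s) v)) (at s)"
    unfolding zp_def
    by (intro has_vector_derivative_add has_vector_derivative_mult_right z
        bounded_linear.has_vector_derivative[OF bounded_linear_cnj])
  have "((\<lambda>t. zp al be (ze (c t)) * cnj (zp al be (ze (c t)))) has_vector_derivative
      zp al be (ze (c s)) * cnj (zp al be (dze (c s) v)) + zp al be (dze (c s) v) * cnj (zp al be (ze (c s)))) (at s)"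
    by (intro has_vector_derivative_mult zpd bounded_linear.has_vector_derivative[OF bounded_linear_cnj])
  from re[OF this]
  have "((\<lambda>t. Re (zp al be (ze (c t)) * cnj (zp al be (ze (c t))))) has_real_derivative
      2 * Re (cnj (zp al be (ze (c s))) * zp al be (dze (c s) v))) (at s)"
    by (rule DERIV_cong) (simp add: algebra_simps)
  moreover have "Re (w * cnj w) = (cmod w)\<^sup>2" for w unfolding cmod_power2 by (simp add: power2_eq_square)
  ultimately show "((\<lambda>t. psq (c t)) has_real_derivative 2 * Re (cnj (zp al be (ze (c s))) * zp al be (dze (c s) v))) (at s)"
    by (simp add: psq_def)
qed

text \<open>Tangent vectors of a section are normal to the orbits, hence, where \<open>p\<close> is
  positive, their metric products are determined by the differentials of \<open>p\<close> and
  \<open>y\<close>: the metric is \<open>dp\<^sup>2 / (p y) + dy\<^sup>2 / y\<^sup>2\<close>. With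
  \<open>p = r\<^sup>2\<close> and \<open>y = v\<^sup>2\<close> this is
  \<open>4 (dr\<^sup>2 + dv\<^sup>2) / v\<^sup>2\<close>, of curvature -1/4.\<close>

lemma not_flat_section:
  assumes S: "is_section (CH n) Act S"
  shows "\<not> flat_submanifold (CH n) S"
proof
  assume flat: "flat_submanifold (CH n) S"
  define k where "k = mdim S"
  have k2: "2 \<le> k" using section_dim[OF S] by (simp add: k_def)
  have imm: "immersed_submanifold (CH n) S" using S by (simp add: is_section_def)
  have pts: "points S \<subseteq> ball_CH n" using imm by (simp add: immersed_submanifold_def)
  \<comment> \<open>A point off the singular orbits, since \<open>normal_vector\<close> requires a
    nonzero plane component.\<close>
  obtain s where s: "s \<in> points S" "psq s = 1" using section_values[OF S, of 1 1] by auto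
  obtain U \<psi> where U: "s \<in> U" "compatible_chart S (U, \<psi>)"
    and met0: "\<forall>q\<in>U. \<forall>v\<in>Rn (mdim S). \<forall>w\<in>Rn (mdim S).
      rmetric (CH n) q (jacobian (mdim S) (rdim (CH n)) (inv_into U \<psi>) (\<psi> q) v)
        (jacobian (mdim S) (rdim (CH n)) (inv_into U \<psi>) (\<psi> q) w) = (\<Sum>i<mdim S. v i * w i)"
    using flat s(1) unfolding flat_submanifold_def by blast
  have met: "\<And>p v w. p \<in> U \<Longrightarrow> v \<in> Rn k \<Longrightarrow> w \<in> Rn k \<Longrightarrow>
      rmetric (CH n) p (jacobian k (2 * n) (inv_into U \<psi>) (\<psi> p) v) (jacobian k (2 * n) (inv_into U \<psi>) (\<psi> p) w)
        = (\<Sum>i<k. v i * w i)"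
    using met0 unfolding rdim_CH k_def by blast
  define \<gamma> where "\<gamma> = inv_into U \<psi>"
  obtain W0 where W0: "openin (Euclidean_space k) W0" "\<psi> s \<in> W0" "W0 \<subseteq> \<psi> ` U" "smooth_coord k W0 (2 * n) \<gamma>"
    and tan: "\<And>x v. x \<in> W0 \<Longrightarrow> v \<in> Rn k \<Longrightarrow> jacobian k (2 * n) \<gamma> x v \<in> tangent_space (CH n) S (\<gamma> x)"
    using immersed_compatible_chart[OF imm U(2,1), folded k_def \<gamma>_def] by (elim exE conjE) blast
  have ch: "chart (mtop S) k (U, \<psi>)" using U(2) by (simp add: compatible_chart_def k_def)
  have inj: "inj_on \<psi> U" and Usub: "U \<subseteq> points S" using homeomorphic_chart(2,3)[OF ch openin_topspace] by auto
  have gU: "\<gamma> x \<in> U" and pg: "\<psi> (\<gamma> x) = x" if "x \<in> W0" for x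
    using inv_into_into[of x \<psi> U] f_inv_into_f[of x \<psi> U] that W0(3) unfolding \<gamma>_def by blast+
  have gb: "\<gamma> x \<in> ball_CH n" if "x \<in> W0" for x using gU[OF that] Usub pts by blast
  have sj: "\<And>j. j < 2 * n \<Longrightarrow> smooth_on k W0 (\<lambda>x. \<gamma> x j)" using W0(4) by (simp add: smooth_coord_iff[OF W0(1)])
  define p y where "p x = psq (\<gamma> x)" and "y x = ht n (\<gamma> x)" for x
  have p0: "smooth_on k W0 p" unfolding p_def by (rule smooth_on_compose[OF W0(1) gb sj smooth_on_psq])
  have y0: "smooth_on k W0 y" unfolding y_def by (rule smooth_on_compose[OF W0(1) gb sj smooth_on_ht[OF n0]])
  define W where "W = {x \<in> W0. 0 < p x}"
  have W: "openin (Euclidean_space k) W"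
  proof -
    have "continuous_map (subtopology (Euclidean_space k) W0) euclideanreal p"
      using smooth_on_continuous[OF p0] continuous_map_Rn[OF openin_Rn_subset[OF W0(1)]] by blast
    then have "openin (subtopology (Euclidean_space k) W0) {x \<in> topspace (subtopology (Euclidean_space k) W0). p x \<in> {0<..}}"
      by (rule openin_continuous_map_preimage) simp
    moreover have "{x \<in> topspace (subtopology (Euclidean_space k) W0). p x \<in> {0<..}} = W"
      using openin_Rn_subset[OF W0(1)] by (auto simp: W_def)
    ultimately have "openin (subtopology (Euclidean_space k) W0) W" by simp
    then show ?thesis using W0(1) by (rule openin_trans_full)
  qed
  have WW0: "W \<subseteq> W0" by (auto simp: W_def)
  have pW: "smooth_on k W p" "smooth_on k W y"
    using smooth_on_subset[OF p0 W WW0] smooth_on_subset[OF y0 W WW0] by auto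
  have "\<gamma> (\<psi> s) = s" unfolding \<gamma>_def using inj U(1) by simp
  then have x0: "\<psi> s \<in> W" using W0(2) s(2) by (simp add: W_def p_def)
  have ypos: "0 < y x" if "x \<in> W" for x unfolding y_def by (rule ht_pos[OF gb n0]) (use that WW0 in blast)
  have ppos: "0 < p x" if "x \<in> W" for x using that by (simp add: W_def)
  \<comment> \<open>The flat metric on two coordinate vectors, rewritten by the partials of the
    invariants.\<close>
  have rel: "partial i p x * partial j p x / (p x * y x) + partial i y x * partial j y x / (y x)\<^sup>2
      = (if i = j then 1 else 0)" if x: "x \<in> W" and i: "i < k" and j: "j < k" for x i j
  proof -
    have xW0: "x \<in> W0" using x WW0 by blast
    note b = gb[OF xW0]
    define a where "a = zp al be (ze (\<gamma> x))"
    have pa: "p x = (cmod a)\<^sup>2" by (simp add: p_def psq_def a_def)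
    have a0: "a \<noteq> 0" using ppos[OF x] pa by auto
    define E where "E i = (\<lambda>l. if l = i then 1 else 0 :: real)" for i :: nat
    define t where "t i = jacobian k (2 * n) \<gamma> x (E i)" for i
    have ER: "E i \<in> Rn k" if "i < k" for i using that by (auto simp: E_def Rn_iff)
    have orth: "rmetric (CH n) (\<gamma> x) (t i) w = 0" if "i < k" "w \<in> orbit_tangent_space (CH n) Act (\<gamma> x)" for i w
      using S tan[OF xW0 ER[OF that(1)]] that(2) gU[OF xW0] Usub unfolding is_section_def t_def by blast
    have vel: "has_velocity (\<lambda>r. \<gamma> (x(i := r))) (t i) (x i)" if i: "i < k" for i
    proof -
      have "has_velocity (\<lambda>r. x(i := r)) (E i) (x i)"
        unfolding has_velocity_def E_def by (auto simp: fun_upd_apply)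
      moreover have "\<gamma> z \<in> Rn (2 * n)" if "z \<in> W0" for z using gb[OF that] ball_CH_subset by blast
      moreover have "x(i := x i) \<in> W0" using xW0 by simp
      moreover have "x(i := r) \<in> Rn k" for r using xW0 openin_Rn_subset[OF W0(1)] upd_in_Rn[OF _ i] by blast
      then have "eventually (\<lambda>r. x(i := r) \<in> Rn k) (nhds (x i))" by simp
      ultimately have "has_velocity (\<lambda>r. \<gamma> (x(i := r))) (jacobian k (2 * n) \<gamma> (x(i := x i)) (E i)) (x i)"
        using has_velocity_map[OF W0(1,4), of "\<lambda>r. x(i := r)"] by blast
      then show ?thesis by (simp add: t_def)
    qed
    have up: "x(i := x i) = x" for i by simp
    have yi: "partial i y x = 2 * Re (bet n (\<gamma> x) (t i))" and pi: "partial i p x = 2 * Re (cnj a * zp al be (dze (\<gamma> x) (t i)))"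
      if i: "i < k" for i
    proof -
      have b': "\<gamma> (x(i := x i)) \<in> ball_CH n" using b by simp
      note d = invariant_derivatives[OF vel[OF i] b', unfolded up]
      show "partial i y x = 2 * Re (bet n (\<gamma> x) (t i))" "partial i p x = 2 * Re (cnj a * zp al be (dze (\<gamma> x) (t i)))"
        using partial_eqI[of "\<lambda>x. ht n (\<gamma> x)" x i, OF d(1)] partial_eqI[of "\<lambda>x. psq (\<gamma> x)" x i, OF d(2)]
        unfolding y_def[abs_def] p_def[abs_def] a_def .
    qed
    have N: "Im (bet n (\<gamma> x) (t i)) = 0" "\<exists>c. \<forall>j. 1 \<le> j \<and> j < n \<longrightarrow> dze (\<gamma> x) (t i) j = pv al be (calbe c * a) j"
      if i: "i < k" for i
      using normal_vector[OF b _ orth[OF i], folded a_def, OF a0] by simp_all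
    obtain ci where ci: "\<And>l. 1 \<le> l \<Longrightarrow> l < n \<Longrightarrow> dze (\<gamma> x) (t i) l = pv al be (calbe ci * a) l" using N(2)[OF i] by blast
    obtain cj where cj: "\<And>l. 1 \<le> l \<Longrightarrow> l < n \<Longrightarrow> dze (\<gamma> x) (t j) l = pv al be (calbe cj * a) l" using N(2)[OF j] by blast
    have zpc: "zp al be (dze (\<gamma> x) v) = b" if "\<And>l. 1 \<le> l \<Longrightarrow> l < n \<Longrightarrow> dze (\<gamma> x) v l = pv al be b l" for v b
    proof -
      have "zp al be (dze (\<gamma> x) v) = zp al be (pv al be b)" by (rule zp_cong) (use that n3 in auto)
      then show ?thesis by (simp add: zp_pv)
    qed
    have aa: "Re (cnj a * (calbe c * a)) = c * p x" for c
      unfolding pa cmod_power2 by (simp add: power2_eq_square algebra_simps)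
    have zi: "zp al be (dze (\<gamma> x) (t i)) = calbe ci * a" by (rule zpc) (rule ci)
    have zj: "zp al be (dze (\<gamma> x) (t j)) = calbe cj * a" by (rule zpc) (rule cj)
    have Pi: "partial i p x = 2 * ci * p x" and Pj: "partial j p x = 2 * cj * p x"
      unfolding pi[OF i] pi[OF j] zi zj aa by simp_all
    define Bi Bj where "Bi = Re (bet n (\<gamma> x) (t i))" and "Bj = Re (bet n (\<gamma> x) (t j))"
    have Yi: "partial i y x = 2 * Bi" and Yj: "partial j y x = 2 * Bj"
      unfolding yi[OF i] yi[OF j] Bi_def Bj_def by simp_all
    have "dot n (dze (\<gamma> x) (t i)) (dze (\<gamma> x) (t j)) = dot n (pv al be (calbe ci * a)) (pv al be (calbe cj * a))"
      by (rule dot_cong) (simp_all add: ci cj)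
    then have d: "Re (dot n (dze (\<gamma> x) (t i)) (dze (\<gamma> x) (t j))) = ci * cj * p x"
      unfolding pa cmod_power2 by (simp add: Re_dot_pv zp_pv power2_eq_square algebra_simps)
    have bb: "Re (bet n (\<gamma> x) (t i) * cnj (bet n (\<gamma> x) (t j))) = Bi * Bj"
      using N(1)[OF i] N(1)[OF j] by (simp add: Bi_def Bj_def)
    have "rmetric (CH n) (\<gamma> x) (t i) (t j) = 4 * (ci * cj * p x / y x + Bi * Bj / (y x)\<^sup>2)"
      unfolding rmetric_siegel[OF b n0] y_def d[symmetric] bb[symmetric]
      unfolding of_real_power[symmetric] plus_complex.sel Re_divide_of_real ..
    moreover have "rmetric (CH n) (\<gamma> x) (t i) (t j) = (\<Sum>l<k. E i l * E j l)"
      using met[OF gU[OF xW0] ER[OF i] ER[OF j]] unfolding pg[OF xW0] \<gamma>_def[symmetric] t_def[symmetric] .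
    moreover have "(\<Sum>l<k. E i l * E j l) = (if i = j then 1 else 0)"
    proof -
      have "(\<Sum>l<k. E i l * E j l) = (\<Sum>l<k. if l = i then E j i else 0)"
        by (intro sum.cong refl) (simp add: E_def)
      also have "\<dots> = E j i" using i by simp
      finally show ?thesis by (auto simp: E_def)
    qed
    ultimately have m: "4 * (ci * cj * p x / y x + Bi * Bj / (y x)\<^sup>2) = (if i = j then 1 else 0)" by simp
    have "2 * ci * p x * (2 * cj * p x) / (p x * y x) + 2 * Bi * (2 * Bj) / (y x)\<^sup>2
       = 4 * (ci * cj * p x / y x + Bi * Bj / (y x)\<^sup>2)"
      using ppos[OF x] ypos[OF x] by (simp add: field_simps)
    then show ?thesis unfolding Pi Pj Yi Yj m .
  qed
  \<comment> \<open>Components of the coordinate vectors in an orthonormal coframe: by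
    \<open>rel\<close> the pairs \<open>(A x i, B x i)\<close> are orthonormal in the Euclidean
    plane.\<close>
  define A where "A x i = partial i p x / sqrt (p x * y x)" for x i
  define B where "B x i = partial i y x / y x" for x i
  have AB: "A x i * A x j + B x i * B x j = (if i = j then 1 else 0)" if "x \<in> W" "i < k" "j < k" for x i j
  proof -
    have "0 < p x * y x" using ppos[OF that(1)] ypos[OF that(1)] by simp
    then have "A x i * A x j = partial i p x * partial j p x / (p x * y x)"
      unfolding A_def by simp
    moreover have "B x i * B x j = partial i y x * partial j y x / (y x)\<^sup>2" by (simp add: B_def power2_eq_square)
    ultimately show ?thesis using rel[OF that] by simp
  qed
  have rows: "A x 0 * A x 0 + A x 1 * A x 1 = 1" "B x 0 * B x 0 + B x 1 * B x 1 = 1" "A x 0 * B x 0 + A x 1 * B x 1 = 0"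
    if x: "x \<in> W" for x
    using orthonormal_columns_imp_rows[of "A x 0" "B x 0" "A x 1" "B x 1"]
      AB[OF x, of 0 0] AB[OF x, of 1 1] AB[OF x, of 0 1] k2 by auto
  show False
  proof (cases "k = 2")
    \<comment> \<open>In dimension three or more, a third unit vector of the plane would be
      orthogonal to both vectors of an orthonormal basis.\<close>
    case False
    define x where "x = \<psi> s"
    have x: "x \<in> W" using x0 by (simp add: x_def)
    define a0 a1 a2 b0 b1 b2 where "a0 = A x 0" and "a1 = A x 1" and "a2 = A x 2"
      and "b0 = B x 0" and "b1 = B x 1" and "b2 = B x 2"
    have e: "a2 * a0 + b2 * b0 = 0" "a2 * a1 + b2 * b1 = 0" "a2 * a2 + b2 * b2 = 1"
      using AB[OF x, of 2 0] AB[OF x, of 2 1] AB[OF x, of 2 2] k2 False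
      by (simp_all add: a0_def a1_def a2_def b0_def b1_def b2_def)
    have r: "a0 * a0 + a1 * a1 = 1" "b0 * b0 + b1 * b1 = 1" "a0 * b0 + a1 * b1 = 0"
      using rows[OF x] by (simp_all add: a0_def a1_def b0_def b1_def)
    have "a2 * (a0 * a0 + a1 * a1) + b2 * (a0 * b0 + a1 * b1) = a0 * (a2 * a0 + b2 * b0) + a1 * (a2 * a1 + b2 * b1)"
      by (simp add: algebra_simps)
    then have "a2 = 0" unfolding e r by simp
    have "a2 * (a0 * b0 + a1 * b1) + b2 * (b0 * b0 + b1 * b1) = b0 * (a2 * a0 + b2 * b0) + b1 * (a2 * a1 + b2 * b1)"
      by (simp add: algebra_simps)
    then have "b2 = 0" unfolding e r by simp
    then show False using e(3) \<open>a2 = 0\<close> by simp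
  next
    case True
    have Pe: "partial i p x = A x i * sqrt (p x * y x)" and Ye: "partial i y x = B x i * y x" if "x \<in> W" for x i
      using ppos[OF that] ypos[OF that] by (simp_all add: A_def B_def)
    have sq: "sqrt (p x * y x) * sqrt (p x * y x) = p x * y x" if "x \<in> W" for x
      using ppos[OF that] ypos[OF that] by simp
    show False
    proof (rule no_flat_hyperbolic_coordinates[OF pW[unfolded True] x0 ppos ypos])
      fix x assume x: "x \<in> W"
      have "partial 0 y x * partial 0 y x + partial 1 y x * partial 1 y x = (B x 0 * B x 0 + B x 1 * B x 1) * (y x * y x)"
        unfolding Ye[OF x] by (simp add: algebra_simps)
      then show "partial 0 y x * partial 0 y x + partial 1 y x * partial 1 y x = y x * y x" unfolding rows[OF x] by simp
      have "partial 0 p x * partial 0 p x + partial 1 p x * partial 1 p x =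
          (A x 0 * A x 0 + A x 1 * A x 1) * (sqrt (p x * y x) * sqrt (p x * y x))"
        unfolding Pe[OF x] by (simp add: algebra_simps)
      then show "partial 0 p x * partial 0 p x + partial 1 p x * partial 1 p x = p x * y x"
        unfolding rows[OF x] sq[OF x] by simp
      have "partial 0 p x * partial 0 y x + partial 1 p x * partial 1 y x =
          (A x 0 * B x 0 + A x 1 * B x 1) * (sqrt (p x * y x) * y x)"
        unfolding Pe[OF x] Ye[OF x] by (simp add: algebra_simps)
      then show "partial 0 p x * partial 0 y x + partial 1 p x * partial 1 y x = 0" unfolding rows[OF x] by simp
    qed
  qed
qed

lemma Act_in: "Act \<in> polar_nonhyperpolar_actions (CH n)"
  unfolding polar_nonhyperpolar_actions_def hyperpolar_def using polar_G not_flat_section by blast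

text \<open>The action of the identity element serves as the isometry.\<close>

lemma Act_refl: "orbit_equivalent (CH n) Act (CH n) Act"
proof -
  have act1: "act Act (gone n) z = z" if "z \<in> ball_CH n" for z
    using gact_one[OF that] that by (simp add: Gact_def)
  have "act Act (gone n) ` C = C" if "C \<in> orbit_components (CH n) Act" for C
  proof -
    have "C \<subseteq> ball_CH n" using that orbit_iff unfolding orbit_components_eq by blast
    then show ?thesis using act1 by force
  qed
  then have "(\<lambda>C. act Act (gone n) ` C) ` orbit_components (CH n) Act = orbit_components (CH n) Act"
    by simp
  then show ?thesis unfolding orbit_equivalent_def using isometry_act[OF one_in_G] by blast
qed

end

theorem mainTheorem3:
  fixes n :: nat
  assumes "n \<ge> 3"
  shows "uncountable (polar_nonhyperpolar_actions (CH n) // orbit_equivalence (CH n))"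
proof
  assume cnt: "countable (polar_nonhyperpolar_actions (CH n) // orbit_equivalence (CH n))"
  \<comment> \<open>The nonnegative solution of \<open>al\<^sup>2 + be\<^sup>2 = 1\<close> and
    \<open>al\<^sup>2 - be\<^sup>2 = k\<close>, so that the family is indexed by the cosine
    itself.\<close>
  define al be where "al k = sqrt ((1 + k) / 2)" and "be k = sqrt ((1 - k) / 2)" for k :: real
  define A where "A k = Gact n (al k) (be k)" for k
  define c where "c k = orbit_equivalence (CH n) `` {A k}" for k
  have sq: "(al k)\<^sup>2 = (1 + k) / 2" "(be k)\<^sup>2 = (1 - k) / 2" if "k \<in> {0<..<1}" for k
    using that by (simp_all add: al_def be_def)
  have fam: "polar_family n (al k) (be k)" if "k \<in> {0<..<1}" for k
    using assms by unfold_locales (simp_all add: sq[OF that] field_simps)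
  have diff: "(al k)\<^sup>2 - (be k)\<^sup>2 = k" if "k \<in> {0<..<1}" for k
    unfolding sq[OF that] by (simp add: field_simps)
  have mem: "A k \<in> polar_nonhyperpolar_actions (CH n)" if "k \<in> {0<..<1}" for k
    unfolding A_def by (rule polar_family.Act_in[OF fam[OF that]])
  have "inj_on c {0<..<1}"
  proof (rule inj_onI)
    fix k l :: real assume k: "k \<in> {0<..<1}" and l: "l \<in> {0<..<1}" and eq: "c k = c l"
    \<comment> \<open>Reflexivity puts \<open>A l\<close> into its own class; equality of the
      classes then makes \<open>A k\<close> orbit equivalent to \<open>A l\<close>.\<close>
    have "A l \<in> c l"
      using mem[OF l] polar_family.Act_refl[OF fam[OF l]] by (simp add: c_def orbit_equivalence_def A_def)
    then have "orbit_equivalent (CH n) (A k) (CH n) (A l)"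
      unfolding eq[symmetric] by (simp add: c_def orbit_equivalence_def)
    from orbit_equivalent_imp_angle_eq[OF fam[OF k] fam[OF l] _ _ _ _ this[unfolded A_def]]
    show "k = l" using k l unfolding diff[OF k] diff[OF l] by simp
  qed
  moreover have "c ` {0<..<1} \<subseteq> polar_nonhyperpolar_actions (CH n) // orbit_equivalence (CH n)"
    using mem unfolding quotient_def c_def by blast
  then have "countable (c ` {0<..<1})" using cnt countable_subset by blast
  ultimately have "countable {0<..<1::real}" by (rule countable_image_inj_on[rotated])
  then show False using uncountable_open_interval[of 0 "1::real"] by simp
qed

end
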